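(* Let $\alpha,\beta\in(0,1)$. Then the averaging projection $\mathcal{Q}_{\alpha,\beta}$ is a bounded operator on the space $\mathcal{B}(L^2(\mathbb{R}_+))$ of bounded operators and on the space $\boldsymbol{\mathcal{C}}(L^2(\mathbb{R}_+))$ of compact operators.
   Context: $\mathbb{R}_+=(0,\infty)$. $\boldsymbol{S}_1$ and $\boldsymbol{S}_2$ are the trace class and the Hilbert--Schmidt class on $L^2(\mathbb{R}_+)$; $\boldsymbol{S}_2$ is identified with $L^2(\mathbb{R}_+^2)$ via $k\mapsto\mathfrak{I}_k$, $(\mathfrak{I}_kf)(x)=\int_{\mathbb{R}_+}k(x,y)f(y)\,dy$. The spaces $\mathcal{B}(L^2(\mathbb{R}_+))$ and $\boldsymbol{\mathcal{C}}(L^2(\mathbb{R}_+))$ carry the operator norm. For $\alpha,\beta>0$ and a function $\varphi$ on $(0,\infty)$, the distorted Hankel operator $\mathfrak{G}^{\alpha,\beta}_\varphi$ is the integral operator on $L^2(\mathbb{R}_+)$ with kernel $\varphi(x^\alpha+y^\beta)$. The averaging projection $\mathcal{Q}_{\alpha,\beta}$ is the orthogonal projection on the Hilbert space $\boldsymbol{S}_2$ onto the subspace of operators in $\boldsymbol{S}_2$ of the form $\mathfrak{G}^{\alpha,\beta}_\varphi$; equivalently, on kernels, it is the orthogonal projection of $L^2(\mathbb{R}_+^2)$ onto the subspace of functions that are constant on the sets $\{(x,y)\in\mathbb{R}_+^2:\ x^\alpha+y^\beta=c\}$, $c>0$. For $\alpha,\beta\in(0,1)$ the projection $\mathcal{Q}_{\alpha,\beta}$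 maps $\boldsymbol{S}_1$ boundedly into $\boldsymbol{S}_1$. It is extended to $\mathcal{B}(L^2(\mathbb{R}_+))$ by $\mathcal{Q}_{\alpha,\beta}T=\mathcal{Q}_{\alpha,\beta}^*T$, where $\mathcal{Q}_{\alpha,\beta}^*$ is the conjugate of $\mathcal{Q}_{\alpha,\beta}:\boldsymbol{S}_1\to\boldsymbol{S}_1$ with respect to the pairing $\langle T,R\rangle=\operatorname{trace}TR^*$, $T\in\boldsymbol{S}_1$, $R\in\mathcal{B}(L^2(\mathbb{R}_+))$, which identifies $\boldsymbol{S}_1^*$ with $\mathcal{B}(L^2(\mathbb{R}_+))$; this agrees with the original $\mathcal{Q}_{\alpha,\beta}$ on $\boldsymbol{S}_2$. Boundedness on $\boldsymbol{\mathcal{C}}(L^2(\mathbb{R}_+))$ means that this extension maps $\boldsymbol{\mathcal{C}}(L^2(\mathbb{R}_+))$ boundedly into itself. *)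

theory Defs
  imports "HOL-Analysis.Analysis"
begin

section \<open>The complex Hilbert space of square integrable functions on the positive half-line\<close>

definition square_integrable :: "'a measure \<Rightarrow> ('a \<Rightarrow> complex) \<Rightarrow> bool" where
  "square_integrable M f \<longleftrightarrow>
     f \<in> borel_measurable M \<and> integrable M (\<lambda>x. (cmod (f x))\<^sup>2)"

lemma square_integrable_0 [simp]: "square_integrable M (\<lambda>x. 0)"
  by (simp add: square_integrable_def)

lemma square_integrable_scale:
  assumes "square_integrable M f"
  shows "square_integrable M (\<lambda>x. c * f x)"
  using assms by (auto simp: square_integrable_def norm_mult power_mult_distrib)

lemma square_integrable_mult_cnj:
  assumes "square_integrable M f" "square_integrable M g"
  shows "integrable M (\<lambda>x. f x * cnj (g x))"
proof (rule Bochner_Integration.integrable_bound)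
  show "integrable M (\<lambda>x. (cmod (f x))\<^sup>2 + (cmod (g x))\<^sup>2)"
    using assms by (auto simp: square_integrable_def)
  have [measurable]: "f \<in> borel_measurable M" "g \<in> borel_measurable M"
    using assms by (auto simp: square_integrable_def)
  show "(\<lambda>x. f x * cnj (g x)) \<in> borel_measurable M"
    by (intro borel_measurable_times borel_measurable_continuous_on[where f = cnj])
       (auto intro: continuous_intros)
  have "a * b \<le> a\<^sup>2 + b\<^sup>2" if "a \<ge> 0" "b \<ge> 0" for a b :: real
    using sum_squares_bound[of a b] mult_nonneg_nonneg[OF that] by linarith
  then show "AE x in M. norm (f x * cnj (g x)) \<le> norm ((cmod (f x))\<^sup>2 + (cmod (g x))\<^sup>2)"
    by (simp add: norm_mult)
qed

lemma square_integrable_add: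
  assumes "square_integrable M f" "square_integrable M g"
  shows "square_integrable M (\<lambda>x. f x + g x)"
proof -
  have [measurable]: "f \<in> borel_measurable M" "g \<in> borel_measurable M"
    using assms by (auto simp: square_integrable_def)
  have "integrable M (\<lambda>x. (cmod (f x + g x))\<^sup>2)"
  proof (rule Bochner_Integration.integrable_bound)
    show "integrable M (\<lambda>x. 2 * (cmod (f x))\<^sup>2 + 2 * (cmod (g x))\<^sup>2)"
      using assms by (auto simp: square_integrable_def)
    have "(cmod (a + b))\<^sup>2 \<le> 2 * (cmod a)\<^sup>2 + 2 * (cmod b)\<^sup>2" for a b
    proof -
      have "(cmod (a + b))\<^sup>2 \<le> (cmod a + cmod b)\<^sup>2"
        by (intro power_mono norm_triangle_ineq) auto
      also have "\<dots> \<le> 2 * (cmod a)\<^sup>2 + 2 * (cmod b)\<^sup>2"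
        using sum_squares_bound[of "cmod a" "cmod b"] by (simp add: power2_sum)
      finally show ?thesis .
    qed
    then show "AE x in M. norm ((cmod (f x + g x))\<^sup>2)
        \<le> norm (2 * (cmod (f x))\<^sup>2 + 2 * (cmod (g x))\<^sup>2)"
      by simp
  qed measurable
  then show ?thesis
    by (simp add: square_integrable_def)
qed

definition lborel_pos :: "real measure" where
  "lborel_pos = restrict_space lborel {0<..}"

text \<open>
  Equality almost everywhere on the half-line; values outside the half-line are irrelevant.  Using
  Borel instead of Lebesgue measurable representatives does not change the quotient.
\<close>

definition ae_rel :: "(real \<Rightarrow> complex) \<Rightarrow> (real \<Rightarrow> complex) \<Rightarrow> bool" where
  "ae_rel f g \<longleftrightarrow> square_integrable lborel_pos f \<and> square_integrable lborel_pos g \<and>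
     (AE x in lborel_pos. f x = g x)"

lemma part_equivp_ae_rel: "part_equivp ae_rel"
proof (rule part_equivpI)
  show "\<exists>x. ae_rel x x"
    by (rule exI[of _ "\<lambda>x. 0"]) (simp add: ae_rel_def)
  show "symp ae_rel"
    by (rule sympI) (auto simp: ae_rel_def elim: eventually_mono)
  show "transp ae_rel"
    by (rule transpI) (auto simp: ae_rel_def elim: eventually_elim2)
qed

quotient_type l2 = "real \<Rightarrow> complex" / partial: ae_rel
  by (rule part_equivp_ae_rel)

lift_definition scaleC :: "complex \<Rightarrow> l2 \<Rightarrow> l2" (infixr "*\<^sub>C" 75)
  is "\<lambda>c f x. c * f x"
  by (auto simp: ae_rel_def intro: square_integrable_scale)

text \<open>The inner product is linear in the first argument.\<close>

lift_definition cinner :: "l2 \<Rightarrow> l2 \<Rightarrow> complex"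
  is "\<lambda>f g. LINT x|lborel_pos. f x * cnj (g x)"
proof -
  fix f f' g g'
  assume "ae_rel f f'" "ae_rel g g'"
  then show "(LINT x|lborel_pos. f x * cnj (g x)) = (LINT x|lborel_pos. f' x * cnj (g' x))"
    unfolding ae_rel_def
    by (intro integral_cong_AE)
       (auto dest: square_integrable_mult_cnj[THEN borel_measurable_integrable]
             elim: eventually_elim2)
qed

instantiation l2 :: real_vector
begin

lift_definition zero_l2 :: l2 is "\<lambda>x. 0"
  by (simp add: ae_rel_def)

lift_definition plus_l2 :: "l2 \<Rightarrow> l2 \<Rightarrow> l2" is "\<lambda>f g x. f x + g x"
  by (auto simp: ae_rel_def intro: square_integrable_add elim: eventually_elim2)

lift_definition uminus_l2 :: "l2 \<Rightarrow> l2" is "\<lambda>f x. - f x"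
  using square_integrable_scale[where c = "-1"] by (auto simp: ae_rel_def)

definition minus_l2 :: "l2 \<Rightarrow> l2 \<Rightarrow> l2" where
  "minus_l2 f g = f + (- g)"

definition scaleR_l2 :: "real \<Rightarrow> l2 \<Rightarrow> l2" where
  "scaleR_l2 r f = complex_of_real r *\<^sub>C f"

instance
proof
  fix a b c :: l2 and r s :: real
  show "a + b + c = a + (b + c)"
    by transfer (auto simp: ae_rel_def add.assoc intro!: square_integrable_add)
  show "a + b = b + a"
    by transfer (auto simp: ae_rel_def add.commute intro!: square_integrable_add)
  show "0 + a = a"
    by transfer (auto simp: ae_rel_def)
  show "- a + a = 0"
    by transfer (auto simp: ae_rel_def)
  show "a - b = a + - b"
    by (simp add: minus_l2_def)
  show "r *\<^sub>R (a + b) = r *\<^sub>R a + r *\<^sub>R b"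
    unfolding scaleR_l2_def
    by transfer (auto simp: ae_rel_def distrib_left distrib_right
                      intro!: square_integrable_add square_integrable_scale)
  show "(r + s) *\<^sub>R a = r *\<^sub>R a + s *\<^sub>R a"
    unfolding scaleR_l2_def
    by transfer (auto simp: ae_rel_def distrib_left distrib_right
                      intro!: square_integrable_add square_integrable_scale)
  show "r *\<^sub>R s *\<^sub>R a = (r * s) *\<^sub>R a"
    unfolding scaleR_l2_def
    by transfer (auto simp: ae_rel_def mult.assoc intro!: square_integrable_scale)
  show "1 *\<^sub>R a = a"
    unfolding scaleR_l2_def by transfer (auto simp: ae_rel_def)
qed

end

lemma cinner_add_left: "cinner (f + g) h = cinner f h + cinner g h"
  by transfer (auto simp: ae_rel_def algebra_simps square_integrable_mult_cnj)

lemma cinner_scaleC_left: "cinner (c *\<^sub>C f) g = c * cinner f g"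
  by transfer (auto simp: ae_rel_def mult.assoc)

lemma cinner_commute: "cinner f g = cnj (cinner g f)"
proof transfer
  fix f g :: "real \<Rightarrow> complex"
  have "cnj (LINT x|lborel_pos. g x * cnj (f x)) = (LINT x|lborel_pos. cnj (g x * cnj (f x)))"
    by (rule Bochner_Integration.integral_cnj [symmetric])
  also have "\<dots> = (LINT x|lborel_pos. f x * cnj (g x))"
    by (simp add: mult.commute)
  finally show "(LINT x|lborel_pos. f x * cnj (g x)) = cnj (LINT x|lborel_pos. g x * cnj (f x))"
    by (rule sym)
qed

lemma cinner_self_ge_0: "Re (cinner f f) \<ge> 0"
proof transfer
  fix f
  assume "ae_rel f f"
  then have "integrable lborel_pos (\<lambda>x. f x * cnj (f x))"
    by (auto simp: ae_rel_def intro: square_integrable_mult_cnj)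
  from integral_Re[OF this]
  have "Re (LINT x|lborel_pos. f x * cnj (f x)) = (LINT x|lborel_pos. Re (f x * cnj (f x)))"
    by simp
  also have "\<dots> \<ge> 0"
    by (rule integral_nonneg_AE) simp
  finally show "0 \<le> Re (LINT x|lborel_pos. f x * cnj (f x))" .
qed

lemma cinner_self_eq_0_iff: "Re (cinner f f) = 0 \<longleftrightarrow> f = 0"
proof transfer
  fix f
  assume f: "ae_rel f f"
  then have sq: "square_integrable lborel_pos f"
    by (simp add: ae_rel_def)
  have "Re (LINT x|lborel_pos. f x * cnj (f x)) = (LINT x|lborel_pos. (cmod (f x))\<^sup>2)"
    using integral_Re[OF square_integrable_mult_cnj[OF sq sq]]
    by (simp add: cmod_power2 flip: power2_eq_square)
  also have "\<dots> = 0 \<longleftrightarrow> (AE x in lborel_pos. (cmod (f x))\<^sup>2 = 0)"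
    using sq by (intro integral_nonneg_eq_0_iff_AE) (auto simp: square_integrable_def)
  also have "\<dots> \<longleftrightarrow> ae_rel f (\<lambda>x. 0)"
    using sq by (auto simp: ae_rel_def)
  finally show "Re (LINT x|lborel_pos. f x * cnj (f x)) = 0 \<longleftrightarrow> ae_rel f (\<lambda>x. 0)" .
qed

text \<open>
  The real inner product is the real part of the complex one, so that norm, metric and topology
  are those of the complex Hilbert space.
\<close>

instantiation l2 :: real_inner
begin

definition inner_l2 :: "l2 \<Rightarrow> l2 \<Rightarrow> real" where
  "inner_l2 f g = Re (cinner f g)"

definition norm_l2 :: "l2 \<Rightarrow> real" where
  "norm_l2 f = sqrt (inner f f)"

definition sgn_l2 :: "l2 \<Rightarrow> l2" where
  "sgn_l2 f = f /\<^sub>R norm f"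

definition dist_l2 :: "l2 \<Rightarrow> l2 \<Rightarrow> real" where
  "dist_l2 f g = norm (f - g)"

definition uniformity_l2 :: "(l2 \<times> l2) filter" where
  "uniformity_l2 = (INF e\<in>{0<..}. principal {(f, g). dist f g < e})"

definition open_l2 :: "l2 set \<Rightarrow> bool" where
  "open_l2 U \<longleftrightarrow> (\<forall>f\<in>U. eventually (\<lambda>(f', g). f' = f \<longrightarrow> g \<in> U) uniformity)"

instance
proof
  fix f g h :: l2 and r :: real and U :: "l2 set"
  show "dist f g = norm (f - g)" by (rule dist_l2_def)
  show "sgn f = f /\<^sub>R norm f" by (rule sgn_l2_def)
  show "uniformity = (INF e\<in>{0<..}. principal {(f, g :: l2). dist f g < e})"
    by (rule uniformity_l2_def)
  show "open U \<longleftrightarrow> (\<forall>f\<in>U. eventually (\<lambda>(f', g). f' = f \<longrightarrow> g \<in> U) uniformity)"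
    by (rule open_l2_def)
  show "inner f g = inner g f"
    using cinner_commute[of f g] by (simp add: inner_l2_def)
  show "inner (f + g) h = inner f h + inner g h"
    by (simp add: inner_l2_def cinner_add_left)
  show "inner (r *\<^sub>R f) g = r * inner f g"
    by (simp add: inner_l2_def scaleR_l2_def cinner_scaleC_left)
  show "0 \<le> inner f f"
    by (simp add: inner_l2_def cinner_self_ge_0)
  show "inner f f = 0 \<longleftrightarrow> f = 0"
    by (simp add: inner_l2_def cinner_self_eq_0_iff)
  show "norm f = sqrt (inner f f)"
    by (rule norm_l2_def)
qed

end


section \<open>Operators and Schatten classes\<close>

definition bounded_ops :: "(l2 \<Rightarrow> l2) set" where
  "bounded_ops = {T. bounded_linear T \<and> (\<forall>c f. T (c *\<^sub>C f) = c *\<^sub>C T f)}"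

definition compact_ops :: "(l2 \<Rightarrow> l2) set" where
  "compact_ops = {T \<in> bounded_ops. compact (closure (T ` cball 0 1))}"

definition rank_at_most :: "nat \<Rightarrow> (l2 \<Rightarrow> l2) \<Rightarrow> bool" where
  "rank_at_most n T \<longleftrightarrow> (\<exists>v :: nat \<Rightarrow> l2. \<forall>f. \<exists>c :: nat \<Rightarrow> complex. T f = (\<Sum>i<n. c i *\<^sub>C v i))"

definition singular_value :: "nat \<Rightarrow> (l2 \<Rightarrow> l2) \<Rightarrow> real" where
  "singular_value n T = Inf {onorm (\<lambda>f. T f - K f) | K. K \<in> bounded_ops \<and> rank_at_most n K}"

text \<open>Only \<open>p = 1\<close> (trace class) and \<open>p = 2\<close> (Hilbert--Schmidt class) are used.\<close>

definition schatten_class :: "nat \<Rightarrow> (l2 \<Rightarrow> l2) set" where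
  "schatten_class p = {T \<in> bounded_ops. summable (\<lambda>n. singular_value n T ^ p)}"

definition orthonormal_basis :: "(nat \<Rightarrow> l2) \<Rightarrow> bool" where
  "orthonormal_basis e \<longleftrightarrow> (\<forall>m n. cinner (e m) (e n) = (if m = n then 1 else 0)) \<and>
     (\<forall>f. (\<forall>n. cinner f (e n) = 0) \<longrightarrow> f = 0)"

text \<open>
  The common value of the diagonal sums over all orthonormal bases; meaningful for trace class
  operators.
\<close>

definition op_trace :: "(l2 \<Rightarrow> l2) \<Rightarrow> complex" where
  "op_trace T = (THE t. \<forall>e. orthonormal_basis e \<longrightarrow> (\<lambda>n. cinner (T (e n)) (e n)) sums t)"

definition adjoint_op :: "(l2 \<Rightarrow> l2) \<Rightarrow> l2 \<Rightarrow> l2" where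
  "adjoint_op T = (THE S. \<forall>f g. cinner (T f) g = cinner f (S g))"

text \<open>
  This is both the pairing of the trace class with the bounded operators and the inner product of
  the Hilbert--Schmidt class.
\<close>

definition trace_pairing :: "(l2 \<Rightarrow> l2) \<Rightarrow> (l2 \<Rightarrow> l2) \<Rightarrow> complex" where
  "trace_pairing T R = op_trace (T \<circ> adjoint_op R)"


section \<open>Distorted Hankel operators and the averaging projection\<close>

text \<open>
  The integral does not depend on the representative of \<open>f\<close>.  For a kernel that is square
  integrable on the quadrant the resulting function is square integrable, so that
  \<^const>\<open>abs_l2\<close> is applied to an element of the domain of \<^const>\<open>ae_rel\<close>.
\<close>

definition integral_op :: "(real \<times> real \<Rightarrow> complex) \<Rightarrow> l2 \<Rightarrow> l2" where
  "integral_op k f = abs_l2 (\<lambda>x. LINT y|lborel_pos. k (x, y) * rep_l2 f y)"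

definition distorted_kernel :: "real \<Rightarrow> real \<Rightarrow> (real \<Rightarrow> complex) \<Rightarrow> real \<times> real \<Rightarrow> complex" where
  "distorted_kernel \<alpha> \<beta> \<phi> = (\<lambda>(x, y). \<phi> (x powr \<alpha> + y powr \<beta>))"

definition distorted_hankel :: "real \<Rightarrow> real \<Rightarrow> (real \<Rightarrow> complex) \<Rightarrow> l2 \<Rightarrow> l2" where
  "distorted_hankel \<alpha> \<beta> \<phi> = integral_op (distorted_kernel \<alpha> \<beta> \<phi>)"

text \<open>
  An integral operator is Hilbert--Schmidt if and only if its kernel is square integrable; the
  condition on the kernel only excludes values of \<^const>\<open>integral_op\<close> at functions that
  are not kernels of Hilbert--Schmidt operators.
\<close>

definition hs_distorted_hankel :: "real \<Rightarrow> real \<Rightarrow> (l2 \<Rightarrow> l2) set" where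
  "hs_distorted_hankel \<alpha> \<beta> = {T \<in> schatten_class 2. \<exists>\<phi>.
     square_integrable (lborel_pos \<Otimes>\<^sub>M lborel_pos) (distorted_kernel \<alpha> \<beta> \<phi>) \<and>
     T = distorted_hankel \<alpha> \<beta> \<phi>}"

text \<open>The orthogonal projection of the Hilbert--Schmidt class onto the subspace above.\<close>

definition averaging_projection_hs :: "real \<Rightarrow> real \<Rightarrow> (l2 \<Rightarrow> l2) \<Rightarrow> (l2 \<Rightarrow> l2)" where
  "averaging_projection_hs \<alpha> \<beta> T = (THE P. P \<in> hs_distorted_hankel \<alpha> \<beta> \<and>
     (\<forall>G \<in> hs_distorted_hankel \<alpha> \<beta>. trace_pairing (\<lambda>f. T f - P f) G = 0))"

text \<open>
  The extension to bounded operators: the conjugate, with respect to \<^const>\<open>trace_pairing\<close>,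
  of the restriction of \<^const>\<open>averaging_projection_hs\<close> to the trace class.
\<close>

definition averaging_projection :: "real \<Rightarrow> real \<Rightarrow> (l2 \<Rightarrow> l2) \<Rightarrow> (l2 \<Rightarrow> l2)" where
  "averaging_projection \<alpha> \<beta> R = (THE X. X \<in> bounded_ops \<and>
     (\<forall>T \<in> schatten_class 1.
        trace_pairing T X = trace_pairing (averaging_projection_hs \<alpha> \<beta> T) R))"

definition bounded_operator_on :: "(l2 \<Rightarrow> l2) set \<Rightarrow> ((l2 \<Rightarrow> l2) \<Rightarrow> (l2 \<Rightarrow> l2)) \<Rightarrow> bool" where
  "bounded_operator_on V \<Phi> \<longleftrightarrow>
     (\<forall>T\<in>V. \<Phi> T \<in> V) \<and>
     (\<forall>S\<in>V. \<forall>T\<in>V. \<Phi> (\<lambda>f. S f + T f) = (\<lambda>f. \<Phi> S f + \<Phi> T f)) \<and>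
     (\<forall>c. \<forall>T\<in>V. \<Phi> (\<lambda>f. c *\<^sub>C T f) = (\<lambda>f. c *\<^sub>C \<Phi> T f)) \<and>
     (\<exists>C. \<forall>T\<in>V. onorm (\<Phi> T) \<le> C * onorm T)"

end

(*
  For z = sigma + i tau in the right half-plane put e_z(x) = exp(-conj(z) x^alpha) and
  d_z(y) = exp(-z y^beta).  The projection is the superposition

    Q R = int <R d_z, e_z> e_z (x) d_z dV(z),     dV(z) = c sigma^(m-1) dsigma dtau,  m = 1/alpha + 1/beta - 1,

  since e_z (x) d_z has the kernel exp(-conj(z) (x^alpha + y^beta)), a function of x^alpha + y^beta.

  Substituting u = x^alpha, Plancherel in tau and then the Gamma integral in sigma give
  int int sigma^(1/alpha-2) |<f, e_z>|^2 dtau dsigma <= C |f|^2; the Gamma integral has exponent 1/alpha - 1,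
  so alpha < 1 is needed exactly here.  As |<R d_z, e_z>| <= |R| |e_z| |d_z|, Cauchy-Schwarz bounds the
  sesquilinear form of Q R by a multiple of |R| |f| |g|.

  That Q fixes distorted Hankel operators reduces to the cut-off symbols exp(-t) 1_{t <= q}, q rational,
  whose transforms are explicit, so that Fourier inversion in tau applies for each sigma.  The form
  <Q T, R> = <T, Q R> is symmetric, and Q T is a Hilbert-Schmidt distorted Hankel operator for nuclear T;
  together these identify Q with the orthogonal projection on the trace class and with its adjoint on
  bounded operators.  Finite-rank operators go to Hilbert-Schmidt ones, so by boundedness compact operators
  go to compact ones.
*)

theory Submission
  imports Defs "HOL-Probability.Characteristic_Functions"
begin

section \<open>The Hilbert space\<close>

text \<open>By \<open>integral_level_fun\<close>, functions constant on the level sets form the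
  space L2(B t^m dt), which the Laplace transform identifies with the Bergman space of the right
  half-plane for a multiple of the weight \<sigma>^(m-1). The superposition is the resolution of the
  identity in that space; this is the origin of m and of the constant c. A general bounded operator
  has no kernel to average over level sets. The superposition uses only the numbers <R d_z, e_z>, so
  one formula serves trace class, compact and bounded operators alike. Traces, adjoints and both
  projections are definite descriptions, so each needs existence and uniqueness. Since the trace
  class is given by approximation numbers and a trace by the diagonal sums in every basis, a trace
  class operator is first written as an absolutely convergent series of rank-one operators. Traces
  then become integrals, and the symmetry of the form becomes Fubini's theorem. Fourier inversion at
  fixed \<sigma> is run only on cut-offs because a general symbol is neither bounded nor continuous,
  while a cut-off is bounded and jumps at a single level.\<close>

lemma cinner_add_right: "cinner f (g + h) = cinner f g + cinner f h"
  by (metis cinner_add_left cinner_commute complex_cnj_add)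

lemma cinner_scaleC_right: "cinner f (c *\<^sub>C g) = cnj c * cinner f g"
  by (metis cinner_scaleC_left cinner_commute complex_cnj_mult)

lemma cinner_zero_left [simp]: "cinner 0 g = 0"
  using cinner_add_left[of 0 0 g] by simp

lemma cinner_zero_right [simp]: "cinner f 0 = 0"
  using cinner_add_right[of f 0 0] by simp

lemma cinner_minus_left: "cinner (- f) g = - cinner f g"
  using cinner_add_left[of f "- f" g] by (simp add: minus_unique)

lemma cinner_minus_right: "cinner f (- g) = - cinner f g"
  using cinner_add_right[of f g "- g"] by (simp add: minus_unique)

lemma cinner_diff_left: "cinner (f - g) h = cinner f h - cinner g h"
  using cinner_add_left[of f "- g" h] by (simp add: cinner_minus_left)

lemma cinner_diff_right: "cinner f (g - h) = cinner f g - cinner f h"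
  using cinner_add_right[of f g "- h"] by (simp add: cinner_minus_right)

lemma cinner_sum_left: "cinner (\<Sum>i\<in>A. f i) g = (\<Sum>i\<in>A. cinner (f i) g)"
  by (induction A rule: infinite_finite_induct) (auto simp: cinner_add_left)

lemma cinner_sum_right: "cinner f (\<Sum>i\<in>A. g i) = (\<Sum>i\<in>A. cinner f (g i))"
  by (induction A rule: infinite_finite_induct) (auto simp: cinner_add_right)

lemma cinner_scaleR_left: "cinner (r *\<^sub>R f) g = of_real r * cinner f g"
  by (simp add: scaleR_l2_def cinner_scaleC_left)

lemma cinner_scaleR_right: "cinner f (r *\<^sub>R g) = of_real r * cinner f g"
  by (simp add: scaleR_l2_def cinner_scaleC_right)

lemma power2_norm_l2: "(norm f)\<^sup>2 = Re (cinner f f)" for f :: l2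
  using power2_norm_eq_inner[of f] by (simp add: inner_l2_def)

lemma cinner_self: "cinner f f = of_real ((norm f)\<^sup>2)"
proof -
  have "Im (cinner f f) = 0"
    using arg_cong[OF cinner_commute[of f f], of Im] by simp
  then show ?thesis
    by (simp add: complex_eq_iff power2_norm_l2)
qed

text \<open>Nondegeneracy: the difference of f and g is orthogonal to itself. Vector and operator
  identities below are mostly checked weakly through this rule and its mirror image, so that
  representatives seldom have to be unfolded.\<close>

lemma l2_eqI: "(\<And>h. cinner f h = cinner g h) \<Longrightarrow> f = g"
  by (metis cinner_diff_left cinner_self cinner_self_eq_0_iff diff_self eq_iff_diff_eq_0 zero_complex.simps(1))

lemma l2_eqI_right: "(\<And>h. cinner h f = cinner h g) \<Longrightarrow> f = g"
  by (metis cinner_commute l2_eqI)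

lemma scaleC_add_right: "c *\<^sub>C (f + g) = c *\<^sub>C f + c *\<^sub>C g"
  by (rule l2_eqI) (simp add: cinner_add_left cinner_scaleC_left algebra_simps)

lemma scaleC_add_left: "(c + d) *\<^sub>C f = c *\<^sub>C f + d *\<^sub>C f"
  by (rule l2_eqI) (simp add: cinner_add_left cinner_scaleC_left algebra_simps)

lemma scaleC_scaleC [simp]: "c *\<^sub>C d *\<^sub>C f = (c * d) *\<^sub>C f"
  by (rule l2_eqI) (simp add: cinner_scaleC_left)

lemma scaleC_zero_left [simp]: "0 *\<^sub>C f = 0"
  by (rule l2_eqI) (simp add: cinner_scaleC_left)

lemma scaleC_zero_right [simp]: "c *\<^sub>C 0 = 0"
  by (rule l2_eqI) (simp add: cinner_scaleC_left)

lemma scaleC_sum_right: "c *\<^sub>C (\<Sum>i\<in>A. f i) = (\<Sum>i\<in>A. c *\<^sub>C f i)"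
  by (rule l2_eqI) (simp add: cinner_sum_left cinner_scaleC_left sum_distrib_left)

lemma norm_scaleC [simp]: "norm (c *\<^sub>C f) = cmod c * norm f"
proof -
  have "cinner (c *\<^sub>C f) (c *\<^sub>C f) = (c * cnj c) * cinner f f"
    by (simp add: cinner_scaleC_left cinner_scaleC_right)
  also have "\<dots> = of_real ((cmod c * norm f)\<^sup>2)"
    by (simp add: cinner_self power_mult_distrib flip: complex_norm_square)
  finally have "(norm (c *\<^sub>C f))\<^sup>2 = (cmod c * norm f)\<^sup>2"
    by (simp only: power2_norm_l2[of "c *\<^sub>C f"] Re_complex_of_real)
  then show ?thesis
    by simp
qed

lemma cinner_cauchy_schwarz: "cmod (cinner f g) \<le> norm f * norm g"
proof (cases "cinner f g = 0")
  case False
  \<comment> \<open>A unimodular factor rotates the inner product onto the positive axis, where it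
    equals its real part and the real Cauchy--Schwarz inequality applies.\<close>
  define c where "c = cnj (sgn (cinner f g))"
  have "cmod (cinner f g) = Re (c * cinner f g)"
    using False by (simp add: c_def sgn_eq complex_norm_square[symmetric] mult.commute
        power2_eq_square flip: of_real_mult)
  also have "\<dots> = inner (c *\<^sub>C f) g"
    by (simp add: inner_l2_def cinner_scaleC_left)
  also have "\<dots> \<le> norm (c *\<^sub>C f) * norm g"
    by (rule norm_cauchy_schwarz)
  also have "\<dots> = norm f * norm g"
    using False by (simp add: c_def norm_sgn)
  finally show ?thesis .
qed simp

lemma bounded_linear_cinner_left: "bounded_linear (\<lambda>f. cinner f g)"
  by (rule bounded_linear_intro[where K = "norm g"])
     (auto simp: cinner_add_left cinner_scaleR_left scaleR_conv_of_real cinner_cauchy_schwarz)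

lemma bounded_linear_cinner_right: "bounded_linear (\<lambda>g. cinner f g)"
  by (rule bounded_linear_intro[where K = "norm f"])
     (auto simp: cinner_add_right cinner_scaleR_right scaleR_conv_of_real cinner_cauchy_schwarz
        mult.commute[of _ "norm f"])

lemma norm_le_of_cinner_le:
  assumes "\<And>h. cmod (cinner f h) \<le> C * norm h" "0 \<le> C"
  shows "norm f \<le> C"
proof (cases "f = 0")
  case False
  have "norm f * norm f \<le> C * norm f"
    using assms(1)[of f] by (simp add: cinner_self power2_eq_square flip: of_real_mult)
  then show ?thesis
    using False by simp
qed (use assms in simp)

section \<open>The half-line measure and representatives of L2 classes\<close>

lemma space_lborel_pos [simp]: "space lborel_pos = {0<..}"
  by (simp add: lborel_pos_def space_restrict_space)

lemma sets_lborel_pos: "sets lborel_pos = sets (restrict_space borel {0<..})"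
  by (simp add: lborel_pos_def sets_restrict_space)

lemma borel_measurable_lborel_pos:
  "f \<in> borel_measurable borel \<Longrightarrow> f \<in> borel_measurable lborel_pos"
  unfolding measurable_cong_sets[OF sets_lborel_pos refl] by (rule measurable_restrict_space1)

lemma measurable_ident_lborel_pos [measurable]: "(\<lambda>x. x) \<in> lborel_pos \<rightarrow>\<^sub>M borel"
  by (rule borel_measurable_lborel_pos) simp

interpretation lborel_pos: sigma_finite_measure lborel_pos
  unfolding lborel_pos_def by (rule sigma_finite_measure_restrict_space) (auto intro: lborel.sigma_finite_measure_axioms)

interpretation lborel_pos2: pair_sigma_finite lborel_pos lborel_pos ..

lemma nn_integral_lborel_pos:
  "(\<integral>\<^sup>+x. f x \<partial>lborel_pos) = (\<integral>\<^sup>+x. f x * indicator {0<..} x \<partial>lborel)"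
  unfolding lborel_pos_def by (subst nn_integral_restrict_space) auto

lemma ae_rel_rep: "ae_rel (rep_l2 f) (rep_l2 f)"
  using Quotient3_rep_reflp[OF Quotient3_l2] by simp

lemma square_integrable_rep [simp]: "square_integrable lborel_pos (rep_l2 f)"
  using ae_rel_rep[of f] by (simp add: ae_rel_def)

lemma rep_l2_measurable [measurable]: "rep_l2 f \<in> borel_measurable lborel_pos"
  using square_integrable_rep[of f] by (simp only: square_integrable_def)

lemma abs_rep_l2 [simp]: "abs_l2 (rep_l2 f) = f"
  by (rule Quotient3_abs_rep[OF Quotient3_l2])

lemma ae_rel_self_iff: "ae_rel f f \<longleftrightarrow> square_integrable lborel_pos f"
  by (simp add: ae_rel_def)

lemma abs_l2_eq_iff:
  assumes "square_integrable lborel_pos f" "square_integrable lborel_pos g"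
  shows "abs_l2 f = abs_l2 g \<longleftrightarrow> (AE x in lborel_pos. f x = g x)"
  using Quotient3_rel[OF Quotient3_l2, of f g] assms by (auto simp: ae_rel_def)

lemma rep_abs_l2:
  assumes "square_integrable lborel_pos f"
  shows "AE x in lborel_pos. rep_l2 (abs_l2 f) x = f x"
  using assms by (subst abs_l2_eq_iff[symmetric]) auto

lemma cinner_abs_l2:
  assumes "square_integrable lborel_pos f" "square_integrable lborel_pos g"
  shows "cinner (abs_l2 f) (abs_l2 g) = (LINT x|lborel_pos. f x * cnj (g x))"
  by (rule cinner.abs_eq) (use assms in \<open>simp_all add: ae_rel_self_iff\<close>)

lemma add_abs_l2:
  assumes "square_integrable lborel_pos f" "square_integrable lborel_pos g"
  shows "abs_l2 f + abs_l2 g = abs_l2 (\<lambda>x. f x + g x)"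
  by (rule plus_l2.abs_eq) (use assms in \<open>simp_all add: ae_rel_self_iff\<close>)

lemma scaleC_abs_l2:
  assumes "square_integrable lborel_pos f"
  shows "c *\<^sub>C abs_l2 f = abs_l2 (\<lambda>x. c * f x)"
  by (rule scaleC.abs_eq) (use assms in \<open>simp_all add: ae_rel_self_iff\<close>)

text \<open>\<open>rep_l2\<close> picks a representative of each class without regard to the vector
  space structure, so linearity survives only almost everywhere.\<close>

lemma rep_l2_add: "AE x in lborel_pos. rep_l2 (f + g) x = rep_l2 f x + rep_l2 g x"
  using rep_abs_l2[OF square_integrable_add[OF square_integrable_rep square_integrable_rep, of f g]]
  by (simp flip: add_abs_l2)

lemma rep_l2_scaleC: "AE x in lborel_pos. rep_l2 (c *\<^sub>C f) x = c * rep_l2 f x"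
  using rep_abs_l2[OF square_integrable_scale[OF square_integrable_rep, of c f]]
  by (simp flip: scaleC_abs_l2)

lemma rep_l2_diff: "AE x in lborel_pos. rep_l2 (f - g) x = rep_l2 f x - rep_l2 g x"
  using rep_l2_add[of f "(-1) *\<^sub>C g"] rep_l2_scaleC[of "-1" g]
proof eventually_elim
  case (elim x)
  moreover have "f + (-1) *\<^sub>C g = f - g"
    by (rule l2_eqI) (simp add: cinner_add_left cinner_scaleC_left cinner_diff_left)
  ultimately show ?case
    by simp
qed

lemma norm_abs_l2:
  assumes "square_integrable lborel_pos f"
  shows "(norm (abs_l2 f))\<^sup>2 = (LINT x|lborel_pos. (cmod (f x))\<^sup>2)"
  using integral_Re[OF square_integrable_mult_cnj[OF assms assms]]
  by (simp add: power2_norm_l2 cinner_abs_l2[OF assms assms] cmod_power2 flip: power2_eq_square)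

lemma norm_rep_l2: "(norm f)\<^sup>2 = (LINT x|lborel_pos. (cmod (rep_l2 f x))\<^sup>2)" for f :: l2
  using norm_abs_l2[of "rep_l2 f"] by simp

lemma nn_integral_square_integrable:
  assumes "square_integrable M f"
  shows "(\<integral>\<^sup>+x. ennreal ((cmod (f x))\<^sup>2) \<partial>M) = ennreal (LINT x|M. (cmod (f x))\<^sup>2)"
  using assms by (intro nn_integral_eq_integral) (auto simp: square_integrable_def)

lemma nn_integral_rep_l2:
  "(\<integral>\<^sup>+x. ennreal ((cmod (rep_l2 f x))\<^sup>2) \<partial>lborel_pos) = ennreal ((norm f)\<^sup>2)"
  by (simp add: nn_integral_square_integrable norm_rep_l2)

lemma square_integrable_iff_nn:
  assumes "f \<in> borel_measurable M"
  shows "square_integrable M f \<longleftrightarrow> (\<integral>\<^sup>+x. ennreal ((cmod (f x))\<^sup>2) \<partial>M) < \<infinity>"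
  using assms by (auto simp: square_integrable_def integrable_iff_bounded)

lemma nn_integral_diff_l2:
  "(\<integral>\<^sup>+x. ennreal ((cmod (rep_l2 f x - rep_l2 g x))\<^sup>2) \<partial>lborel_pos) = ennreal ((norm (f - g))\<^sup>2)"
proof -
  have "(\<integral>\<^sup>+x. ennreal ((cmod (rep_l2 f x - rep_l2 g x))\<^sup>2) \<partial>lborel_pos)
      = (\<integral>\<^sup>+x. ennreal ((cmod (rep_l2 (f - g) x))\<^sup>2) \<partial>lborel_pos)"
    by (rule nn_integral_cong_AE) (use rep_l2_diff[of f g] in \<open>auto elim: eventually_mono\<close>)
  then show ?thesis
    by (simp add: nn_integral_rep_l2)
qed

section \<open>Completeness of L2\<close>

lemma power2_half_power: "((1 / 2) ^ n)\<^sup>2 = (1 / 4 :: real) ^ n"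
proof -
  have "((1 / 2) ^ n)\<^sup>2 = ((1 / 2)\<^sup>2 :: real) ^ n"
    by (simp only: power_mult[symmetric] mult.commute)
  then show ?thesis
    by (simp add: power2_eq_square)
qed

text \<open>The terms of a convergent series are bounded, so the n-th increment is at most a
  constant times 2^(-n/2), a geometric majorant. The factor 2^n is affordable because in the
  application the squared increments integrate to at most 4^(-n).\<close>

lemma convergent_of_geometric_increments:
  fixes F :: "nat \<Rightarrow> 'a::banach"
  assumes "(\<Sum>n. ennreal (2 ^ n * (norm (F (Suc n) - F n))\<^sup>2)) \<noteq> \<infinity>"
  shows "convergent F"
proof -
  define D where "D n = norm (F (Suc n) - F n)" for n
  have "summable (\<lambda>n. 2 ^ n * (D n)\<^sup>2)"
    using assms unfolding D_def by (intro summable_suminf_not_top) auto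
  then have "bounded (range (\<lambda>n. 2 ^ n * (D n)\<^sup>2))"
    by (rule convergent_imp_bounded[OF summable_LIMSEQ_zero])
  then obtain C where C: "2 ^ n * (D n)\<^sup>2 \<le> C" for n
    by (force simp: bounded_iff)
  have D: "D n \<le> sqrt C * (1 / sqrt 2) ^ n" for n
  proof -
    have "D n * sqrt 2 ^ n = sqrt (2 ^ n * (D n)\<^sup>2)"
      by (simp add: real_sqrt_mult D_def real_sqrt_power)
    also have "\<dots> \<le> sqrt C"
      using C by simp
    finally show ?thesis
      by (simp add: field_simps power_divide)
  qed
  have "summable (\<lambda>n. F (Suc n) - F n)"
  proof (rule summable_comparison_test')
    show "summable (\<lambda>n. sqrt C * (1 / sqrt 2) ^ n)"
      by (intro summable_mult summable_geometric) auto
    show "norm (F (Suc n) - F n) \<le> sqrt C * (1 / sqrt 2) ^ n" if "n \<ge> 0" for n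
      using D[of n] by (simp add: D_def)
  qed
  then have "(\<lambda>n. (\<Sum>i<n. F (Suc i) - F i) + F 0) \<longlonglongrightarrow> suminf (\<lambda>n. F (Suc n) - F n) + F 0"
    by (intro tendsto_add tendsto_const summable_LIMSEQ)
  then show ?thesis
    by (auto simp: sum_lessThan_telescope convergent_def)
qed

text \<open>Riesz--Fischer: a rapidly convergent subsequence converges almost everywhere, Fatou's
  lemma turns its pointwise limit into a limit in norm, and a Cauchy sequence follows its
  subsequence.\<close>

instance l2 :: complete_space
proof
  fix X :: "nat \<Rightarrow> l2"
  assume X: "Cauchy X"
  have "\<exists>N. \<forall>m\<ge>N. \<forall>k\<ge>N. norm (X m - X k) < (1 / 2) ^ n" for n
    using X by (auto simp: Cauchy_iff)
  then obtain N where N: "\<And>n m k. m \<ge> N n \<Longrightarrow> k \<ge> N n \<Longrightarrow> norm (X m - X k) < (1 / 2) ^ n"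
    by metis
  \<comment> \<open>Summing all earlier thresholds gives \<open>r m \<ge> N n\<close> whenever n
    \<le> m; the extra n makes the sequence strictly increasing.\<close>
  define r where "r n = (\<Sum>i\<le>n. N i) + n" for n
  have r: "strict_mono r"
    by (rule strict_monoI_Suc) (simp add: r_def)
  have rN: "N n \<le> r m" if "n \<le> m" for n m
    using member_le_sum[of n "{..m}" N] that by (simp add: r_def trans_le_add1)
  have X_r: "norm (X (r n) - X (r m)) < (1 / 2) ^ n" if "n \<le> m" for n m
    using that by (intro N rN) auto
  define F where "F n = rep_l2 (X (r n))" for n
  have [measurable]: "F n \<in> borel_measurable lborel_pos" for n
    by (simp add: F_def)
  have F: "(\<integral>\<^sup>+x. ennreal ((cmod (F n x - F m x))\<^sup>2) \<partial>lborel_pos) \<le> ennreal ((1 / 4) ^ n)"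
    if "n \<le> m" for n m
  proof -
    have "(norm (X (r n) - X (r m)))\<^sup>2 \<le> ((1 / 2) ^ n)\<^sup>2"
      using X_r[OF that] by (intro power_mono) auto
    then show ?thesis
      unfolding F_def nn_integral_diff_l2 power2_half_power by (rule ennreal_leI)
  qed
  have "(\<integral>\<^sup>+x. (\<Sum>n. ennreal (2 ^ n * (cmod (F (Suc n) x - F n x))\<^sup>2)) \<partial>lborel_pos)
      = (\<Sum>n. ennreal (2 ^ n) * (\<integral>\<^sup>+x. ennreal ((cmod (F n x - F (Suc n) x))\<^sup>2) \<partial>lborel_pos))"
    by (subst nn_integral_suminf)
       (auto simp: ennreal_mult' nn_integral_cmult norm_minus_commute)
  also have "\<dots> \<le> (\<Sum>n. ennreal ((1 / 2) ^ n))"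
  proof (intro suminf_le)
    fix n
    have "ennreal (2 ^ n) * (\<integral>\<^sup>+x. ennreal ((cmod (F n x - F (Suc n) x))\<^sup>2) \<partial>lborel_pos)
        \<le> ennreal (2 ^ n) * ennreal ((1 / 4) ^ n)"
      by (intro mult_left_mono F) auto
    also have "\<dots> = ennreal ((1 / 2) ^ n)"
      by (simp flip: ennreal_mult' power_mult_distrib)
    finally show "ennreal (2 ^ n) * (\<integral>\<^sup>+x. ennreal ((cmod (F n x - F (Suc n) x))\<^sup>2) \<partial>lborel_pos)
        \<le> ennreal ((1 / 2) ^ n)" .
  qed auto
  also have "\<dots> < \<infinity>"
    by (subst suminf_ennreal2) (auto intro: summable_geometric)
  finally have "AE x in lborel_pos. (\<Sum>n. ennreal (2 ^ n * (cmod (F (Suc n) x - F n x))\<^sup>2)) \<noteq> \<infinity>"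
    by (intro nn_integral_noteq_infinite) auto
  then have conv: "AE x in lborel_pos. convergent (\<lambda>n. F n x)"
    by eventually_elim (auto intro: convergent_of_geometric_increments)
  define G where "G x = lim (\<lambda>n. F n x)" for x
  have [measurable]: "G \<in> borel_measurable lborel_pos"
    unfolding G_def by measurable
  have FG: "(\<integral>\<^sup>+x. ennreal ((cmod (F n x - G x))\<^sup>2) \<partial>lborel_pos) \<le> ennreal ((1 / 4) ^ n)" for n
  proof -
    have "(\<integral>\<^sup>+x. ennreal ((cmod (F n x - G x))\<^sup>2) \<partial>lborel_pos)
        = (\<integral>\<^sup>+x. liminf (\<lambda>m. ennreal ((cmod (F n x - F m x))\<^sup>2)) \<partial>lborel_pos)"
    proof (rule nn_integral_cong_AE)
      show "AE x in lborel_pos. ennreal ((cmod (F n x - G x))\<^sup>2)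
          = liminf (\<lambda>m. ennreal ((cmod (F n x - F m x))\<^sup>2))"
        using conv
      proof eventually_elim
        case (elim x)
        then have "(\<lambda>m. F m x) \<longlonglongrightarrow> G x"
          by (simp add: G_def convergent_LIMSEQ_iff)
        then have "(\<lambda>m. ennreal ((cmod (F n x - F m x))\<^sup>2)) \<longlonglongrightarrow> ennreal ((cmod (F n x - G x))\<^sup>2)"
          by (intro tendsto_intros) auto
        then show ?case
          by (rule lim_imp_Liminf[OF trivial_limit_sequentially, symmetric])
      qed
    qed
    also have "\<dots> \<le> liminf (\<lambda>m. \<integral>\<^sup>+x. ennreal ((cmod (F n x - F m x))\<^sup>2) \<partial>lborel_pos)"
      by (rule nn_integral_liminf) auto
    also have "\<dots> \<le> ennreal ((1 / 4) ^ n)"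
      by (intro Liminf_le eventually_sequentiallyI[of n] F) auto
    finally show ?thesis .
  qed
  have "square_integrable lborel_pos (\<lambda>x. F 0 x - G x)"
    using FG[of 0] by (subst square_integrable_iff_nn) (auto intro: le_less_trans)
  then have "square_integrable lborel_pos (\<lambda>x. F 0 x + (-1) * (F 0 x - G x))"
    by (intro square_integrable_add square_integrable_scale) (simp_all add: F_def)
  then have G: "square_integrable lborel_pos G"
    by simp
  have bound: "norm (X (r n) - abs_l2 G) \<le> (1 / 2) ^ n" for n
  proof -
    have "ennreal ((norm (X (r n) - abs_l2 G))\<^sup>2)
        = (\<integral>\<^sup>+x. ennreal ((cmod (F n x - G x))\<^sup>2) \<partial>lborel_pos)"
      unfolding nn_integral_diff_l2[symmetric] F_def
      by (rule nn_integral_cong_AE) (use rep_abs_l2[OF G] in \<open>auto elim: eventually_mono\<close>)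
    also have "\<dots> \<le> ennreal (((1 / 2) ^ n)\<^sup>2)"
      using FG[of n] by (simp only: power2_half_power)
    finally show ?thesis
      by (simp add: power2_le_iff_abs_le)
  qed
  have "(\<lambda>n. X (r n) - abs_l2 G) \<longlonglongrightarrow> 0"
  proof (rule Lim_null_comparison)
    show "eventually (\<lambda>n. norm (X (r n) - abs_l2 G) \<le> (1 / 2) ^ n) sequentially"
      by (intro always_eventually allI bound)
    show "(\<lambda>n. (1 / 2) ^ n :: real) \<longlonglongrightarrow> 0"
      by (intro LIMSEQ_realpow_zero) auto
  qed
  then have "(X \<circ> r) \<longlonglongrightarrow> abs_l2 G"
    by (simp add: o_def LIM_zero_iff)
  with X r have "X \<longlonglongrightarrow> abs_l2 G"
    by (rule Cauchy_converges_subseq)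
  then show "convergent X"
    by (rule convergentI)
qed

instance l2 :: banach ..

section \<open>Orthonormal systems, projections and Gram--Schmidt\<close>

text \<open>Zero vectors are allowed, so that Gram--Schmidt needs no independence assumption.\<close>

definition orthosystem :: "(nat \<Rightarrow> l2) \<Rightarrow> bool" where
  "orthosystem e \<longleftrightarrow> (\<forall>i j. cinner (e i) (e j) = (if i = j \<and> e i \<noteq> 0 then 1 else 0))"

definition ortho_proj :: "(nat \<Rightarrow> l2) \<Rightarrow> nat \<Rightarrow> l2 \<Rightarrow> l2" where
  "ortho_proj e n f = (\<Sum>i<n. cinner f (e i) *\<^sub>C e i)"

lemma orthosystemD: "orthosystem e \<Longrightarrow> cinner (e i) (e j) = (if i = j \<and> e i \<noteq> 0 then 1 else 0)"
  by (simp add: orthosystem_def)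

lemma orthosystem_norm: "orthosystem e \<Longrightarrow> norm (e i) \<le> 1"
  using power2_norm_l2[of "e i"] by (auto simp: orthosystemD power2_eq_1_iff split: if_splits)

lemma norm_sum_orthosystem:
  assumes "orthosystem e" "finite A"
  shows "(norm (\<Sum>i\<in>A. c i *\<^sub>C e i))\<^sup>2 = (\<Sum>i\<in>A. if e i = 0 then 0 else (cmod (c i))\<^sup>2)"
proof -
  have "cinner (\<Sum>i\<in>A. c i *\<^sub>C e i) (\<Sum>i\<in>A. c i *\<^sub>C e i)
      = (\<Sum>i\<in>A. \<Sum>j\<in>A. cnj (c i) * (c j * (if j = i \<and> e j \<noteq> 0 then 1 else 0)))"
    by (simp only: cinner_sum_left cinner_sum_right cinner_scaleC_left cinner_scaleC_right
        orthosystemD[OF assms(1)] sum_distrib_left)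
  also have "\<dots> = (\<Sum>i\<in>A. \<Sum>j\<in>A. if i = j then (if e i = 0 then 0 else c i * cnj (c i)) else 0)"
    by (intro sum.cong) auto
  also have "\<dots> = (\<Sum>i\<in>A. if e i = 0 then 0 else c i * cnj (c i))"
    using assms(2) by (intro sum.cong) auto
  also have "\<dots> = (\<Sum>i\<in>A. of_real (if e i = 0 then 0 else (cmod (c i))\<^sup>2))"
    by (intro sum.cong refl) (auto simp add: complex_norm_square simp del: of_real_power)
  finally show ?thesis
    by (simp only: power2_norm_l2 Re_complex_of_real flip: of_real_sum)
qed

lemma norm_sum_orthosystem_le:
  assumes "orthosystem e" "finite A"
  shows "(norm (\<Sum>i\<in>A. c i *\<^sub>C e i))\<^sup>2 \<le> (\<Sum>i\<in>A. (cmod (c i))\<^sup>2)"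
  unfolding norm_sum_orthosystem[OF assms] by (intro sum_mono) auto

lemma cinner_ortho_proj_left:
  assumes "orthosystem e"
  shows "cinner (ortho_proj e n f) (e j) = (if j < n then cinner f (e j) else 0)"
proof -
  have "cinner (ortho_proj e n f) (e j) = (\<Sum>i<n. if i = j then cinner f (e j) else 0)"
    unfolding ortho_proj_def cinner_sum_left
    by (intro sum.cong) (auto simp: cinner_scaleC_left orthosystemD[OF assms])
  then show ?thesis
    by simp
qed

lemma norm_ortho_proj: "orthosystem e \<Longrightarrow> (norm (ortho_proj e n f))\<^sup>2 = (\<Sum>i<n. (cmod (cinner f (e i)))\<^sup>2)"
  unfolding ortho_proj_def by (subst norm_sum_orthosystem) (auto intro!: sum.cong)

lemma norm_diff_ortho_proj:
  assumes "orthosystem e"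
  shows "(norm (f - ortho_proj e n f))\<^sup>2 = (norm f)\<^sup>2 - (\<Sum>i<n. (cmod (cinner f (e i)))\<^sup>2)"
proof -
  define p where "p = ortho_proj e n f"
  have "cinner f p = (\<Sum>i<n. of_real ((cmod (cinner f (e i)))\<^sup>2))"
    unfolding p_def ortho_proj_def cinner_sum_right cinner_scaleC_right
    by (intro sum.cong refl) (simp only: complex_norm_square mult.commute)
  then have fp: "cinner f p = of_real (\<Sum>i<n. (cmod (cinner f (e i)))\<^sup>2)"
    by simp
  have "cinner (f - p) (f - p) = cinner f f - cinner f p - cnj (cinner f p) + cinner p p"
    using cinner_commute[of p f] by (simp add: cinner_diff_left cinner_diff_right)
  also have "\<dots> = of_real ((norm f)\<^sup>2 - (\<Sum>i<n. (cmod (cinner f (e i)))\<^sup>2))"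
    using norm_ortho_proj[OF assms, of n f] unfolding fp cinner_self
    by (simp add: p_def flip: of_real_power)
  finally show ?thesis
    by (simp only: power2_norm_l2 Re_complex_of_real p_def)
qed

lemma bessel_inequality: "orthosystem e \<Longrightarrow> (\<Sum>i<n. (cmod (cinner f (e i)))\<^sup>2) \<le> (norm f)\<^sup>2"
  using norm_diff_ortho_proj[of e f n] by (metis diff_ge_0_iff_ge zero_le_power2)

lemma norm_ortho_proj_le: "orthosystem e \<Longrightarrow> norm (ortho_proj e n f) \<le> norm f"
  by (rule power2_le_imp_le) (use bessel_inequality[of e f n] norm_ortho_proj[of e n f] in auto)

lemma ortho_proj_add: "ortho_proj e n (f + g) = ortho_proj e n f + ortho_proj e n g"
  by (simp add: ortho_proj_def cinner_add_left scaleC_add_left sum.distrib)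

lemma ortho_proj_scaleC: "ortho_proj e n (c *\<^sub>C f) = c *\<^sub>C ortho_proj e n f"
  by (simp add: ortho_proj_def cinner_scaleC_left scaleC_sum_right)

text \<open>\<open>sgn\<close> normalises a nonzero vector and sends 0 to 0, so a vector that
  depends on its predecessors simply contributes a zero entry.\<close>

fun gram_schmidt :: "(nat \<Rightarrow> l2) \<Rightarrow> nat \<Rightarrow> l2" where
  "gram_schmidt v n = sgn (v n - (\<Sum>i<n. cinner (v n) (gram_schmidt v i) *\<^sub>C gram_schmidt v i))"

declare gram_schmidt.simps [simp del]

lemma gram_schmidt_self:
  "cinner (gram_schmidt v n) (gram_schmidt v n) = (if gram_schmidt v n = 0 then 0 else 1)"
  by (simp add: cinner_self gram_schmidt.simps[of v n] norm_sgn sgn_zero_iff)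

lemma gram_schmidt_orthogonal: "j < n \<Longrightarrow> cinner (gram_schmidt v n) (gram_schmidt v j) = 0"
proof (induction n arbitrary: j rule: less_induct)
  case (less n)
  define w where "w = v n - (\<Sum>i<n. cinner (v n) (gram_schmidt v i) *\<^sub>C gram_schmidt v i)"
  have 1: "cinner (gram_schmidt v i) (gram_schmidt v j)
      = (if i = j \<and> gram_schmidt v j \<noteq> 0 then 1 else 0)" if "i < n" for i
    using less.IH[of i j] less.IH[of j i] less.prems that gram_schmidt_self[of v j]
      cinner_commute[of "gram_schmidt v i" "gram_schmidt v j"]
    by (cases i j rule: linorder_cases) auto
  have "(\<Sum>i<n. cinner (v n) (gram_schmidt v i) * cinner (gram_schmidt v i) (gram_schmidt v j))
      = (\<Sum>i<n. if i = j then cinner (v n) (gram_schmidt v j) else 0)"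
    by (intro sum.cong) (auto simp: 1)
  then have "cinner w (gram_schmidt v j) = 0"
    using less.prems by (simp add: w_def cinner_diff_left cinner_sum_left cinner_scaleC_left)
  then show ?case
    by (simp add: gram_schmidt.simps[of v n] sgn_div_norm cinner_scaleR_left flip: w_def)
qed

lemma orthosystem_gram_schmidt: "orthosystem (gram_schmidt v)"
  unfolding orthosystem_def
proof (intro allI)
  fix i j
  show "cinner (gram_schmidt v i) (gram_schmidt v j) = (if i = j \<and> gram_schmidt v i \<noteq> 0 then 1 else 0)"
    using gram_schmidt_orthogonal[of i j v] gram_schmidt_orthogonal[of j i v]
      gram_schmidt_self[of v i] cinner_commute[of "gram_schmidt v i" "gram_schmidt v j"]
    by (cases i j rule: linorder_cases) auto
qed

lemma gram_schmidt_expansion: "v n = ortho_proj (gram_schmidt v) (Suc n) (v n)"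
proof -
  define p where "p = (\<Sum>i<n. cinner (v n) (gram_schmidt v i) *\<^sub>C gram_schmidt v i)"
  define w where "w = v n - p"
  have w: "w = of_real (norm w) *\<^sub>C gram_schmidt v n"
    by (cases "w = 0") (simp_all add: gram_schmidt.simps[of v n] sgn_div_norm flip: w_def p_def scaleR_l2_def)
  have "cinner p (gram_schmidt v n) = 0"
    unfolding p_def cinner_sum_left
    by (intro sum.neutral) (auto simp: cinner_scaleC_left orthosystemD[OF orthosystem_gram_schmidt])
  then have "cinner (v n) (gram_schmidt v n) = cinner w (gram_schmidt v n)"
    by (simp add: w_def cinner_diff_left)
  moreover obtain a where "w = a *\<^sub>C gram_schmidt v n"
    using w by blast
  ultimately have "cinner (v n) (gram_schmidt v n) *\<^sub>C gram_schmidt v n = w"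
    by (cases "gram_schmidt v n = 0") (simp_all add: cinner_scaleC_left gram_schmidt_self)
  then show ?thesis
    by (simp add: ortho_proj_def w_def flip: p_def)
qed

lemma orthosystem_summable:
  assumes e: "orthosystem e" and c: "summable (\<lambda>i. (cmod (c i))\<^sup>2)"
  shows "summable (\<lambda>i. c i *\<^sub>C e i)"
  unfolding summable_Cauchy
proof (intro allI impI)
  fix \<epsilon> :: real
  assume "\<epsilon> > 0"
  then have "\<epsilon>\<^sup>2 > 0"
    by simp
  with c obtain N where N: "\<And>m n. m \<ge> N \<Longrightarrow> norm (\<Sum>i=m..<n. (cmod (c i))\<^sup>2) < \<epsilon>\<^sup>2"
    unfolding summable_Cauchy by blast
  have "norm (\<Sum>i=m..<n. c i *\<^sub>C e i) < \<epsilon>" if "m \<ge> N" for m n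
  proof -
    have "(norm (\<Sum>i=m..<n. c i *\<^sub>C e i))\<^sup>2 < \<epsilon>\<^sup>2"
      using norm_sum_orthosystem_le[OF e, of "{m..<n}" c] N[OF that, of n] by simp
    then show ?thesis
      by (rule power2_less_imp_less) (use \<open>\<epsilon> > 0\<close> in simp)
  qed
  then show "\<exists>N. \<forall>m\<ge>N. \<forall>n. norm (\<Sum>i=m..<n. c i *\<^sub>C e i) < \<epsilon>"
    by (intro exI[of _ N]) simp
qed

text \<open>The complex measure that sends A to the integral of k over the preimage of A under s
  vanishes on rational half-lines. Limits from the right give real half-lines, Dynkin's argument all
  Borel sets, and simple functions the symbol \<psi>. It serves twice: with s the identity for the
  totality of rational intervals in L2, and with s the level function for passing from cut-off
  symbols to arbitrary ones.\<close>

lemma integral_level_sets_eq_0: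
  fixes k :: "'a \<Rightarrow> complex" and s :: "'a \<Rightarrow> real" and \<psi> :: "real \<Rightarrow> complex"
  assumes k: "integrable M k" and [measurable]: "s \<in> borel_measurable M" "\<psi> \<in> borel_measurable borel"
    and zero: "\<And>q. (LINT x|M. indicator {..real_of_rat q} (s x) *\<^sub>R k x) = 0"
    and int: "integrable M (\<lambda>x. \<psi> (s x) * k x)"
  shows "(LINT x|M. \<psi> (s x) * k x) = 0"
proof -
  note [measurable] = borel_measurable_integrable[OF k]
  have real: "(LINT x|M. indicator {..c} (s x) *\<^sub>R k x) = 0" for c
  proof -
    \<comment> \<open>The rationals approach c from the right: points with s x \<le> c then lie in
      every cut-off, and all other points eventually leave.\<close>
    have "\<exists>q. c < real_of_rat q \<and> real_of_rat q < c + 1 / real (Suc n)" for n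
      by (rule of_rat_dense) simp
    then obtain q where q: "\<And>n. c < real_of_rat (q n)" "\<And>n. real_of_rat (q n) < c + 1 / real (Suc n)"
      by metis
    have "(\<lambda>n. LINT x|M. indicator {..real_of_rat (q n)} (s x) *\<^sub>R k x)
        \<longlonglongrightarrow> (LINT x|M. indicator {..c} (s x) *\<^sub>R k x)"
    proof (rule integral_dominated_convergence[where w = "\<lambda>x. norm (k x)"])
      show "AE x in M. (\<lambda>n. indicator {..real_of_rat (q n)} (s x) *\<^sub>R k x)
          \<longlonglongrightarrow> indicator {..c} (s x) *\<^sub>R k x"
      proof (rule AE_I2)
        fix x
        have "eventually (\<lambda>n. indicator {..real_of_rat (q n)} (s x) = (indicator {..c} (s x) :: real)) sequentially"
        proof (cases "s x \<le> c")
          case True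
          then have "s x \<le> real_of_rat (q n)" for n
            using q(1)[of n] by linarith
          then show ?thesis
            using True by simp
        next
          case False
          have "(\<lambda>n. c + 1 / real (Suc n)) \<longlonglongrightarrow> c + 0"
            by (intro tendsto_add tendsto_const lim_1_over_n[THEN LIMSEQ_Suc])
          then have "eventually (\<lambda>n. c + 1 / real (Suc n) < s x) sequentially"
            using False by (intro order_tendstoD) auto
          then show ?thesis
          proof eventually_elim
            case (elim n)
            then show ?case
              using False q(2)[of n] by simp
          qed
        qed
        then show "(\<lambda>n. indicator {..real_of_rat (q n)} (s x) *\<^sub>R k x)
            \<longlonglongrightarrow> indicator {..c} (s x) *\<^sub>R k x"
          by (intro tendsto_eventually) (auto elim: eventually_mono)
      qed
    qed (use k in \<open>auto split: split_indicator\<close>)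
    then show ?thesis
      by (simp add: zero LIMSEQ_const_iff)
  qed
  have int_ind: "integrable M (\<lambda>x. indicator A (s x) *\<^sub>R k x)" if [measurable]: "A \<in> sets borel" for A
    by (rule Bochner_Integration.integrable_bound[OF integrable_norm[OF k]])
       (auto split: split_indicator)
  have borel: "(LINT x|M. indicator A (s x) *\<^sub>R k x) = 0" if "A \<in> sets borel" for A
  proof -
    \<comment> \<open>The complement case of the induction subtracts from the integral over the
      whole space, which must therefore vanish first.\<close>
    have total: "(LINT x|M. k x) = 0"
    proof -
      have "(\<lambda>n. LINT x|M. indicator {..real n} (s x) *\<^sub>R k x) \<longlonglongrightarrow> (LINT x|M. k x)"
      proof (rule integral_dominated_convergence[where w = "\<lambda>x. norm (k x)"])
        show "AE x in M. (\<lambda>n. indicator {..real n} (s x) *\<^sub>R k x) \<longlonglongrightarrow> k x"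
        proof (rule AE_I2)
          fix x
          obtain N where "s x \<le> real N"
            using real_arch_simple by blast
          then show "(\<lambda>n. indicator {..real n} (s x) *\<^sub>R k x) \<longlonglongrightarrow> k x"
            by (intro tendsto_eventually eventually_sequentiallyI[of N]) (auto split: split_indicator)
        qed
      qed (use k in \<open>auto split: split_indicator\<close>)
      then show ?thesis
        by (simp add: real LIMSEQ_const_iff)
    qed
    have "Int_stable (range (\<lambda>a::real. {..a}))"
      by (auto simp: Int_stable_def)
    moreover have "range (\<lambda>a::real. {..a}) \<subseteq> Pow UNIV"
      by simp
    moreover have "A \<in> sigma_sets UNIV (range (\<lambda>a::real. {..a}))"
      using that by (subst (asm) borel_eq_atMost) (simp add: sets_measure_of)
    ultimately show ?thesis
    proof (induction rule: sigma_sets_induct_disjoint)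
      case (compl A)
      then have [measurable]: "A \<in> sets borel"
        by (subst borel_eq_atMost) (simp add: sets_measure_of)
      have "(LINT x|M. indicator (UNIV - A) (s x) *\<^sub>R k x)
          = (LINT x|M. k x - indicator A (s x) *\<^sub>R k x)"
        by (intro Bochner_Integration.integral_cong) (auto split: split_indicator)
      then show ?case
        using k by (simp add: int_ind total compl)
    next
      case (union A)
      then have A[measurable]: "A i \<in> sets borel" for i
        by (subst borel_eq_atMost) (auto simp: sets_measure_of)
      have disj: "disjoint_family A"
        by fact
      have [measurable]: "(\<Union>i<n. A i) \<in> sets borel" "(\<Union>i. A i) \<in> sets borel" for n
        using A by auto
      have "(\<lambda>n. LINT x|M. indicator (\<Union>i<n. A i) (s x) *\<^sub>R k x)
          \<longlonglongrightarrow> (LINT x|M. indicator (\<Union>i. A i) (s x) *\<^sub>R k x)"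
      proof (rule integral_dominated_convergence[where w = "\<lambda>x. norm (k x)"])
        show "AE x in M. (\<lambda>n. indicator (\<Union>i<n. A i) (s x) *\<^sub>R k x)
            \<longlonglongrightarrow> indicator (\<Union>i. A i) (s x) *\<^sub>R k x"
          by (intro AE_I2 tendsto_scaleR tendsto_const LIMSEQ_indicator_UN)
      qed (use k in \<open>auto split: split_indicator\<close>)
      moreover have "(LINT x|M. indicator (\<Union>i<n. A i) (s x) *\<^sub>R k x) = 0" for n
      proof -
        have "indicator (\<Union>i<n. A i) y = (\<Sum>i<n. indicator (A i) y :: real)" for y
          using disj by (intro indicator_UN_disjoint) (auto simp: disjoint_family_on_def)
        then have "(LINT x|M. indicator (\<Union>i<n. A i) (s x) *\<^sub>R k x)
            = (LINT x|M. (\<Sum>i<n. indicator (A i) (s x) *\<^sub>R k x))"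
          by (simp add: scaleR_sum_left)
        also have "\<dots> = 0"
          by (subst Bochner_Integration.integral_sum) (auto simp: int_ind union)
        finally show ?thesis .
      qed
      ultimately show ?case
        by (simp add: LIMSEQ_const_iff)
    qed (auto simp: real)
  qed
  \<comment> \<open>Only the product of \<psi> with k is known to be integrable, so the simple
    functions must be dominated by a multiple of |\<psi>|; the approximation theorem provides the
    factor 2.\<close>
  obtain F where F: "\<And>i. simple_function borel (F i)" "\<And>x. (\<lambda>i. F i x) \<longlonglongrightarrow> \<psi> x"
    "\<And>i x. dist (F i x) 0 \<le> 2 * dist (\<psi> x) 0"
    using borel_measurable_implies_sequence_metric[of \<psi> borel 0] by auto
  have F_meas[measurable]: "F i \<in> borel_measurable borel" for i
    by (rule borel_measurable_simple_function[OF F(1)])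
  have zero_F: "(LINT x|M. F i (s x) * k x) = 0" for i
  proof -
    have fin: "finite (range (F i))"
      using F(1)[of i] by (simp add: simple_function_def)
    have [measurable]: "F i -` {y} \<in> sets borel" for y
      using measurable_sets[OF F_meas[of i], of "{y}"] by simp
    have "F i (s x) * k x = (\<Sum>y\<in>range (F i). y * (indicator (F i -` {y}) (s x) *\<^sub>R k x))" for x
    proof -
      have "(\<Sum>y\<in>range (F i). y * (indicator (F i -` {y}) (s x) *\<^sub>R k x))
          = (\<Sum>y\<in>range (F i). if y = F i (s x) then F i (s x) * k x else 0)"
        by (intro sum.cong) (auto split: split_indicator)
      then show ?thesis
        using fin by simp
    qed
    then have "(LINT x|M. F i (s x) * k x)
        = (LINT x|M. (\<Sum>y\<in>range (F i). y * (indicator (F i -` {y}) (s x) *\<^sub>R k x)))"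
      by simp
    also have "\<dots> = (\<Sum>y\<in>range (F i). y * (LINT x|M. indicator (F i -` {y}) (s x) *\<^sub>R k x))"
      by (subst Bochner_Integration.integral_sum)
         (simp_all add: int_ind integrable_mult_right del: mult_scaleR_right)
    also have "\<dots> = 0"
      by (simp add: borel)
    finally show ?thesis .
  qed
  have "(\<lambda>i. LINT x|M. F i (s x) * k x) \<longlonglongrightarrow> (LINT x|M. \<psi> (s x) * k x)"
  proof (rule integral_dominated_convergence[where w = "\<lambda>x. 2 * norm (\<psi> (s x) * k x)"])
    show "AE x in M. (\<lambda>i. F i (s x) * k x) \<longlonglongrightarrow> \<psi> (s x) * k x"
      by (intro AE_I2 tendsto_mult tendsto_const F)
    show "AE x in M. norm (F i (s x) * k x) \<le> 2 * norm (\<psi> (s x) * k x)" for i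
      using F(3)[of i] by (auto simp: norm_mult mult.assoc[symmetric] intro!: mult_right_mono)
  qed (use int in auto)
  then show ?thesis
    by (simp add: zero_F LIMSEQ_const_iff)
qed

section \<open>Existence of an orthonormal basis and Parseval's identity\<close>

lemma cnj_indicator [simp]: "cnj (indicator A x) = indicator A x"
  by (simp split: split_indicator)

lemma measurable_cnj [measurable (raw)]:
  "F \<in> borel_measurable M \<Longrightarrow> (\<lambda>x. cnj (F x)) \<in> borel_measurable M"
  by (rule borel_measurable_continuous_on[where f = cnj]) (auto intro: continuous_intros)

lemma borel_measurable_extend_lborel_pos:
  fixes F :: "real \<Rightarrow> complex"
  assumes "F \<in> borel_measurable lborel_pos"
  shows "(\<lambda>x. indicator {0<..} x *\<^sub>R F x) \<in> borel_measurable borel"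
proof -
  have "F \<in> borel_measurable (restrict_space borel {0<..})"
    using assms by (simp only: measurable_cong_sets[OF sets_lborel_pos refl])
  then show ?thesis
    by (subst (asm) borel_measurable_restrict_space_iff) auto
qed

lemma cmod_cinner_commute: "cmod (cinner f g) = cmod (cinner g f)"
  by (subst cinner_commute) simp

text \<open>Totality of countably many indicators, the input of Gram--Schmidt. Choosing the
  conjugate of f itself as the symbol and f restricted to the interval up to N as the integrand
  makes the vanishing integral equal to that of |f|^2 over this interval. Nonpositive rationals give
  the empty interval and do no harm.\<close>

lemma rep_l2_eqI:
  assumes "\<And>n. cinner f (abs_l2 (indicator {0<..real_of_rat (nat_to_rat_surj n)})) = 0"
  shows "f = 0"
proof -
  have ind: "square_integrable lborel_pos (indicator A :: real \<Rightarrow> complex)"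
    if "A \<in> sets borel" "A \<subseteq> {..real N}" for A N
  proof (subst square_integrable_iff_nn)
    show "indicator A \<in> borel_measurable lborel_pos"
      using that by measurable
    have "(\<integral>\<^sup>+x. ennreal ((cmod (indicator A x))\<^sup>2) \<partial>lborel_pos) \<le> (\<integral>\<^sup>+x. indicator {0..real N} x \<partial>lborel)"
      unfolding nn_integral_lborel_pos using that
      by (intro nn_integral_mono) (auto split: split_indicator)
    also have "\<dots> < \<infinity>"
      by simp
    finally show "(\<integral>\<^sup>+x. ennreal ((cmod (indicator A x))\<^sup>2) \<partial>lborel_pos) < \<infinity>" .
  qed
  have rat: "(LINT x|lborel_pos. rep_l2 f x * indicator {0<..real_of_rat q} x) = 0" for q
  proof -
    obtain N where N: "real_of_rat q \<le> real N"
      using real_arch_simple by blast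
    obtain n where n: "q = nat_to_rat_surj n"
      using surj_nat_to_rat_surj by (metis surjD)
    have "square_integrable lborel_pos (indicator {0<..real_of_rat q} :: real \<Rightarrow> complex)"
      using N by (intro ind[of _ N]) auto
    from cinner_abs_l2[OF square_integrable_rep this, of f] show ?thesis
      using assms[of n] by (simp add: n)
  qed
  have "(\<integral>\<^sup>+x. ennreal ((cmod (rep_l2 f x))\<^sup>2 * indicator {..real N} x) \<partial>lborel_pos) = 0" for N
  proof -
    define k where "k x = rep_l2 f x * indicator {0<..real N} x" for x
    define \<psi> where "\<psi> x = indicator {0<..} x *\<^sub>R cnj (rep_l2 f x)" for x
    have "integrable lborel_pos (\<lambda>x. rep_l2 f x * cnj (indicator {0<..real N} x))"
      by (intro square_integrable_mult_cnj ind[of _ N] square_integrable_rep) auto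
    then have k: "integrable lborel_pos k"
      by (simp add: k_def[abs_def])
    have \<psi>[measurable]: "\<psi> \<in> borel_measurable borel"
      unfolding \<psi>_def by (intro borel_measurable_extend_lborel_pos measurable_cnj rep_l2_measurable)
    have *: "\<psi> x * k x = of_real ((cmod (rep_l2 f x))\<^sup>2 * indicator {..real N} x)" if "x > 0" for x
      using that complex_norm_square[of "rep_l2 f x"]
      by (auto simp: \<psi>_def k_def mult.commute split: split_indicator)
    have int: "integrable lborel_pos (\<lambda>x. (cmod (rep_l2 f x))\<^sup>2 * indicator {..real N} x)"
    proof (rule Bochner_Integration.integrable_bound)
      show "integrable lborel_pos (\<lambda>x. (cmod (rep_l2 f x))\<^sup>2)"
        using square_integrable_rep[of f] by (simp only: square_integrable_def)
    qed (auto split: split_indicator)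
    have "(LINT x|lborel_pos. \<psi> x * k x) = 0"
    proof (rule integral_level_sets_eq_0[OF k])
      fix q :: rat
      define b where "b = min q (of_nat N)"
      have b: "real_of_rat b = min (real_of_rat q) (real N)"
        unfolding b_def min_def by (metis of_rat_less_eq of_rat_of_nat_eq)
      have "indicator {..real_of_rat q} x *\<^sub>R k x = rep_l2 f x * indicator {0<..real_of_rat b} x"
        if "x > 0" for x
        using that by (simp add: k_def b indicator_def)
      then have "(LINT x|lborel_pos. indicator {..real_of_rat q} x *\<^sub>R k x)
          = (LINT x|lborel_pos. rep_l2 f x * indicator {0<..real_of_rat b} x)"
        by (intro Bochner_Integration.integral_cong) auto
      then show "(LINT x|lborel_pos. indicator {..real_of_rat q} x *\<^sub>R k x) = 0"
        by (simp add: rat)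
      have "integrable lborel_pos (\<lambda>x. complex_of_real ((cmod (rep_l2 f x))\<^sup>2 * indicator {..real N} x))"
        using int by (rule integrable_of_real)
      moreover have "integrable lborel_pos (\<lambda>x. \<psi> x * k x) \<longleftrightarrow>
          integrable lborel_pos (\<lambda>x. complex_of_real ((cmod (rep_l2 f x))\<^sup>2 * indicator {..real N} x))"
        by (intro Bochner_Integration.integrable_cong *) auto
      ultimately show "integrable lborel_pos (\<lambda>x. \<psi> x * k x)"
        by simp
    qed auto
    also have "(LINT x|lborel_pos. \<psi> x * k x)
        = (LINT x|lborel_pos. of_real ((cmod (rep_l2 f x))\<^sup>2 * indicator {..real N} x))"
      by (intro Bochner_Integration.integral_cong *) auto
    also have "\<dots> = of_real (LINT x|lborel_pos. (cmod (rep_l2 f x))\<^sup>2 * indicator {..real N} x)"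
      by (rule integral_complex_of_real)
    finally show ?thesis
      by (subst nn_integral_eq_integral[OF int]) auto
  qed
  then have "AE x in lborel_pos. ennreal ((cmod (rep_l2 f x))\<^sup>2 * indicator {..real N} x) = 0" for N
    by (intro nn_integral_0_iff_AE[THEN iffD1]) auto
  then have "AE x in lborel_pos. \<forall>N. ennreal ((cmod (rep_l2 f x))\<^sup>2 * indicator {..real N} x) = 0"
    unfolding AE_all_countable by blast
  then have "AE x in lborel_pos. rep_l2 f x = 0"
  proof eventually_elim
    case (elim x)
    obtain N where "x \<le> real N"
      using real_arch_simple by blast
    then show ?case
      using elim[rule_format, of N] by (simp add: ennreal_eq_0_iff)
  qed
  then have "abs_l2 (rep_l2 f) = abs_l2 (\<lambda>x. 0)"
    by (subst abs_l2_eq_iff) auto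
  then show ?thesis
    by (simp add: zero_l2_def)
qed

lemma ortho_proj_eq_self:
  assumes "orthosystem e" "\<And>n. N \<le> n \<Longrightarrow> e n = 0" "\<And>f. (\<And>n. cinner f (e n) = 0) \<Longrightarrow> f = 0"
  shows "ortho_proj e N f = f"
proof -
  have "cinner (f - ortho_proj e N f) (e n) = 0" for n
    using assms(2)[of n] by (simp add: cinner_diff_left cinner_ortho_proj_left[OF assms(1)])
  from assms(3)[OF this] show ?thesis
    by simp
qed

text \<open>Indicators of disjoint unit intervals witness infinite dimension, which keeps
  Gram--Schmidt from stopping after finitely many nonzero vectors.\<close>

lemma ex_orthonormal_sequence: "\<exists>u. orthosystem u \<and> (\<forall>n. u n \<noteq> 0)"
proof -
  define U where "U n = (indicator {real n<..real n + 1} :: real \<Rightarrow> complex)" for n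
  have int: "(\<integral>\<^sup>+x. indicator {real n<..real n + 1} x \<partial>lborel_pos) = 1" for n
  proof -
    have "(\<integral>\<^sup>+x. indicator {real n<..real n + 1} x \<partial>lborel_pos)
        = (\<integral>\<^sup>+x. indicator {real n<..real n + 1} x \<partial>lborel)"
      unfolding nn_integral_lborel_pos by (intro nn_integral_cong) (auto split: split_indicator)
    then show ?thesis
      by simp
  qed
  have sq: "square_integrable lborel_pos (U n)" for n
  proof (subst square_integrable_iff_nn)
    show "U n \<in> borel_measurable lborel_pos"
      unfolding U_def by measurable
    have "(\<integral>\<^sup>+x. ennreal ((cmod (U n x))\<^sup>2) \<partial>lborel_pos)
        = (\<integral>\<^sup>+x. indicator {real n<..real n + 1} x \<partial>lborel_pos)"
      unfolding U_def by (intro nn_integral_cong) (auto split: split_indicator)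
    then show "(\<integral>\<^sup>+x. ennreal ((cmod (U n x))\<^sup>2) \<partial>lborel_pos) < \<infinity>"
      by (simp add: int)
  qed
  have "cinner (abs_l2 (U i)) (abs_l2 (U j)) = (if i = j then 1 else 0)" for i j
  proof (cases "i = j")
    case True
    have "ennreal (LINT x|lborel_pos. (cmod (U i x))\<^sup>2) = (\<integral>\<^sup>+x. ennreal ((cmod (U i x))\<^sup>2) \<partial>lborel_pos)"
      using nn_integral_square_integrable[OF sq] by simp
    also have "\<dots> = (\<integral>\<^sup>+x. indicator {real i<..real i + 1} x \<partial>lborel_pos)"
      unfolding U_def by (intro nn_integral_cong) (auto split: split_indicator)
    finally have "(norm (abs_l2 (U i)))\<^sup>2 = 1"
      by (simp add: int norm_abs_l2[OF sq])
    then show ?thesis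
      using True by (simp add: cinner_self)
  next
    case False
    have "real i + 1 \<le> real j \<or> real j + 1 \<le> real i"
      using False by linarith
    then have "(\<lambda>x. U i x * cnj (U j x)) = (\<lambda>x. 0)"
      by (auto simp: U_def fun_eq_iff split: split_indicator)
    then show ?thesis
      using False by (simp add: cinner_abs_l2[OF sq sq])
  qed
  then have "orthosystem (\<lambda>n. abs_l2 (U n)) \<and> (\<forall>n. abs_l2 (U n) \<noteq> 0)"
    unfolding orthosystem_def by (metis cinner_zero_left zero_neq_one)
  then show ?thesis
    by blast
qed

text \<open>A basis in the sense of \<open>orthonormal_basis\<close> is indexed by all natural
  numbers, so the zero entries of Gram--Schmidt are skipped by enumerating the index set S of the
  others. This requires S to be infinite.\<close>

lemma ex_orthonormal_basis: "\<exists>e. orthonormal_basis e"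
proof -
  define v where "v n = abs_l2 (indicator {0<..real_of_rat (nat_to_rat_surj n)})" for n
  define g where "g = gram_schmidt v"
  have g: "orthosystem g"
    by (simp add: g_def orthosystem_gram_schmidt)
  have total: "f = 0" if "\<And>n. cinner f (g n) = 0" for f
  proof (rule rep_l2_eqI)
    fix n
    show "cinner f (abs_l2 (indicator {0<..real_of_rat (nat_to_rat_surj n)})) = 0"
      unfolding v_def[symmetric]
      by (subst gram_schmidt_expansion[of v n])
         (simp add: ortho_proj_def cinner_add_right cinner_sum_right cinner_scaleC_right that flip: g_def)
  qed
  define S where "S = {n. g n \<noteq> 0}"
  have "infinite S"
  proof
    assume "finite S"
    then obtain N where N: "\<And>n. n \<in> S \<Longrightarrow> n < N"
      by (metis bounded_nat_set_is_finite finite_nat_set_iff_bounded)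
    then have zero: "g n = 0" if "N \<le> n" for n
      using N[of n] that by (metis (mono_tags) S_def mem_Collect_eq leD)
    obtain u where u: "orthosystem u" "\<And>n. u n \<noteq> 0"
      using ex_orthonormal_sequence by (metis (no_types))
    have "(norm (u n))\<^sup>2 = 1" for n
      using orthosystemD[OF u(1), of n n] u(2)[of n] by (simp add: cinner_self flip: of_real_power)
    \<comment> \<open>A dimension count by traces: N + 1 orthonormal vectors fixed by the projection
      contribute N + 1, but after exchanging the two sums Bessel's inequality leaves at most
      N.\<close>
    then have "real (Suc N) = (\<Sum>n<Suc N. (norm (ortho_proj g N (u n)))\<^sup>2)"
      by (simp add: ortho_proj_eq_self[OF g zero total])
    also have "\<dots> = (\<Sum>i<N. \<Sum>n<Suc N. (cmod (cinner (g i) (u n)))\<^sup>2)"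
      unfolding norm_ortho_proj[OF g] 
      by (subst sum.swap) (intro sum.cong refl arg_cong[where f = "\<lambda>x. x\<^sup>2"] cmod_cinner_commute)
    also have "\<dots> \<le> (\<Sum>i<N. (norm (g i))\<^sup>2)"
      by (intro sum_mono bessel_inequality u)
    also have "\<dots> \<le> (\<Sum>i<N. 1)"
      by (intro sum_mono power_le_one orthosystem_norm g) auto
    finally show False
      by simp
  qed
  have range: "range (enumerate S) = S"
    using \<open>infinite S\<close> by (rule range_enumerate)
  have "orthonormal_basis (\<lambda>n. g (enumerate S n))"
    unfolding orthonormal_basis_def
  proof (intro conjI allI impI)
    fix m n
    have "g i \<noteq> 0" if "i \<in> S" for i
      using that by (simp add: S_def)
    then have "g (enumerate S m) \<noteq> 0"
      using \<open>infinite S\<close> by (simp add: enumerate_in_set)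
    moreover have "(enumerate S m = enumerate S n) = (m = n)"
      using \<open>infinite S\<close> strict_mono_enumerate strict_mono_eq by blast
    ultimately show "cinner (g (enumerate S m)) (g (enumerate S n)) = (if m = n then 1 else 0)"
      by (simp add: orthosystemD[OF g])
  next
    fix f
    assume f: "\<forall>n. cinner f (g (enumerate S n)) = 0"
    have "cinner f (g n) = 0" for n
    proof (cases "n \<in> S")
      case True
      then show ?thesis
        using f range by (metis imageE)
    qed (simp add: S_def)
    then show "f = 0"
      by (rule total)
  qed
  then show ?thesis
    by blast
qed

lemma orthonormal_basis_orthosystem: "orthonormal_basis e \<Longrightarrow> orthosystem e"
  unfolding orthonormal_basis_def orthosystem_def by (metis cinner_zero_left zero_neq_one)

lemma orthonormal_basis_self: "orthonormal_basis e \<Longrightarrow> cinner (e i) (e j) = (if i = j then 1 else 0)"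
  by (simp add: orthonormal_basis_def)

lemma summable_bessel:
  assumes "orthosystem e"
  shows "summable (\<lambda>i. (cmod (cinner f (e i)))\<^sup>2)"
  by (rule bounded_imp_summable[where B = "(norm f)\<^sup>2"])
     (use bessel_inequality[OF assms, of f "Suc n" for n] in \<open>auto simp: lessThan_Suc_atMost\<close>)

lemma orthonormal_basis_sums:
  assumes "orthonormal_basis e"
  shows "(\<lambda>i. cinner f (e i) *\<^sub>C e i) sums f"
proof -
  have e: "orthosystem e"
    using assms by (rule orthonormal_basis_orthosystem)
  obtain v where v: "(\<lambda>i. cinner f (e i) *\<^sub>C e i) sums v"
    using orthosystem_summable[OF e summable_bessel[OF e, of f]] by (auto simp: summable_def)
  have "cinner (f - v) (e n) = 0" for n
  proof -
    have "(\<lambda>i. cinner (cinner f (e i) *\<^sub>C e i) (e n)) sums cinner v (e n)"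
      by (rule bounded_linear.sums[OF bounded_linear_cinner_left v])
    moreover have "(\<lambda>i. cinner (cinner f (e i) *\<^sub>C e i) (e n)) = (\<lambda>i. if i = n then cinner f (e n) else 0)"
      by (auto simp: cinner_scaleC_left orthonormal_basis_self[OF assms])
    ultimately have "cinner v (e n) = cinner f (e n)"
      using sums_unique2 sums_single[of n "\<lambda>_. cinner f (e n)"] by metis
    then show ?thesis
      by (simp add: cinner_diff_left)
  qed
  then have "f - v = 0"
    using assms unfolding orthonormal_basis_def by blast
  then show ?thesis
    using v by simp
qed

lemma parseval_identity:
  assumes "orthonormal_basis e"
  shows "(\<lambda>i. cinner f (e i) * cinner (e i) g) sums cinner f g"
  using bounded_linear.sums[OF bounded_linear_cinner_left orthonormal_basis_sums[OF assms], of f g]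
  by (simp add: cinner_scaleC_left)

lemma parseval_norm:
  assumes "orthonormal_basis e"
  shows "(\<lambda>i. (cmod (cinner f (e i)))\<^sup>2) sums (norm f)\<^sup>2"
proof -
  have "cinner f (e i) * cinner (e i) f = of_real ((cmod (cinner f (e i)))\<^sup>2)" for i
    by (metis cinner_commute complex_norm_square)
  then show ?thesis
    using parseval_identity[OF assms, of f f] by (simp only: cinner_self sums_of_real_iff)
qed

text \<open>Bessel's inequality for both vectors, combined by Cauchy--Schwarz in the index. The
  bound does not depend on n, and so provides the dominating function in
  \<open>integral_rep_trace\<close>.\<close>

lemma bessel_bilinear:
  assumes "orthosystem e"
  shows "(\<Sum>i<n. cmod (cinner f (e i)) * cmod (cinner (e i) g)) \<le> norm f * norm g"
proof -
  have *: "L2_set (\<lambda>i. cmod (cinner f (e i))) {..<n} \<le> norm f" for f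
    unfolding L2_set_def using bessel_inequality[OF assms, of f n] by (intro real_le_lsqrt) (auto simp: sum_nonneg)
  have "(\<Sum>i<n. cmod (cinner f (e i)) * cmod (cinner (e i) g))
      = (\<Sum>i<n. \<bar>cmod (cinner f (e i))\<bar> * \<bar>cmod (cinner g (e i))\<bar>)"
    by (intro sum.cong refl) (simp only: abs_norm_cancel cmod_cinner_commute[of "e _" g])
  also have "\<dots> \<le> L2_set (\<lambda>i. cmod (cinner f (e i))) {..<n} * L2_set (\<lambda>i. cmod (cinner g (e i))) {..<n}"
    by (rule L2_set_mult_ineq)
  also have "\<dots> \<le> norm f * norm g"
    by (intro mult_mono *) auto
  finally show ?thesis .
qed

section \<open>Bounded operators, singular values and traces\<close>

text \<open>The representing vector is built from its coefficients in an orthonormal basis. Testing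
  \<phi> on the finite sum p with coefficients \<open>cnj (\<phi> (e i))\<close> gives S \<le> C
  sqrt S for the partial sum S of squares, hence S \<le> C^2 and the series converges.\<close>

lemma riesz_representation:
  assumes add: "\<And>f g. \<phi> (f + g) = \<phi> f + \<phi> g" and scale: "\<And>c f. \<phi> (c *\<^sub>C f) = c * \<phi> f"
    and bound: "\<And>f. cmod (\<phi> f) \<le> C * norm f"
  shows "\<exists>g. (\<forall>f. \<phi> f = cinner f g) \<and> norm g \<le> C"
proof -
  obtain e where e: "orthonormal_basis e"
    using ex_orthonormal_basis by blast
  note o = orthonormal_basis_orthosystem[OF e]
  have lin: "bounded_linear \<phi>"
    by (rule bounded_linear_intro[where K = C])
       (auto simp: add scale scaleR_l2_def scaleR_conv_of_real bound mult.commute[of _ C])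
  have sum: "\<phi> (\<Sum>i\<in>A. f i) = (\<Sum>i\<in>A. \<phi> (f i))" for f :: "nat \<Rightarrow> l2" and A
    by (rule linear_sum[OF bounded_linear.linear[OF lin]])
  \<comment> \<open>The bound at a single unit vector forces C \<ge> 0, on which the square root
    estimates rely.\<close>
  have "norm (e 0) = 1"
    using orthonormal_basis_self[OF e, of 0 0] power2_norm_l2[of "e 0"] norm_ge_zero[of "e 0"]
    by (auto simp: power2_eq_1_iff)
  then have C: "C \<ge> 0"
    using order_trans[OF norm_ge_zero bound[of "e 0"]] by simp
  have "(\<Sum>i<n. (cmod (\<phi> (e i)))\<^sup>2) \<le> C\<^sup>2" for n
  proof -
    define p where "p = (\<Sum>i<n. cnj (\<phi> (e i)) *\<^sub>C e i)"
    define S where "S = (\<Sum>i<n. (cmod (\<phi> (e i)))\<^sup>2)"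
    have "\<phi> p = (\<Sum>i<n. of_real ((cmod (\<phi> (e i)))\<^sup>2))"
      unfolding p_def sum scale by (intro sum.cong refl) (simp only: complex_norm_square mult.commute)
    then have "\<phi> p = of_real S"
      by (simp add: S_def)
    moreover have "S \<ge> 0"
      by (auto simp: S_def intro: sum_nonneg)
    ultimately have "S \<le> C * norm p"
      using bound[of p] by simp
    also have "\<dots> \<le> C * sqrt S"
      using norm_sum_orthosystem_le[OF o, of "{..<n}" "\<lambda>i. cnj (\<phi> (e i))"] C
      by (intro mult_left_mono real_le_rsqrt) (auto simp: p_def S_def)
    finally have "sqrt S * sqrt S \<le> C * sqrt S"
      using \<open>S \<ge> 0\<close> by simp
    then have "sqrt S \<le> C \<or> sqrt S \<le> 0"
      using \<open>S \<ge> 0\<close> by (metis linorder_not_less mult_right_less_imp_less mult_strict_right_mono)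
    then have "sqrt S \<le> C"
      using C \<open>S \<ge> 0\<close> by (cases "S = 0") auto
    then show ?thesis
      using C \<open>S \<ge> 0\<close> by (simp add: real_sqrt_le_iff' sqrt_le_D flip: S_def)
  qed
  then have "summable (\<lambda>i. (cmod (cnj (\<phi> (e i))))\<^sup>2)"
    by (intro bounded_imp_summable[where B = "C\<^sup>2"]) (simp_all only: complex_mod_cnj zero_le_power2 flip: lessThan_Suc_atMost)
  from orthosystem_summable[OF o this] obtain g where g: "(\<lambda>i. cnj (\<phi> (e i)) *\<^sub>C e i) sums g"
    by (auto simp: summable_def)
  have eq: "\<phi> f = cinner f g" for f
  proof -
    have "(\<lambda>i. cinner f (cnj (\<phi> (e i)) *\<^sub>C e i)) sums cinner f g"
      by (rule bounded_linear.sums[OF bounded_linear_cinner_right g])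
    then have "(\<lambda>i. \<phi> (cinner f (e i) *\<^sub>C e i)) sums cinner f g"
      by (simp add: cinner_scaleC_right scale mult.commute)
    then show ?thesis
      using bounded_linear.sums[OF lin orthonormal_basis_sums[OF e, of f]] sums_unique2 by blast
  qed
  have "norm g * norm g \<le> C * norm g"
    using bound[of g] by (simp add: eq cinner_self power2_eq_square flip: of_real_mult)
  then have "norm g \<le> C"
    using C by (cases "g = 0") auto
  with eq show ?thesis
    by blast
qed

lemma bounded_opsI:
  assumes "\<And>f g. T (f + g) = T f + T g" "\<And>c f. T (c *\<^sub>C f) = c *\<^sub>C T f"
    "\<And>f. norm (T f) \<le> C * norm f"
  shows "T \<in> bounded_ops"
  unfolding bounded_ops_def using assms
  by (auto intro!: bounded_linear_intro[where K = C] simp: scaleR_l2_def mult.commute[of _ C])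

lemma
  assumes "T \<in> bounded_ops"
  shows bounded_ops_add: "T (f + g) = T f + T g"
    and bounded_ops_diff: "T (f - g) = T f - T g"
    and bounded_ops_scaleC: "T (c *\<^sub>C f) = c *\<^sub>C T f"
    and bounded_ops_sum: "T (\<Sum>i\<in>A. h i) = (\<Sum>i\<in>A. T (h i))"
    and bounded_ops_norm: "norm (T f) \<le> onorm T * norm f"
    and bounded_ops_onorm_nonneg: "0 \<le> onorm T"
    and bounded_ops_linear: "bounded_linear T"
proof -
  show bl: "bounded_linear T" and "T (c *\<^sub>C f) = c *\<^sub>C T f"
    using assms by (auto simp: bounded_ops_def)
  then interpret bounded_linear T
    by simp
  show "T (f + g) = T f + T g" "T (f - g) = T f - T g" "T (\<Sum>i\<in>A. h i) = (\<Sum>i\<in>A. T (h i))"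
    by (rule add diff sum)+
  show "norm (T f) \<le> onorm T * norm f" "0 \<le> onorm T"
    using bl by (auto intro: onorm onorm_pos_le)
qed

text \<open>Riesz' theorem in the first argument for each fixed g; uniqueness of the representing
  vector makes it linear in g. Both adjoints and averages are obtained in this way.\<close>

lemma sesquilinear_form_operator:
  assumes "\<And>f f' g. B (f + f') g = B f g + B f' g" "\<And>c f g. B (c *\<^sub>C f) g = c * B f g"
    and "\<And>f g g'. B f (g + g') = B f g + B f g'" "\<And>c f g. B f (c *\<^sub>C g) = cnj c * B f g"
    and bound: "\<And>f g. cmod (B f g) \<le> C * norm f * norm g"
  shows "\<exists>X \<in> bounded_ops. (\<forall>f g. cinner f (X g) = B f g) \<and> (\<forall>g. norm (X g) \<le> C * norm g)"
proof -
  have "\<exists>h. (\<forall>f. B f g = cinner f h) \<and> norm h \<le> C * norm g" for g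
    by (rule riesz_representation) (use assms in \<open>simp_all add: mult.assoc mult.commute[of "norm g"]\<close>)
  then obtain X where X: "\<And>f g. B f g = cinner f (X g)" "\<And>g. norm (X g) \<le> C * norm g"
    by metis
  have "X \<in> bounded_ops"
  proof (rule bounded_opsI)
    show "X (f + g) = X f + X g" "X (c *\<^sub>C f) = c *\<^sub>C X f" for f g c
      by (rule l2_eqI_right, simp add: cinner_add_right cinner_scaleC_right assms flip: X)+
  qed (rule X)
  then show ?thesis
    using X by auto
qed

text \<open>Resolves the definite description in \<open>adjoint_op\<close>: Riesz' theorem gives
  existence, nondegeneracy of the inner product uniqueness.\<close>

lemma adjoint_op:
  assumes R: "R \<in> bounded_ops"
  shows cinner_adjoint_op: "cinner (R f) g = cinner f (adjoint_op R g)"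
    and adjoint_op_bounded: "adjoint_op R \<in> bounded_ops"
proof -
  have "\<exists>X \<in> bounded_ops. (\<forall>f g. cinner f (X g) = cinner (R f) g) \<and> (\<forall>g. norm (X g) \<le> onorm R * norm g)"
  proof (rule sesquilinear_form_operator)
    show "cmod (cinner (R f) g) \<le> onorm R * norm f * norm g" for f g
      using cinner_cauchy_schwarz[of "R f" g] bounded_ops_norm[OF R, of f]
      by (meson mult_right_mono norm_ge_zero order_trans)
  qed (simp_all add: bounded_ops_add[OF R] bounded_ops_scaleC[OF R] cinner_add_left cinner_add_right
        cinner_scaleC_left cinner_scaleC_right)
  then obtain X where X: "X \<in> bounded_ops" "\<And>f g. cinner f (X g) = cinner (R f) g"
    by blast
  have "adjoint_op R = X"
    unfolding adjoint_op_def
  proof (rule the_equality)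
    fix S
    assume "\<forall>f g. cinner (R f) g = cinner f (S g)"
    then show "S = X"
      using X(2) by (intro ext l2_eqI_right) simp
  qed (simp add: X)
  then show "cinner (R f) g = cinner f (adjoint_op R g)" "adjoint_op R \<in> bounded_ops"
    using X by auto
qed

lemma cinner_adjoint_op': "R \<in> bounded_ops \<Longrightarrow> cinner (adjoint_op R f) g = cinner f (R g)"
  by (metis cinner_adjoint_op cinner_commute)

lemma bounded_ops_plus:
  assumes S: "S \<in> bounded_ops" and T: "T \<in> bounded_ops"
  shows "(\<lambda>f. S f + T f) \<in> bounded_ops"
proof (rule bounded_opsI)
  show "norm (S f + T f) \<le> (onorm S + onorm T) * norm f" for f
    using norm_triangle_le[of "S f" "T f"] bounded_ops_norm[OF S, of f] bounded_ops_norm[OF T, of f]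
    by (simp add: algebra_simps)
qed (simp_all add: bounded_ops_add[OF S] bounded_ops_add[OF T] bounded_ops_scaleC[OF S]
      bounded_ops_scaleC[OF T] scaleC_add_right)

lemma bounded_ops_cmult:
  assumes T: "T \<in> bounded_ops"
  shows "(\<lambda>f. c *\<^sub>C T f) \<in> bounded_ops"
proof (rule bounded_opsI)
  show "norm (c *\<^sub>C T f) \<le> (cmod c * onorm T) * norm f" for f
    using bounded_ops_norm[OF T, of f] by (simp add: mult.assoc mult_left_mono)
qed (simp_all add: bounded_ops_add[OF T] bounded_ops_scaleC[OF T] scaleC_add_right mult.commute)

lemma bounded_ops_minus:
  assumes S: "S \<in> bounded_ops" and T: "T \<in> bounded_ops"
  shows "(\<lambda>f. S f - T f) \<in> bounded_ops"
proof -
  have "(\<lambda>f. S f - T f) = (\<lambda>f. S f + (-1) *\<^sub>C T f)"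
    by (rule ext, rule l2_eqI) (simp add: cinner_diff_left cinner_add_left cinner_scaleC_left)
  then show ?thesis
    using bounded_ops_plus[OF S bounded_ops_cmult[OF T]] by simp
qed

lemma bounded_ops_zero: "(\<lambda>f. 0) \<in> bounded_ops"
  by (rule bounded_opsI[where C = 0]) auto

lemma bounded_ops_compose:
  assumes S: "S \<in> bounded_ops" and T: "T \<in> bounded_ops"
  shows "(\<lambda>f. S (T f)) \<in> bounded_ops"
proof (rule bounded_opsI)
  show "norm (S (T f)) \<le> (onorm S * onorm T) * norm f" for f
    using order_trans[OF bounded_ops_norm[OF S] mult_left_mono[OF bounded_ops_norm[OF T]]]
      bounded_ops_onorm_nonneg[OF S] by (simp add: mult.assoc)
qed (simp_all add: bounded_ops_add[OF S] bounded_ops_add[OF T] bounded_ops_scaleC[OF S] bounded_ops_scaleC[OF T])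

lemma bounded_ops_ortho_proj:
  assumes "orthosystem e"
  shows "ortho_proj e n \<in> bounded_ops"
  by (rule bounded_opsI[where C = 1])
     (simp_all add: ortho_proj_add ortho_proj_scaleC norm_ortho_proj_le[OF assms])

lemma adjoint_op_norm:
  assumes R: "R \<in> bounded_ops"
  shows "norm (adjoint_op R g) \<le> onorm R * norm g"
proof (rule norm_le_of_cinner_le)
  fix h
  have "cmod (cinner (adjoint_op R g) h) = cmod (cinner g (R h))"
    by (simp add: cinner_adjoint_op'[OF R])
  also have "\<dots> \<le> norm g * (onorm R * norm h)"
    by (rule order_trans[OF cinner_cauchy_schwarz mult_left_mono[OF bounded_ops_norm[OF R] norm_ge_zero]])
  finally show "cmod (cinner (adjoint_op R g) h) \<le> onorm R * norm g * norm h"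
    by (simp add: mult_ac)
qed (simp add: bounded_ops_onorm_nonneg[OF R])

section \<open>Finite rank and approximation numbers\<close>

lemma rank_at_most_zero: "rank_at_most n (\<lambda>f. 0)"
  unfolding rank_at_most_def by (intro exI[of _ "\<lambda>_. 0"]) simp

lemma rank_at_most_mono:
  assumes "rank_at_most n T" "n \<le> m"
  shows "rank_at_most m T"
proof -
  obtain v where v: "\<And>f. \<exists>c. T f = (\<Sum>i<n. c i *\<^sub>C v i)"
    using assms(1) by (auto simp: rank_at_most_def)
  have "\<exists>c. T f = (\<Sum>i<m. c i *\<^sub>C v i)" for f
  proof -
    obtain c where c: "T f = (\<Sum>i<n. c i *\<^sub>C v i)"
      using v by metis
    have "(\<Sum>i<m. (if i < n then c i else 0) *\<^sub>C v i) = (\<Sum>i<n. c i *\<^sub>C v i)"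
      by (rule sum.mono_neutral_cong_right) (use assms(2) in auto)
    then show ?thesis
      by (intro exI[of _ "\<lambda>i. if i < n then c i else 0"]) (simp add: c)
  qed
  then show ?thesis
    unfolding rank_at_most_def by (intro exI[of _ v] allI)
qed

lemma rank_at_most_add:
  assumes "rank_at_most n S" "rank_at_most m T"
  shows "rank_at_most (n + m) (\<lambda>f. S f + T f)"
proof -
  obtain v where v: "\<And>f. \<exists>c. S f = (\<Sum>i<n. c i *\<^sub>C v i)"
    using assms(1) by (auto simp: rank_at_most_def)
  obtain w where w: "\<And>f. \<exists>c. T f = (\<Sum>i<m. c i *\<^sub>C w i)"
    using assms(2) by (auto simp: rank_at_most_def)
  define x where "x i = (if i < n then v i else w (i - n))" for i
  have "\<exists>c. S f + T f = (\<Sum>i<n + m. c i *\<^sub>C x i)" for f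
  proof -
    obtain c where c: "S f = (\<Sum>i<n. c i *\<^sub>C v i)"
      using v by metis
    obtain d where d: "T f = (\<Sum>i<m. d i *\<^sub>C w i)"
      using w by metis
    define b where "b i = (if i < n then c i else d (i - n))" for i
    have "(\<Sum>i<n + k. b i *\<^sub>C x i) = (\<Sum>i<n. c i *\<^sub>C v i) + (\<Sum>i<k. d i *\<^sub>C w i)" for k
      by (induction k) (simp_all add: b_def x_def)
    then show ?thesis
      by (intro exI[of _ b]) (simp add: c d)
  qed
  then show ?thesis
    unfolding rank_at_most_def by (intro exI[of _ x] allI)
qed

lemma rank_at_most_cmult:
  assumes "rank_at_most n T"
  shows "rank_at_most n (\<lambda>f. a *\<^sub>C T f)"
proof -
  obtain v where v: "\<And>f. \<exists>c. T f = (\<Sum>i<n. c i *\<^sub>C v i)"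
    using assms(1) by (auto simp: rank_at_most_def)
  have "\<exists>c. a *\<^sub>C T f = (\<Sum>i<n. c i *\<^sub>C v i)" for f
  proof -
    obtain c where "T f = (\<Sum>i<n. c i *\<^sub>C v i)"
      using v by metis
    then show ?thesis
      by (intro exI[of _ "\<lambda>i. a * c i"]) (simp add: scaleC_sum_right)
  qed
  then show ?thesis
    unfolding rank_at_most_def by (intro exI[of _ v] allI)
qed

lemma rank_at_most_diff:
  assumes "rank_at_most n S" "rank_at_most m T"
  shows "rank_at_most (n + m) (\<lambda>f. S f - T f)"
proof -
  have "(\<lambda>f. S f - T f) = (\<lambda>f. S f + (-1) *\<^sub>C T f)"
    by (rule ext, rule l2_eqI) (simp add: cinner_diff_left cinner_add_left cinner_scaleC_left)
  then show ?thesis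
    using rank_at_most_add[OF assms(1) rank_at_most_cmult[OF assms(2)]] by simp
qed

lemma rank_at_most_ortho_proj: "rank_at_most n (\<lambda>f. ortho_proj e n (T f))"
  unfolding rank_at_most_def ortho_proj_def by (intro exI[of _ e] allI) (rule exI, rule refl)

lemma rank_at_most_ortho_proj':
  assumes T: "T \<in> bounded_ops"
  shows "rank_at_most n (\<lambda>f. T (ortho_proj e n f))"
  unfolding rank_at_most_def
proof (intro exI[of _ "\<lambda>i. T (e i)"] allI)
  fix f
  show "\<exists>c. T (ortho_proj e n f) = (\<Sum>i<n. c i *\<^sub>C T (e i))"
    by (intro exI[of _ "\<lambda>i. cinner f (e i)"])
       (simp add: ortho_proj_def bounded_ops_sum[OF T] bounded_ops_scaleC[OF T])
qed

lemma gram_schmidt_ortho_proj: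
  assumes "j < n"
  shows "ortho_proj (gram_schmidt v) n (v j) = v j"
proof -
  define g where "g = gram_schmidt v"
  have g: "orthosystem g"
    by (simp add: g_def orthosystem_gram_schmidt)
  have v: "v j = ortho_proj g (Suc j) (v j)"
    unfolding g_def by (rule gram_schmidt_expansion)
  have "cinner (v j) (g i) = 0" if "\<not> i < Suc j" for i
    by (subst v) (simp only: cinner_ortho_proj_left[OF g] that if_False)
  then have "ortho_proj g n (v j) = ortho_proj g (Suc j) (v j)"
    unfolding ortho_proj_def using assms by (intro sum.mono_neutral_right) auto
  then show ?thesis
    using v by (simp add: g_def)
qed

text \<open>Gram--Schmidt turns the spanning family into an orthosystem of the same length n, padded
  by zero vectors, so that the rank bound is kept.\<close>

lemma rank_at_most_range:
  assumes "rank_at_most n K"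
  shows "\<exists>e. orthosystem e \<and> (\<forall>f. ortho_proj e n (K f) = K f)"
proof -
  obtain v where v: "\<And>f. \<exists>c. K f = (\<Sum>i<n. c i *\<^sub>C v i)"
    using assms by (auto simp: rank_at_most_def)
  note P = bounded_ops_ortho_proj[OF orthosystem_gram_schmidt[of v], of n]
  have "ortho_proj (gram_schmidt v) n (K f) = K f" for f
  proof -
    obtain c where "K f = (\<Sum>i<n. c i *\<^sub>C v i)"
      using v by metis
    then show ?thesis
      by (simp add: bounded_ops_sum[OF P] bounded_ops_scaleC[OF P] gram_schmidt_ortho_proj)
  qed
  then show ?thesis
    using orthosystem_gram_schmidt by (intro exI[of _ "gram_schmidt v"]) simp
qed

lemma singular_value_set_bdd_below:
  assumes T: "T \<in> bounded_ops"
  shows "bdd_below {onorm (\<lambda>f. T f - K f) | K. K \<in> bounded_ops \<and> rank_at_most n K}"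
  by (rule bdd_belowI[of _ 0]) (auto intro!: bounded_ops_onorm_nonneg bounded_ops_minus T)

lemma singular_value_set_nonempty:
  "{onorm (\<lambda>f. T f - K f) | K. K \<in> bounded_ops \<and> rank_at_most n K} \<noteq> {}"
  using bounded_ops_zero rank_at_most_zero[of n] by blast

lemma singular_value_nonneg:
  assumes T: "T \<in> bounded_ops"
  shows "0 \<le> singular_value n T"
  unfolding singular_value_def
  by (rule cInf_greatest[OF singular_value_set_nonempty])
     (auto intro!: bounded_ops_onorm_nonneg bounded_ops_minus T)

lemma singular_value_le:
  assumes "T \<in> bounded_ops" "K \<in> bounded_ops" "rank_at_most n K"
  shows "singular_value n T \<le> onorm (\<lambda>f. T f - K f)"
  unfolding singular_value_def
  by (rule cInf_lower[OF _ singular_value_set_bdd_below]) (use assms in blast)+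

lemma singular_value_less_ex:
  assumes "T \<in> bounded_ops" "singular_value n T < c"
  shows "\<exists>K\<in>bounded_ops. rank_at_most n K \<and> onorm (\<lambda>f. T f - K f) < c"
  using cInf_lessD[OF singular_value_set_nonempty assms(2)[unfolded singular_value_def]] by blast

lemma singular_value_antimono:
  assumes T: "T \<in> bounded_ops" and "n \<le> m"
  shows "singular_value m T \<le> singular_value n T"
  unfolding singular_value_def
  by (rule cInf_superset_mono[OF singular_value_set_nonempty singular_value_set_bdd_below[OF T]])
     (use rank_at_most_mono[OF _ \<open>n \<le> m\<close>] in blast)

section \<open>Rank-one operators, traces and integral representations\<close>

definition rank_one :: "l2 \<Rightarrow> l2 \<Rightarrow> l2 \<Rightarrow> l2" where
  "rank_one f g = (\<lambda>h. cinner h g *\<^sub>C f)"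

lemma rank_one_bounded: "rank_one f g \<in> bounded_ops"
proof (rule bounded_opsI)
  show "norm (rank_one f g h) \<le> (norm g * norm f) * norm h" for h
    using mult_right_mono[OF cinner_cauchy_schwarz[of h g], of "norm f"] by (simp add: rank_one_def mult_ac)
qed (simp_all add: rank_one_def cinner_add_left cinner_scaleC_left scaleC_add_left)

lemma rank_at_most_rank_one: "rank_at_most 1 (rank_one f g)"
  unfolding rank_at_most_def rank_one_def
  by (intro exI[of _ "\<lambda>_. f"] allI) (auto intro: exI[of _ "\<lambda>_. cinner _ g"])

lemma rank_one_schatten: "rank_one f g \<in> schatten_class 1"
proof -
  have "singular_value n (rank_one f g) = 0" if "n \<ge> 1" for n
  proof (rule antisym)
    have "rank_at_most n (rank_one f g)"
      using rank_at_most_rank_one that by (rule rank_at_most_mono)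
    from singular_value_le[OF rank_one_bounded rank_one_bounded this, of f g]
    show "singular_value n (rank_one f g) \<le> 0"
      by (simp add: onorm_zero)
  qed (rule singular_value_nonneg[OF rank_one_bounded])
  then have "summable (\<lambda>n. singular_value n (rank_one f g) ^ 1)"
    by (intro summable_finite[of "{0}"]) auto
  then show ?thesis
    by (simp add: schatten_class_def rank_one_bounded)
qed

text \<open>A relational form of \<open>op_trace\<close>. It contains the convergence of the
  diagonal sums in every basis, so that traces can be added and compared before the definite
  description is evaluated.\<close>

definition has_trace :: "(l2 \<Rightarrow> l2) \<Rightarrow> complex \<Rightarrow> bool" where
  "has_trace T t \<longleftrightarrow> (\<forall>e. orthonormal_basis e \<longrightarrow> (\<lambda>n. cinner (T (e n)) (e n)) sums t)"

text \<open>Uniqueness of the value depends on the existence of at least one orthonormal basis;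
  otherwise every number would satisfy the description vacuously.\<close>

lemma op_trace_eqI:
  assumes "has_trace T t"
  shows "op_trace T = t"
  unfolding op_trace_def
proof (rule the_equality)
  show "\<forall>e. orthonormal_basis e \<longrightarrow> (\<lambda>n. cinner (T (e n)) (e n)) sums t"
    using assms by (simp add: has_trace_def)
  fix s
  assume s: "\<forall>e. orthonormal_basis e \<longrightarrow> (\<lambda>n. cinner (T (e n)) (e n)) sums s"
  obtain e where "orthonormal_basis e"
    using ex_orthonormal_basis by blast
  with s assms show "s = t"
    unfolding has_trace_def using sums_unique2 by blast
qed

lemma has_trace_add:
  assumes "has_trace S s" "has_trace T t"
  shows "has_trace (\<lambda>f. S f + T f) (s + t)"
  using assms unfolding has_trace_def by (auto simp: cinner_add_left intro: sums_add)

lemma has_trace_diff: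
  assumes "has_trace S s" "has_trace T t"
  shows "has_trace (\<lambda>f. S f - T f) (s - t)"
  using assms unfolding has_trace_def by (auto simp: cinner_diff_left intro: sums_diff)

text \<open>
  \<open>T = \<integral> u\<^sub>z \<otimes> v\<^sub>z dM(z)\<close>, weakly and with integrable trace norms.  With a counting measure this is
  a nuclear representation of \<open>T\<close>.
\<close>

definition integral_rep :: "'z measure \<Rightarrow> ('z \<Rightarrow> l2) \<Rightarrow> ('z \<Rightarrow> l2) \<Rightarrow> (l2 \<Rightarrow> l2) \<Rightarrow> bool" where
  "integral_rep M u v T \<longleftrightarrow>
     (\<forall>h. (\<lambda>z. cinner (u z) h) \<in> borel_measurable M) \<and>
     (\<forall>h. (\<lambda>z. cinner h (v z)) \<in> borel_measurable M) \<and>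
     integrable M (\<lambda>z. norm (u z) * norm (v z)) \<and>
     (\<forall>h k. cinner (T h) k = (LINT z|M. cinner h (v z) * cinner (u z) k))"

text \<open>The families are only weakly measurable. Parseval's identity exhibits the inner product
  as a limit of finite sums of products of measurable scalar functions.\<close>

lemma borel_measurable_cinner_op:
  assumes u: "\<And>h. (\<lambda>z. cinner (u z) h) \<in> borel_measurable M"
    and v: "\<And>h. (\<lambda>z. cinner h (v z)) \<in> borel_measurable M" and R: "R \<in> bounded_ops"
  shows "(\<lambda>z. cinner (u z) (R (v z))) \<in> borel_measurable M"
proof -
  obtain e where e: "orthonormal_basis e"
    using ex_orthonormal_basis by blast
  show ?thesis
  proof (rule borel_measurable_LIMSEQ_metric)
    show "(\<lambda>N. \<Sum>n<N. cinner (u z) (e n) * cinner (e n) (R (v z))) \<longlonglongrightarrow> cinner (u z) (R (v z))" for z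
      using parseval_identity[OF e] by (simp add: sums_def)
    show "(\<lambda>z. \<Sum>n<N. cinner (u z) (e n) * cinner (e n) (R (v z))) \<in> borel_measurable M" for N
      by (intro borel_measurable_sum borel_measurable_times u)
         (simp add: v flip: cinner_adjoint_op'[OF R])
  qed
qed

text \<open>Sum and integral are interchanged by dominated convergence, with the majorant supplied
  by \<open>bessel_bilinear\<close>. The resulting integral does not mention e, and this is what
  makes the trace independent of the basis.\<close>

lemma integral_rep_trace:
  assumes T: "integral_rep M u v T" and R: "R \<in> bounded_ops"
  shows "has_trace (T \<circ> adjoint_op R) (LINT z|M. cinner (u z) (R (v z)))"
  unfolding has_trace_def
proof (intro allI impI)
  fix e
  assume e: "orthonormal_basis e"
  note o = orthonormal_basis_orthosystem[OF e]
  have u: "(\<lambda>z. cinner (u z) h) \<in> borel_measurable M"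
    and v: "(\<lambda>z. cinner h (v z)) \<in> borel_measurable M"
    and int: "integrable M (\<lambda>z. norm (u z) * norm (v z))"
    and T_eq: "cinner (T h) k = (LINT z|M. cinner h (v z) * cinner (u z) k)" for h k
    using T by (auto simp: integral_rep_def)
  define a where "a n z = cinner (u z) (e n) * cinner (e n) (R (v z))" for n z
  have a: "a n z = cinner (adjoint_op R (e n)) (v z) * cinner (u z) (e n)" for n z
    by (simp add: a_def cinner_adjoint_op'[OF R] mult.commute)
  have a_meas: "a n \<in> borel_measurable M" for n
    unfolding a by (intro borel_measurable_times u v)
  have bound: "cmod (\<Sum>n<N. a n z) \<le> onorm R * (norm (u z) * norm (v z))" for N z
  proof -
    have "cmod (\<Sum>n<N. a n z) \<le> (\<Sum>n<N. cmod (cinner (u z) (e n)) * cmod (cinner (e n) (R (v z))))"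
      unfolding a_def norm_mult[symmetric] by (rule norm_sum)
    also have "\<dots> \<le> norm (u z) * norm (R (v z))"
      by (rule bessel_bilinear[OF o])
    also have "\<dots> \<le> norm (u z) * (onorm R * norm (v z))"
      by (intro mult_left_mono bounded_ops_norm[OF R]) auto
    finally show ?thesis
      by (simp add: mult_ac)
  qed
  have int_R: "integrable M (\<lambda>z. onorm R * (norm (u z) * norm (v z)))"
    using int by (rule integrable_mult_right)
  have a_int: "integrable M (a n)" for n
  proof (rule Bochner_Integration.integrable_bound[OF int_R a_meas])
    have "norm (a n z) \<le> norm (onorm R * (norm (u z) * norm (v z)))" for z
    proof -
      have "cmod (a n z) \<le> norm (u z) * norm (e n) * (norm (e n) * norm (R (v z)))"
        unfolding a_def norm_mult by (intro mult_mono cinner_cauchy_schwarz) auto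
      also have "\<dots> \<le> norm (u z) * 1 * (1 * (onorm R * norm (v z)))"
        by (intro mult_mono orthosystem_norm[OF o] bounded_ops_norm[OF R] order_refl) auto
      also have "\<dots> \<le> norm (onorm R * (norm (u z) * norm (v z)))"
        by (simp add: mult_ac)
      finally show ?thesis .
    qed
    then show "AE z in M. norm (a n z) \<le> norm (onorm R * (norm (u z) * norm (v z)))"
      by simp
  qed
  have "(\<lambda>N. LINT z|M. (\<Sum>n<N. a n z)) \<longlonglongrightarrow> (LINT z|M. cinner (u z) (R (v z)))"
  proof (rule integral_dominated_convergence[OF _ _ int_R])
    show "(\<lambda>z. cinner (u z) (R (v z))) \<in> borel_measurable M"
      by (rule borel_measurable_cinner_op[OF u v R])
    show "(\<lambda>z. \<Sum>n<N. a n z) \<in> borel_measurable M" for N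
      by (intro borel_measurable_sum a_meas)
    show "AE z in M. (\<lambda>N. \<Sum>n<N. a n z) \<longlonglongrightarrow> cinner (u z) (R (v z))"
      unfolding a_def using parseval_identity[OF e] by (intro AE_I2) (simp add: sums_def)
    show "AE z in M. norm (\<Sum>n<N. a n z) \<le> onorm R * (norm (u z) * norm (v z))" for N
      by (intro AE_I2 bound)
  qed
  then show "(\<lambda>n. cinner ((T \<circ> adjoint_op R) (e n)) (e n)) sums (LINT z|M. cinner (u z) (R (v z)))"
    by (simp add: sums_def T_eq a Bochner_Integration.integral_sum a_int[unfolded a])
qed

lemma integral_rep_rank_one:
  "integral_rep (count_space {()}) (\<lambda>_. f) (\<lambda>_. g) (rank_one f g)"
  by (simp add: integral_rep_def rank_one_def cinner_scaleC_left lebesgue_integral_count_space_finite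
      integrable_count_space)

lemma rank_one_trace:
  assumes "R \<in> bounded_ops"
  shows "has_trace (rank_one f g \<circ> adjoint_op R) (cinner f (R g))"
  using integral_rep_trace[OF integral_rep_rank_one assms, of f g]
  by (simp add: lebesgue_integral_count_space_finite)

text \<open>The projection onto the orthosystem spanning the range fixes K h, and the coefficients
  of K h are inner products of h with the images of the basis vectors under the adjoint. The norm
  bounds make the trace norm at most n times the operator norm.\<close>

lemma finite_rank_decomposition:
  assumes K: "K \<in> bounded_ops" and "rank_at_most n K"
  shows "\<exists>u v. (\<forall>i. norm (u i) \<le> 1) \<and> (\<forall>i. norm (v i) \<le> onorm K) \<and>
           (\<forall>h. K h = (\<Sum>i<n. rank_one (u i) (v i) h))"
proof -
  obtain e where e: "orthosystem e" "\<And>f. ortho_proj e n (K f) = K f"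
    using rank_at_most_range[OF assms(2)] by metis
  have "norm (adjoint_op K (e i)) \<le> onorm K" for i
    using adjoint_op_norm[OF K, of "e i"] mult_left_mono[OF orthosystem_norm[OF e(1), of i] bounded_ops_onorm_nonneg[OF K]]
    by simp
  moreover have "K h = (\<Sum>i<n. rank_one (e i) (adjoint_op K (e i)) h)" for h
    using e(2)[of h] by (simp add: ortho_proj_def rank_one_def flip: cinner_adjoint_op[OF K])
  ultimately show ?thesis
    by (intro exI[of _ e] exI[of _ "\<lambda>i. adjoint_op K (e i)"]) (simp add: orthosystem_norm[OF e(1)])
qed

section \<open>Compact operators as norm limits of finite-rank operators\<close>

lemma onorm_le_unit_ball:
  fixes A :: "l2 \<Rightarrow> l2"
  assumes A: "A \<in> bounded_ops" and bound: "\<And>h. norm h \<le> 1 \<Longrightarrow> norm (A h) \<le> C"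
  shows "onorm A \<le> C"
proof -
  have C: "C \<ge> 0"
    using bound[of 0] order_trans[OF norm_ge_zero] by fastforce
  have "norm (A h) \<le> C * norm h" for h
  proof (cases "h = 0")
    case True
    then show ?thesis
      using bounded_ops_norm[OF A, of 0] by simp
  next
    case False
    have "h = of_real (norm h) *\<^sub>C sgn h"
      using False by (simp add: sgn_div_norm flip: scaleR_l2_def)
    then have "norm (A h) = norm h * norm (A (sgn h))"
      by (metis bounded_ops_scaleC[OF A] norm_scaleC abs_norm_cancel norm_of_real)
    also have "\<dots> \<le> norm h * C"
      by (intro mult_left_mono bound) (simp_all add: norm_sgn)
    finally show ?thesis
      by (simp add: mult.commute)
  qed
  with C show ?thesis
    by (rule onorm_bound)
qed

lemma compact_bounded_combinations:
  fixes e :: "nat \<Rightarrow> l2"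
  shows "compact {\<Sum>i<n. c i *\<^sub>C e i | c. \<forall>i<n. cmod (c i) \<le> B}"
proof (induction n)
  case (Suc n)
  define S where "S = {\<Sum>i<n. c i *\<^sub>C e i | c. \<forall>i<n. cmod (c i) \<le> B}"
  have lin: "bounded_linear (\<lambda>c. c *\<^sub>C e n)"
    by (rule bounded_linear_intro[where K = "norm (e n)"])
       (simp_all add: scaleC_add_left scaleR_l2_def scaleR_conv_of_real)
  have "{\<Sum>i<Suc n. c i *\<^sub>C e i | c. \<forall>i<Suc n. cmod (c i) \<le> B}
      = (\<lambda>p. fst p + snd p *\<^sub>C e n) ` (S \<times> cball 0 B)" (is "?L = ?R")
  proof
    show "?L \<subseteq> ?R"
    proof
      fix x
      assume "x \<in> ?L"
      then obtain c where c: "x = (\<Sum>i<Suc n. c i *\<^sub>C e i)" "\<forall>i<Suc n. cmod (c i) \<le> B"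
        by auto
      then have "(\<Sum>i<n. c i *\<^sub>C e i) \<in> S"
        by (auto simp: S_def)
      with c show "x \<in> ?R"
        by (intro image_eqI[of _ _ "(\<Sum>i<n. c i *\<^sub>C e i, c n)"]) auto
    qed
    show "?R \<subseteq> ?L"
    proof
      fix x
      assume "x \<in> ?R"
      then obtain c b where c: "x = (\<Sum>i<n. c i *\<^sub>C e i) + b *\<^sub>C e n" "\<forall>i<n. cmod (c i) \<le> B" "cmod b \<le> B"
        by (auto simp: S_def)
      then have "x = (\<Sum>i<Suc n. (c(n := b)) i *\<^sub>C e i)" "\<forall>i<Suc n. cmod ((c(n := b)) i) \<le> B"
        by (auto simp: less_Suc_eq)
      then show "x \<in> ?L"
        by blast
    qed
  qed
  moreover have "compact ((\<lambda>p. fst p + snd p *\<^sub>C e n) ` (S \<times> cball 0 B))"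
    using Suc.IH unfolding S_def
    by (intro compact_continuous_image compact_Times compact_cball continuous_on_add
        continuous_on_fst continuous_on_id bounded_linear.continuous_on[OF lin] continuous_on_snd)
  ultimately show ?case
    by simp
qed simp

lemma compact_opsI:
  assumes T: "T \<in> bounded_ops"
    and approx: "\<And>\<epsilon>. \<epsilon> > 0 \<Longrightarrow> \<exists>K\<in>bounded_ops. \<exists>n. rank_at_most n K \<and> onorm (\<lambda>f. T f - K f) \<le> \<epsilon>"
  shows "T \<in> compact_ops"
proof -
  have "\<exists>k. finite k \<and> closure (T ` cball 0 1) \<subseteq> (\<Union>x\<in>k. ball x \<epsilon>)" if "\<epsilon> > 0" for \<epsilon>
  proof -
    have "\<epsilon> / 4 > 0"
      using that by simp
    from approx[OF this] obtain K where K_bounded: "K \<in> bounded_ops"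
      and "\<exists>n. rank_at_most n K \<and> onorm (\<lambda>f. T f - K f) \<le> \<epsilon> / 4"
      by (rule bexE)
    from this(2) obtain n where "rank_at_most n K \<and> onorm (\<lambda>f. T f - K f) \<le> \<epsilon> / 4"
      by (rule exE)
    with K_bounded have K: "K \<in> bounded_ops" "rank_at_most n K" "onorm (\<lambda>f. T f - K f) \<le> \<epsilon> / 4"
      by simp_all
    obtain e where e: "orthosystem e" "\<And>f. ortho_proj e n (K f) = K f"
      using rank_at_most_range[OF K(2)] by metis
    define S where "S = {\<Sum>i<n. c i *\<^sub>C e i | c. \<forall>i<n. cmod (c i) \<le> onorm K}"
    have KS: "K f \<in> S" if "norm f \<le> 1" for f
    proof -
      have "cmod (cinner (K f) (e i)) \<le> onorm K" for i
      proof -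
        have "norm (K f) \<le> onorm K"
          using bounded_ops_norm[OF K(1), of f] mult_left_mono[OF that bounded_ops_onorm_nonneg[OF K(1)]]
          by simp
        then have "norm (K f) * norm (e i) \<le> onorm K * 1"
          using orthosystem_norm[OF e(1), of i] bounded_ops_onorm_nonneg[OF K(1)]
          by (rule mult_mono) simp
        then show ?thesis
          using cinner_cauchy_schwarz[of "K f" "e i"] by simp
      qed
      then show ?thesis
        unfolding S_def using e(2)[of f]
        by (intro CollectI exI[of _ "\<lambda>i. cinner (K f) (e i)"]) (simp add: ortho_proj_def)
    qed
    have "compact S"
      unfolding S_def by (rule compact_bounded_combinations)
    from compact_eq_totally_bounded[THEN iffD1, OF this, THEN conjunct2, rule_format, OF \<open>\<epsilon> / 4 > 0\<close>]
    obtain k where k: "finite k" "S \<subseteq> (\<Union>x\<in>k. ball x (\<epsilon> / 4))"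
      by (elim exE conjE)
    \<comment> \<open>Closed balls are used because a finite union of them is closed and hence also
      contains the closure. Their radius \<epsilon>/2 is spent half on the approximation of T by K
      and half on the net.\<close>
    have "T ` cball 0 1 \<subseteq> (\<Union>x\<in>k. cball x (\<epsilon> / 2))"
    proof
      fix y
      assume "y \<in> T ` cball 0 1"
      then obtain f where f: "y = T f" "norm f \<le> 1"
        by auto
      obtain x where x: "x \<in> k" "dist x (K f) < \<epsilon> / 4"
        using KS[OF f(2)] k(2) by auto
      have "norm (T f - K f) \<le> \<epsilon> / 4 * norm f"
        using bounded_ops_norm[OF bounded_ops_minus[OF T K(1)], of f] mult_right_mono[OF K(3), of "norm f"]
        by simp
      also have "\<dots> \<le> \<epsilon> / 4"
        using f(2) that by simp
      finally have "dist x y \<le> \<epsilon> / 2"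
        using x(2) dist_triangle[of x y "K f"] by (simp add: f(1) dist_norm norm_minus_commute)
      then show "y \<in> (\<Union>x\<in>k. cball x (\<epsilon> / 2))"
        using x(1) by auto
    qed
    moreover have "closed (\<Union>x\<in>k. cball x (\<epsilon> / 2))"
      using k(1) by (intro closed_UN) auto
    ultimately have "closure (T ` cball 0 1) \<subseteq> (\<Union>x\<in>k. cball x (\<epsilon> / 2))"
      by (rule closure_minimal)
    also have "\<dots> \<subseteq> (\<Union>x\<in>k. ball x \<epsilon>)"
      using that by (intro UN_mono) (auto simp: subset_iff)
    finally show ?thesis
      using k(1) by (intro exI[of _ k]) simp
  qed
  then have "compact (closure (T ` cball 0 1))"
    unfolding compact_eq_totally_bounded by (simp add: complete_eq_closed)
  with T show ?thesis
    by (simp add: compact_ops_def)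
qed

text \<open>The projection onto the span of an \<epsilon>/2-net of the image of the unit ball fixes
  the net and is a contraction. Hence it moves each T h by at most twice the distance of T h to the
  net.\<close>

lemma compact_ops_approx:
  assumes T: "T \<in> compact_ops" and \<epsilon>: "\<epsilon> > 0"
  shows "\<exists>K\<in>bounded_ops. \<exists>n. rank_at_most n K \<and> onorm (\<lambda>f. T f - K f) \<le> \<epsilon>"
proof -
  have Tb: "T \<in> bounded_ops" and "compact (closure (T ` cball 0 1))"
    using T by (auto simp: compact_ops_def)
  then obtain k where k: "finite k" "closure (T ` cball 0 1) \<subseteq> (\<Union>x\<in>k. ball x (\<epsilon> / 2))"
    using \<epsilon> unfolding compact_eq_totally_bounded by (meson divide_pos_pos zero_less_numeral)
  obtain v :: "nat \<Rightarrow> l2" and n where v: "k = v ` {i. i < n}"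
    using finite_imp_nat_seg_image_inj_on[OF k(1)] by metis
  define g where "g = gram_schmidt v"
  have g: "orthosystem g"
    by (simp add: g_def orthosystem_gram_schmidt)
  note P = bounded_ops_ortho_proj[OF g, of n]
  note K = bounded_ops_compose[OF P Tb]
  have "norm (T h - ortho_proj g n (T h)) \<le> \<epsilon>" if "norm h \<le> 1" for h
  proof -
    have "T h \<in> closure (T ` cball 0 1)"
      using that closure_subset by fastforce
    then obtain x where x: "x \<in> k" "dist x (T h) < \<epsilon> / 2"
      using k(2) by auto
    have "ortho_proj g n x = x"
      using x(1) v gram_schmidt_ortho_proj by (auto simp: g_def)
    then have "T h - ortho_proj g n (T h) = (T h - x) + ortho_proj g n (x - T h)"
      by (simp add: bounded_ops_diff[OF P])
    also have "norm \<dots> \<le> norm (T h - x) + norm (x - T h)"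
      by (rule norm_triangle_le) (simp add: norm_ortho_proj_le[OF g])
    also have "\<dots> \<le> \<epsilon>"
      using x(2) by (simp add: dist_norm norm_minus_commute)
    finally show ?thesis .
  qed
  then have "onorm (\<lambda>f. T f - ortho_proj g n (T f)) \<le> \<epsilon>"
    by (intro onorm_le_unit_ball bounded_ops_minus Tb K)
  then show ?thesis
    using K rank_at_most_ortho_proj by blast
qed

lemma schatten_2_compact:
  assumes "T \<in> schatten_class 2"
  shows "T \<in> compact_ops"
proof (rule compact_opsI)
  show T: "T \<in> bounded_ops"
    using assms by (simp add: schatten_class_def)
  fix \<epsilon> :: real
  assume "\<epsilon> > 0"
  have "(\<lambda>n. (singular_value n T)\<^sup>2) \<longlonglongrightarrow> 0"
    using assms by (intro summable_LIMSEQ_zero) (simp add: schatten_class_def)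
  then have "eventually (\<lambda>n. (singular_value n T)\<^sup>2 < \<epsilon>\<^sup>2) sequentially"
    by (rule order_tendstoD(2)) (use \<open>\<epsilon> > 0\<close> in simp)
  then obtain n where "(singular_value n T)\<^sup>2 < \<epsilon>\<^sup>2"
    by (auto simp: eventually_sequentially)
  then have "singular_value n T < \<epsilon>"
    by (rule power2_less_imp_less) (use \<open>\<epsilon> > 0\<close> in simp)
  from singular_value_less_ex[OF T this]
  show "\<exists>K\<in>bounded_ops. \<exists>n. rank_at_most n K \<and> onorm (\<lambda>f. T f - K f) \<le> \<epsilon>"
    by (meson less_imp_le)
qed

text \<open>Passes from approximation numbers to an absolutely convergent series of rank-one
  operators, the form in which traces can be computed by \<open>integral_rep_trace\<close> and
  averages by Fubini's theorem.\<close>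

lemma nuclear_decomposition:
  assumes "T \<in> schatten_class 1"
  shows "\<exists>u v. integral_rep (count_space (UNIV :: (nat \<times> nat) set)) u v T"
proof -
  have T: "T \<in> bounded_ops" and summable_s: "summable (\<lambda>n. singular_value n T)"
    using assms by (auto simp: schatten_class_def)
  define s where "s n = singular_value n T" for n
  have s_nonneg: "0 \<le> s n" for n
    by (simp add: s_def singular_value_nonneg[OF T])
  txt \<open>Telescope near-optimal approximants of rank \<open>2\<^sup>j\<close>; summability of \<open>2\<^sup>j s (2\<^sup>j)\<close> is Cauchy condensation.\<close>
  have condensed: "summable (\<lambda>j. 2 ^ j * s (2 ^ j))"
  proof (rule condensation_test[THEN iffD1])
    show "summable s"
      using summable_s by (simp add: s_def[abs_def])
    show "s (Suc m) \<le> s m" for m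
      unfolding s_def by (rule singular_value_antimono[OF T]) simp
  qed (rule s_nonneg)
  \<comment> \<open>The infimum in \<open>singular_value\<close> need not be attained. The slack
    4^(-j) remains summable after multiplication by ranks of order 2^j.\<close>
  have "\<exists>K\<in>bounded_ops. rank_at_most (2 ^ j) K \<and> onorm (\<lambda>f. T f - K f) < s (2 ^ j) + (1 / 4) ^ j" for j
    by (rule singular_value_less_ex[OF T]) (simp add: s_def)
  then obtain K where K: "\<And>j. K j \<in> bounded_ops" "\<And>j. rank_at_most (2 ^ j) (K j)"
    and K_approx: "\<And>j. onorm (\<lambda>f. T f - K j f) < s (2 ^ j) + (1 / 4) ^ j"
    by metis
  define D where "D j = (case j of 0 \<Rightarrow> K 0 | Suc i \<Rightarrow> (\<lambda>f. K (Suc i) f - K i f))" for j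
  have D: "D j \<in> bounded_ops" for j
    by (cases j) (simp_all add: D_def K bounded_ops_minus)
  \<comment> \<open>A uniform bound for the rank: a difference of consecutive approximants has rank
    at most 2^j + 2^(j-1), the initial term at most 1.\<close>
  define r :: "nat \<Rightarrow> nat" where "r j = 2 * 2 ^ j" for j
  have D_rank: "rank_at_most (r j) (D j)" for j
  proof (cases j)
    case 0
    then show ?thesis
      using rank_at_most_mono[OF K(2)[of 0], of 2] by (simp add: D_def r_def)
  next
    case (Suc i)
    then show ?thesis
      using rank_at_most_mono[OF rank_at_most_diff[OF K(2)[of "Suc i"] K(2)[of i]], of "r j"]
      by (simp add: D_def r_def)
  qed
  have onorm_D: "onorm (D (Suc i)) \<le> 2 * s (2 ^ i) + 2 * (1 / 4) ^ i" for i
  proof -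
    have mono: "s (2 ^ Suc i) \<le> s (2 ^ i)"
      unfolding s_def by (rule singular_value_antimono[OF T]) simp
    have "norm (D (Suc i) f) \<le> (2 * s (2 ^ i) + 2 * (1 / 4) ^ i) * norm f" for f
    proof -
      have "D (Suc i) f = (T f - K i f) - (T f - K (Suc i) f)"
        by (simp add: D_def)
      then have "norm (D (Suc i) f) \<le> norm (T f - K i f) + norm (T f - K (Suc i) f)"
        by (simp only: norm_triangle_ineq4)
      also have "\<dots> \<le> onorm (\<lambda>f. T f - K i f) * norm f + onorm (\<lambda>f. T f - K (Suc i) f) * norm f"
        by (intro add_mono bounded_ops_norm bounded_ops_minus T K)
      also have "\<dots> \<le> (s (2 ^ i) + (1 / 4) ^ i) * norm f + (s (2 ^ Suc i) + (1 / 4) ^ Suc i) * norm f"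
        by (intro add_mono mult_right_mono less_imp_le K_approx norm_ge_zero)
      also have "\<dots> \<le> (s (2 ^ i) + (1 / 4) ^ i) * norm f + (s (2 ^ i) + (1 / 4) ^ i) * norm f"
        using mono by (intro add_mono mult_right_mono order_refl) auto
      finally show ?thesis
        by (simp add: algebra_simps)
    qed
    then show ?thesis
      by (intro onorm_bound) (simp_all add: s_nonneg)
  qed
  have summable_D: "summable (\<lambda>j. real (r j) * onorm (D j))"
  proof (subst summable_Suc_iff[symmetric], rule summable_comparison_test')
    have "summable (\<lambda>i. 8 * (2 ^ i * s (2 ^ i)) + 8 * (1 / 2) ^ i)"
      by (intro summable_add summable_mult condensed summable_geometric) auto
    then show "summable (\<lambda>i. 8 * (2 ^ i * s (2 ^ i)) + 8 * (1 / 2) ^ i)" .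
    fix i :: nat
    have "real (r (Suc i)) * onorm (D (Suc i)) \<le> real (r (Suc i)) * (2 * s (2 ^ i) + 2 * (1 / 4) ^ i)"
      by (intro mult_left_mono onorm_D) simp
    also have "\<dots> = 8 * (2 ^ i * s (2 ^ i)) + 8 * (2 ^ i * (1 / 4) ^ i)"
      by (simp add: r_def algebra_simps)
    also have "2 ^ i * (1 / 4) ^ i = (1 / 2 :: real) ^ i"
      by (simp flip: power_mult_distrib)
    finally show "norm (real (r (Suc i)) * onorm (D (Suc i))) \<le> 8 * (2 ^ i * s (2 ^ i)) + 8 * (1 / 2) ^ i"
      by (simp add: bounded_ops_onorm_nonneg[OF D])
  qed
  have "\<forall>j. \<exists>u v. (\<forall>i. norm (u i) \<le> 1) \<and> (\<forall>i. norm (v i) \<le> onorm (D j)) \<and>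
           (\<forall>h. D j h = (\<Sum>i<r j. rank_one (u i) (v i) h))"
    using finite_rank_decomposition[OF D D_rank] by blast
  then obtain u where "\<forall>j. \<exists>v. (\<forall>i. norm (u j i) \<le> 1) \<and> (\<forall>i. norm (v i) \<le> onorm (D j)) \<and>
           (\<forall>h. D j h = (\<Sum>i<r j. rank_one (u j i) (v i) h))"
    unfolding choice_iff by (rule exE)
  then obtain v where uv: "\<forall>j. (\<forall>i. norm (u j i) \<le> 1) \<and> (\<forall>i. norm (v j i) \<le> onorm (D j)) \<and>
           (\<forall>h. D j h = (\<Sum>i<r j. rank_one (u j i) (v j i) h))"
    unfolding choice_iff by (rule exE)
  have u: "norm (u j i) \<le> 1" and v: "norm (v j i) \<le> onorm (D j)"
    and D_sum: "D j h = (\<Sum>i<r j. rank_one (u j i) (v j i) h)" for j i h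
    using uv by simp_all
  \<comment> \<open>Padding with zero vectors arranges blocks of the varying lengths
    \<open>r j\<close> on the single index set of all pairs.\<close>
  define U where "U p = (if snd p < r (fst p) then u (fst p) (snd p) else 0)" for p
  define V where "V p = v (fst p) (snd p)" for p
  let ?M = "count_space (UNIV :: (nat \<times> nat) set)"
  have bound: "norm (U (j, i)) * norm (V (j, i)) \<le> onorm (D j) * indicator {..<r j} i" for j i
    using mult_mono[OF u[of j i] v[of j i]] by (simp add: U_def V_def)
  have int: "integrable ?M (\<lambda>p. norm (U p) * norm (V p))"
  proof -
    have "(\<integral>\<^sup>+p. ennreal (norm (U p) * norm (V p)) \<partial>?M)
        = (\<integral>\<^sup>+j. \<integral>\<^sup>+i. ennreal (norm (U (j, i)) * norm (V (j, i))) \<partial>count_space UNIV \<partial>count_space UNIV)"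
      by (rule nn_integral_fst_count_space[symmetric])
    also have "\<dots> \<le> (\<integral>\<^sup>+j. \<integral>\<^sup>+i. ennreal (onorm (D j)) * indicator {..<r j} i \<partial>count_space UNIV \<partial>count_space UNIV)"
    proof (intro nn_integral_mono)
      fix j i
      have "ennreal (norm (U (j, i)) * norm (V (j, i))) \<le> ennreal (onorm (D j) * indicator {..<r j} i)"
        by (intro ennreal_leI bound)
      then show "ennreal (norm (U (j, i)) * norm (V (j, i))) \<le> ennreal (onorm (D j)) * indicator {..<r j} i"
        by (cases "i < r j") (simp_all add: U_def)
    qed
    also have "\<dots> = (\<integral>\<^sup>+j. ennreal (real (r j) * onorm (D j)) \<partial>count_space UNIV)"
    proof (intro nn_integral_cong)
      fix j
      have "(\<integral>\<^sup>+i. ennreal (onorm (D j)) * indicator {..<r j} i \<partial>count_space UNIV)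
          = ennreal (onorm (D j)) * of_nat (r j)"
        by (simp add: nn_integral_cmult_indicator)
      then show "(\<integral>\<^sup>+i. ennreal (onorm (D j)) * indicator {..<r j} i \<partial>count_space UNIV)
          = ennreal (real (r j) * onorm (D j))"
        by (simp add: ennreal_mult' ennreal_of_nat_eq_real_of_nat mult.commute)
    qed
    also have "\<dots> = (\<Sum>j. ennreal (real (r j) * onorm (D j)))"
      by (rule nn_integral_count_space_nat)
    also have "\<dots> < \<infinity>"
      by (subst suminf_ennreal2[OF _ summable_D]) (simp_all add: bounded_ops_onorm_nonneg[OF D])
    finally show ?thesis
      by (intro integrableI_bounded) simp_all
  qed
  have "cinner (T h) k = (LINT p|?M. cinner h (V p) * cinner (U p) k)" for h k
  proof -
    define F where "F p = cinner h (V p) * cinner (U p) k" for p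
    have int_F: "integrable ?M F"
    proof (rule Bochner_Integration.integrable_bound[OF integrable_mult_right[OF int, of "norm h * norm k"]])
      have "norm (F p) \<le> norm h * norm (V p) * (norm (U p) * norm k)" for p
        unfolding F_def norm_mult by (intro mult_mono cinner_cauchy_schwarz) auto
      then show "AE p in ?M. norm (F p) \<le> norm (norm h * norm k * (norm (U p) * norm (V p)))"
        by (simp add: mult_ac)
    qed simp
    interpret nat2: pair_sigma_finite "count_space (UNIV :: nat set)" "count_space (UNIV :: nat set)"
      by (intro pair_sigma_finite.intro sigma_finite_measure_count_space)
    have M: "?M = count_space UNIV \<Otimes>\<^sub>M count_space UNIV"
      by (subst pair_measure_countable) auto
    have inner: "(LINT i|count_space UNIV. F (j, i)) = cinner (D j h) k" for j
    proof -
      have "F (j, i) = 0" if "i \<notin> {..<r j}" for i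
        using that by (simp add: F_def U_def)
      then have "(\<lambda>i. F (j, i)) sums (\<Sum>i<r j. F (j, i))"
        by (intro sums_finite) auto
      moreover have "integrable (count_space UNIV) (\<lambda>i. F (j, i))"
        using \<open>\<And>i. i \<notin> {..<r j} \<Longrightarrow> F (j, i) = 0\<close>
        unfolding integrable_count_space_nat_iff by (intro summable_finite[of "{..<r j}"]) auto
      ultimately have "(LINT i|count_space UNIV. F (j, i)) = (\<Sum>i<r j. F (j, i))"
        using sums_integral_count_space_nat sums_unique2 by blast
      then show ?thesis
        by (simp add: D_sum cinner_sum_left rank_one_def cinner_scaleC_left F_def U_def V_def)
    qed
    have "(\<lambda>j. cinner (D j h) k) sums (LINT p|?M. F p)"
      using sums_integral_count_space_nat[OF nat2.integrable_fst'[OF int_F[unfolded M]]]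
        nat2.integral_fst'[OF int_F[unfolded M]] by (simp add: inner flip: M)
    moreover have "(\<lambda>j. cinner (D j h) k) sums cinner (T h) k"
    proof -
      have K_sum: "(\<Sum>j<Suc J. D j h) = K J h" for J
        by (induction J) (simp_all add: D_def)
      have "(\<lambda>J. K J h - T h) \<longlonglongrightarrow> 0"
      proof (rule Lim_null_comparison)
        show "eventually (\<lambda>J. norm (K J h - T h) \<le> (2 ^ J * s (2 ^ J) + (1 / 4) ^ J) * norm h) sequentially"
        proof (intro always_eventually allI)
          fix J
          have "norm (K J h - T h) \<le> onorm (\<lambda>f. T f - K J f) * norm h"
            using bounded_ops_norm[OF bounded_ops_minus[OF T K(1)[of J]], of h] by (simp add: norm_minus_commute)
          also have "\<dots> \<le> (s (2 ^ J) + (1 / 4) ^ J) * norm h"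
            by (rule mult_right_mono[OF less_imp_le[OF K_approx] norm_ge_zero])
          also have "\<dots> \<le> (2 ^ J * s (2 ^ J) + (1 / 4) ^ J) * norm h"
          proof (rule mult_right_mono)
            have "1 * s (2 ^ J) \<le> 2 ^ J * s (2 ^ J)"
              by (rule mult_right_mono[OF _ s_nonneg]) simp
            then show "s (2 ^ J) + (1 / 4) ^ J \<le> 2 ^ J * s (2 ^ J) + (1 / 4) ^ J"
              by simp
          qed simp
          finally show "norm (K J h - T h) \<le> (2 ^ J * s (2 ^ J) + (1 / 4) ^ J) * norm h" .
        qed
        have "(\<lambda>J. (2 ^ J * s (2 ^ J) + (1 / 4) ^ J) * norm h) \<longlonglongrightarrow> (0 + 0) * norm h"
          by (intro tendsto_mult tendsto_add tendsto_const summable_LIMSEQ_zero[OF condensed] LIMSEQ_realpow_zero) auto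
        then show "(\<lambda>J. (2 ^ J * s (2 ^ J) + (1 / 4) ^ J) * norm h) \<longlonglongrightarrow> 0"
          by simp
      qed
      then have "(\<lambda>J. K J h) \<longlonglongrightarrow> T h"
        by (rule LIM_zero_cancel)
      then have "(\<lambda>J. \<Sum>j<J. D j h) \<longlonglongrightarrow> T h"
        unfolding K_sum[symmetric] by (rule LIMSEQ_imp_Suc)
      then have "(\<lambda>j. D j h) sums T h"
        by (simp only: sums_def)
      then show ?thesis
        by (rule bounded_linear.sums[OF bounded_linear_cinner_left])
    qed
    ultimately show ?thesis
      unfolding F_def using sums_unique2 by blast
  qed
  then have "integral_rep ?M U V T"
    using int by (simp add: integral_rep_def)
  then show ?thesis
    by (intro exI)
qed

text \<open>A Hilbert--Schmidt bound that is uniform over orthosystems controls the approximation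
  numbers directly, without a singular value decomposition. Aiming at half of each operator norm
  costs the factor 4 in the final sum of squares.\<close>

lemma summable_singular_values:
  assumes D: "D \<in> bounded_ops"
    and HS: "\<And>e N. orthosystem e \<Longrightarrow> (\<Sum>i<N. (norm (D (e i)))\<^sup>2) \<le> B"
  shows "D \<in> schatten_class 2"
proof -
  define s where "s n = singular_value n D" for n
  have s_nonneg: "0 \<le> s n" for n
    by (simp add: s_def singular_value_nonneg[OF D])
  txt \<open>Greedy choice: \<open>e N\<close> nearly attains the norm of \<open>D\<close> on the orthogonal complement of its
    predecessors, and that norm is at least \<open>s N\<close>.\<close>
  have greedy: "\<exists>e. orthosystem e \<and> (\<forall>i\<ge>N. e i = 0) \<and> (\<forall>i<N. s i \<le> 2 * norm (D (e i)))" for N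
  proof (induction N)
    case 0
    show ?case
      by (intro exI[of _ "\<lambda>_. 0"]) (simp add: orthosystem_def)
  next
    case (Suc N)
    then obtain e where e: "orthosystem e" "\<And>i. N \<le> i \<Longrightarrow> e i = 0" "\<And>i. i < N \<Longrightarrow> s i \<le> 2 * norm (D (e i))"
      by auto
    show ?case
    proof (cases "s N = 0")
      case True
      then show ?thesis
        using e by (intro exI[of _ e]) (auto simp: less_Suc_eq)
    next
      case False
      then have pos: "s N > 0"
        using s_nonneg[of N] by simp
      note P = bounded_ops_ortho_proj[OF e(1), of N]
      have "s N \<le> onorm (\<lambda>f. D f - D (ortho_proj e N f))"
        unfolding s_def
        by (rule singular_value_le[OF D bounded_ops_compose[OF D P] rank_at_most_ortho_proj'[OF D]])
      then have "\<not> onorm (\<lambda>f. D f - D (ortho_proj e N f)) \<le> s N / 2"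
        using pos by simp
      have "\<exists>h. s N / 2 * norm h < norm (D h - D (ortho_proj e N h))"
      proof (rule ccontr)
        assume "\<not> (\<exists>h. s N / 2 * norm h < norm (D h - D (ortho_proj e N h)))"
        then have "norm (D h - D (ortho_proj e N h)) \<le> s N / 2 * norm h" for h
          by (simp add: not_less)
        then have "onorm (\<lambda>f. D f - D (ortho_proj e N f)) \<le> s N / 2"
          using pos by (intro onorm_bound) simp_all
        with \<open>\<not> onorm (\<lambda>f. D f - D (ortho_proj e N f)) \<le> s N / 2\<close> show False
          by simp
      qed
      then obtain h where h: "s N / 2 * norm h < norm (D h - D (ortho_proj e N h))"
        by (rule exE)
      define h' where "h' = h - ortho_proj e N h"
      have "norm h' \<le> norm h"
        unfolding h'_def by (rule power2_le_imp_le) (use norm_diff_ortho_proj[OF e(1), of h N] in \<open>simp_all add: sum_nonneg\<close>)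
      then have Dh': "norm (D h') > s N / 2 * norm h'"
        using h mult_left_mono[of "norm h'" "norm h" "s N / 2"] pos
        unfolding h'_def bounded_ops_diff[OF D] by linarith
      then have "h' \<noteq> 0"
        using bounded_ops_norm[OF D, of 0] by auto
      have D_sgn: "s N \<le> 2 * norm (D (sgn h'))"
      proof -
        have "norm (D (sgn h')) = norm (D h') / norm h'"
          by (simp add: sgn_div_norm scaleR_l2_def bounded_ops_scaleC[OF D] norm_inverse divide_inverse mult.commute)
        moreover have "s N / 2 < norm (D h') / norm h'"
          using Dh' \<open>h' \<noteq> 0\<close> by (simp add: pos_less_divide_eq)
        ultimately show ?thesis
          by linarith
      qed
      have orth: "cinner (sgn h') (e i) = 0" for i
      proof (cases "i < N")
        case True
        then show ?thesis
          by (simp add: h'_def sgn_div_norm cinner_scaleR_left cinner_diff_left cinner_ortho_proj_left[OF e(1)])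
      qed (simp add: e(2))
      have orth': "cinner (e i) (sgn h') = 0" for i
        using cinner_commute[of "e i" "sgn h'"] orth[of i] by simp
      have self: "cinner (sgn h') (sgn h') = 1"
        using \<open>h' \<noteq> 0\<close> by (simp add: cinner_self norm_sgn)
      have "orthosystem (e(N := sgn h'))"
        unfolding orthosystem_def using orthosystemD[OF e(1)] \<open>h' \<noteq> 0\<close>
        by (simp add: orth orth' self sgn_zero_iff)
      show ?thesis
      proof (intro exI[of _ "e(N := sgn h')"] conjI)
        show "orthosystem (e(N := sgn h'))"
          by fact
      qed (use e D_sgn in \<open>auto simp: less_Suc_eq\<close>)
    qed
  qed
  have "(\<Sum>i<N. (s i)\<^sup>2) \<le> 4 * B" for N
  proof -
    obtain e where e: "orthosystem e" "\<And>i. i < N \<Longrightarrow> s i \<le> 2 * norm (D (e i))"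
      using greedy[of N] by auto
    have "(\<Sum>i<N. (s i)\<^sup>2) \<le> (\<Sum>i<N. (2 * norm (D (e i)))\<^sup>2)"
      using s_nonneg by (intro sum_mono power_mono e) auto
    also have "\<dots> = 4 * (\<Sum>i<N. (norm (D (e i)))\<^sup>2)"
      by (simp add: power_mult_distrib sum_distrib_left)
    also have "\<dots> \<le> 4 * B"
      using HS[OF e(1)] by simp
    finally show ?thesis .
  qed
  then have "summable (\<lambda>n. (s n)\<^sup>2)"
    by (intro bounded_imp_summable[where B = "4 * B"]) (simp_all only: zero_le_power2 flip: lessThan_Suc_atMost)
  then show ?thesis
    using D by (simp add: schatten_class_def s_def)
qed

section \<open>Hilbert--Schmidt integral operators\<close>

abbreviation quadrant :: "(real \<times> real) measure" where
  "quadrant \<equiv> lborel_pos \<Otimes>\<^sub>M lborel_pos"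

text \<open>Conjugated because the inner product is conjugate-linear in its second argument;
  applying the integral operator to f then means taking the inner product of f with each section.
  The class is meaningful for the almost all x whose section is square integrable.\<close>

definition kernel_section :: "(real \<times> real \<Rightarrow> complex) \<Rightarrow> real \<Rightarrow> l2" where
  "kernel_section k x = abs_l2 (\<lambda>y. cnj (k (x, y)))"

lemma square_integrable_cnj: "square_integrable M f \<Longrightarrow> square_integrable M (\<lambda>x. cnj (f x))"
  by (auto simp: square_integrable_def)

lemma square_integrable_pair: "square_integrable quadrant (\<lambda>p. rep_l2 f (snd p) * cnj (rep_l2 g (fst p)))"
proof (subst square_integrable_iff_nn)
  have "(\<integral>\<^sup>+p. ennreal ((cmod (rep_l2 f (snd p) * cnj (rep_l2 g (fst p))))\<^sup>2) \<partial>quadrant)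
      = (\<integral>\<^sup>+x. \<integral>\<^sup>+y. ennreal ((cmod (rep_l2 g x))\<^sup>2) * ennreal ((cmod (rep_l2 f y))\<^sup>2) \<partial>lborel_pos \<partial>lborel_pos)"
    by (subst lborel_pos.nn_integral_fst[symmetric]) (simp_all add: norm_mult power_mult_distrib ennreal_mult' mult.commute)
  also have "\<dots> < \<infinity>"
    by (simp add: nn_integral_cmult nn_integral_multc nn_integral_rep_l2 ennreal_mult_less_top)
  finally show "(\<integral>\<^sup>+p. ennreal ((cmod (rep_l2 f (snd p) * cnj (rep_l2 g (fst p))))\<^sup>2) \<partial>quadrant) < \<infinity>" .
qed simp

context
  fixes k :: "real \<times> real \<Rightarrow> complex"
  assumes k: "square_integrable quadrant k"
begin

lemma kernel_measurable [measurable]: "k \<in> borel_measurable quadrant"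
  using k by (simp add: square_integrable_def)

lemma nn_integral_kernel:
  "(\<integral>\<^sup>+x. \<integral>\<^sup>+y. ennreal ((cmod (k (x, y)))\<^sup>2) \<partial>lborel_pos \<partial>lborel_pos)
    = (\<integral>\<^sup>+p. ennreal ((cmod (k p))\<^sup>2) \<partial>quadrant)"
  by (rule lborel_pos.nn_integral_fst) simp

lemma AE_square_integrable_section: "AE x in lborel_pos. square_integrable lborel_pos (\<lambda>y. k (x, y))"
proof -
  have "(\<integral>\<^sup>+x. \<integral>\<^sup>+y. ennreal ((cmod (k (x, y)))\<^sup>2) \<partial>lborel_pos \<partial>lborel_pos)
      = (\<integral>\<^sup>+p. ennreal ((cmod (k p))\<^sup>2) \<partial>quadrant)"
    by (rule lborel_pos.nn_integral_fst) simp
  also have "\<dots> \<noteq> \<infinity>"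
    by (simp add: nn_integral_square_integrable[OF k])
  finally have "AE x in lborel_pos. (\<integral>\<^sup>+y. ennreal ((cmod (k (x, y)))\<^sup>2) \<partial>lborel_pos) \<noteq> \<infinity>"
    by (intro nn_integral_noteq_infinite) auto
  then show ?thesis
  proof (rule AE_mp, intro AE_I2 impI)
    fix x
    assume [measurable]: "x \<in> space lborel_pos"
      and "(\<integral>\<^sup>+y. ennreal ((cmod (k (x, y)))\<^sup>2) \<partial>lborel_pos) \<noteq> \<infinity>"
    then show "square_integrable lborel_pos (\<lambda>y. k (x, y))"
      by (subst square_integrable_iff_nn) (simp_all add: less_top)
  qed
qed

lemma integral_eq_cinner_section:
  assumes "square_integrable lborel_pos (\<lambda>y. k (x, y))"
  shows "(LINT y|lborel_pos. k (x, y) * rep_l2 f y) = cinner f (kernel_section k x)"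
  using cinner_abs_l2[OF square_integrable_rep square_integrable_cnj[OF assms], of f]
  by (simp add: kernel_section_def mult.commute)

lemma norm_kernel_section:
  assumes "square_integrable lborel_pos (\<lambda>y. k (x, y))"
  shows "ennreal ((norm (kernel_section k x))\<^sup>2) = (\<integral>\<^sup>+y. ennreal ((cmod (k (x, y)))\<^sup>2) \<partial>lborel_pos)"
  using norm_abs_l2[OF square_integrable_cnj[OF assms]] nn_integral_square_integrable[OF assms]
  by (simp add: kernel_section_def)

lemma nn_integral_kernel_section:
  "(\<integral>\<^sup>+x. ennreal ((norm (kernel_section k x))\<^sup>2) \<partial>lborel_pos) = ennreal (LINT p|quadrant. (cmod (k p))\<^sup>2)"
proof -
  have "(\<integral>\<^sup>+x. ennreal ((norm (kernel_section k x))\<^sup>2) \<partial>lborel_pos)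
      = (\<integral>\<^sup>+x. \<integral>\<^sup>+y. ennreal ((cmod (k (x, y)))\<^sup>2) \<partial>lborel_pos \<partial>lborel_pos)"
    by (rule nn_integral_cong_AE) (use AE_square_integrable_section norm_kernel_section in \<open>auto elim: eventually_mono\<close>)
  also have "\<dots> = (\<integral>\<^sup>+p. ennreal ((cmod (k p))\<^sup>2) \<partial>quadrant)"
    by (rule lborel_pos.nn_integral_fst) simp
  finally show ?thesis
    by (simp add: nn_integral_square_integrable[OF k])
qed

text \<open>Links two forms of one integrand: the parametric integral on the left is measurable in
  x, which interchanging sums and integrals requires, while the inner product on the right is
  accessible to Bessel and Parseval.\<close>

lemma nn_integral_integral_op:
  "(\<integral>\<^sup>+x. ennreal ((cmod (LINT y|lborel_pos. k (x, y) * rep_l2 f y))\<^sup>2) \<partial>lborel_pos)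
    = (\<integral>\<^sup>+x. ennreal ((cmod (cinner f (kernel_section k x)))\<^sup>2) \<partial>lborel_pos)"
  by (rule nn_integral_cong_AE) (use AE_square_integrable_section integral_eq_cinner_section in \<open>auto elim: eventually_mono\<close>)

lemma square_integrable_integral_op:
  "square_integrable lborel_pos (\<lambda>x. LINT y|lborel_pos. k (x, y) * rep_l2 f y)"
proof (subst square_integrable_iff_nn)
  have "(\<integral>\<^sup>+x. ennreal ((cmod (LINT y|lborel_pos. k (x, y) * rep_l2 f y))\<^sup>2) \<partial>lborel_pos)
      \<le> (\<integral>\<^sup>+x. ennreal ((norm f)\<^sup>2) * (\<integral>\<^sup>+y. ennreal ((cmod (k (x, y)))\<^sup>2) \<partial>lborel_pos) \<partial>lborel_pos)"
  proof (rule nn_integral_mono_AE)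
    show "AE x in lborel_pos. ennreal ((cmod (LINT y|lborel_pos. k (x, y) * rep_l2 f y))\<^sup>2)
        \<le> ennreal ((norm f)\<^sup>2) * (\<integral>\<^sup>+y. ennreal ((cmod (k (x, y)))\<^sup>2) \<partial>lborel_pos)"
      using AE_square_integrable_section
    proof eventually_elim
      case (elim x)
      have "(cmod (cinner f (kernel_section k x)))\<^sup>2 \<le> (norm f * norm (kernel_section k x))\<^sup>2"
        by (intro power_mono cinner_cauchy_schwarz) simp
      then show ?case
        by (simp add: integral_eq_cinner_section[OF elim] power_mult_distrib
            flip: norm_kernel_section[OF elim] ennreal_mult')
    qed
  qed
  also have "\<dots> = ennreal ((norm f)\<^sup>2) * (\<integral>\<^sup>+p. ennreal ((cmod (k p))\<^sup>2) \<partial>quadrant)"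
    by (subst nn_integral_cmult) (simp_all add: nn_integral_kernel)
  also have "\<dots> < \<infinity>"
    by (simp add: nn_integral_square_integrable[OF k] ennreal_mult_less_top)
  finally show "(\<integral>\<^sup>+x. ennreal ((cmod (LINT y|lborel_pos. k (x, y) * rep_l2 f y))\<^sup>2) \<partial>lborel_pos) < \<infinity>" .
qed simp

lemma norm_integral_op:
  "ennreal ((norm (integral_op k f))\<^sup>2) = (\<integral>\<^sup>+x. ennreal ((cmod (cinner f (kernel_section k x)))\<^sup>2) \<partial>lborel_pos)"
  unfolding integral_op_def norm_abs_l2[OF square_integrable_integral_op]
  by (simp add: nn_integral_integral_op flip: nn_integral_square_integrable[OF square_integrable_integral_op])

lemma sum_norm_integral_op_le:
  assumes "orthosystem e"
  shows "(\<Sum>i<N. (norm (integral_op k (e i)))\<^sup>2) \<le> (LINT p|quadrant. (cmod (k p))\<^sup>2)"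
proof -
  have "ennreal (\<Sum>i<N. (norm (integral_op k (e i)))\<^sup>2)
      = (\<Sum>i<N. \<integral>\<^sup>+x. ennreal ((cmod (LINT y|lborel_pos. k (x, y) * rep_l2 (e i) y))\<^sup>2) \<partial>lborel_pos)"
    by (simp add: nn_integral_integral_op flip: norm_integral_op sum_ennreal)
  also have "\<dots> = (\<integral>\<^sup>+x. (\<Sum>i<N. ennreal ((cmod (LINT y|lborel_pos. k (x, y) * rep_l2 (e i) y))\<^sup>2)) \<partial>lborel_pos)"
    by (rule nn_integral_sum[symmetric]) simp
  also have "\<dots> \<le> (\<integral>\<^sup>+x. ennreal ((norm (kernel_section k x))\<^sup>2) \<partial>lborel_pos)"
  proof (rule nn_integral_mono_AE)
    show "AE x in lborel_pos. (\<Sum>i<N. ennreal ((cmod (LINT y|lborel_pos. k (x, y) * rep_l2 (e i) y))\<^sup>2))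
        \<le> ennreal ((norm (kernel_section k x))\<^sup>2)"
      using AE_square_integrable_section
    proof eventually_elim
      case (elim x)
      show ?case
        using bessel_inequality[OF assms, of "kernel_section k x" N]
        by (simp add: integral_eq_cinner_section[OF elim] cmod_cinner_commute[of "e _"] sum_ennreal)
    qed
  qed
  also have "\<dots> = ennreal (LINT p|quadrant. (cmod (k p))\<^sup>2)"
    by (rule nn_integral_kernel_section)
  finally show ?thesis
    by (subst (asm) ennreal_le_iff) simp_all
qed

text \<open>Tonelli's theorem over the basis index, then Parseval's identity for almost every
  section. The sum is thereby the same for all bases, which \<open>integral_op_trace_self\<close>
  turns into the existence of a trace.\<close>

lemma sums_norm_integral_op:
  assumes "orthonormal_basis e"
  shows "(\<lambda>n. (norm (integral_op k (e n)))\<^sup>2) sums (LINT p|quadrant. (cmod (k p))\<^sup>2)"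
proof -
  have "(\<Sum>n. ennreal ((norm (integral_op k (e n)))\<^sup>2))
      = (\<integral>\<^sup>+x. (\<Sum>n. ennreal ((cmod (LINT y|lborel_pos. k (x, y) * rep_l2 (e n) y))\<^sup>2)) \<partial>lborel_pos)"
    by (subst nn_integral_suminf) (simp_all add: nn_integral_integral_op flip: norm_integral_op)
  also have "\<dots> = (\<integral>\<^sup>+x. ennreal ((norm (kernel_section k x))\<^sup>2) \<partial>lborel_pos)"
  proof (rule nn_integral_cong_AE)
    show "AE x in lborel_pos. (\<Sum>n. ennreal ((cmod (LINT y|lborel_pos. k (x, y) * rep_l2 (e n) y))\<^sup>2))
        = ennreal ((norm (kernel_section k x))\<^sup>2)"
      using AE_square_integrable_section
    proof eventually_elim
      case (elim x)
      show ?case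
        using parseval_norm[OF assms, of "kernel_section k x"]
        by (simp add: integral_eq_cinner_section[OF elim] cmod_cinner_commute[of "e _"] suminf_ennreal_eq sums_iff)
    qed
  qed
  also have "\<dots> = ennreal (LINT p|quadrant. (cmod (k p))\<^sup>2)"
    by (rule nn_integral_kernel_section)
  finally have eq: "(\<Sum>n. ennreal ((norm (integral_op k (e n)))\<^sup>2)) = ennreal (LINT p|quadrant. (cmod (k p))\<^sup>2)" .
  have "(\<lambda>n. ennreal ((norm (integral_op k (e n)))\<^sup>2)) sums (\<Sum>n. ennreal ((norm (integral_op k (e n)))\<^sup>2))"
    by (rule summable_sums) simp
  then show ?thesis
    unfolding eq by (subst (asm) sums_ennreal) simp_all
qed

lemma cinner_integral_op:
  "cinner (integral_op k f) g = (LINT p|quadrant. k p * rep_l2 f (snd p) * cnj (rep_l2 g (fst p)))"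
  "integrable quadrant (\<lambda>p. k p * rep_l2 f (snd p) * cnj (rep_l2 g (fst p)))"
proof -
  from square_integrable_mult_cnj[OF k square_integrable_cnj[OF square_integrable_pair[of f g]]]
  show int: "integrable quadrant (\<lambda>p. k p * rep_l2 f (snd p) * cnj (rep_l2 g (fst p)))"
    by (simp add: mult_ac)
  have "cinner (integral_op k f) g = (LINT x|lborel_pos. (LINT y|lborel_pos. k (x, y) * rep_l2 f y) * cnj (rep_l2 g x))"
    using cinner_abs_l2[OF square_integrable_integral_op square_integrable_rep, of f g] by (simp add: integral_op_def)
  also have "\<dots> = (LINT x|lborel_pos. LINT y|lborel_pos. k (x, y) * rep_l2 f y * cnj (rep_l2 g x))"
    by (intro Bochner_Integration.integral_cong refl) (rule integral_mult_left_zero[symmetric])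
  also have "\<dots> = (LINT p|quadrant. k p * rep_l2 f (snd p) * cnj (rep_l2 g (fst p)))"
    using lborel_pos2.integral_fst'[OF int] by simp
  finally show "cinner (integral_op k f) g = (LINT p|quadrant. k p * rep_l2 f (snd p) * cnj (rep_l2 g (fst p)))" .
qed

lemma integral_op_add: "integral_op k (f + g) = integral_op k f + integral_op k g"
  unfolding integral_op_def add_abs_l2[OF square_integrable_integral_op square_integrable_integral_op]
  by (subst abs_l2_eq_iff)
     (auto intro: square_integrable_integral_op square_integrable_add
       intro!: eventually_mono[OF AE_square_integrable_section] simp: integral_eq_cinner_section cinner_add_left)

lemma integral_op_scaleC: "integral_op k (c *\<^sub>C f) = c *\<^sub>C integral_op k f"
  unfolding integral_op_def scaleC_abs_l2[OF square_integrable_integral_op]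
  by (subst abs_l2_eq_iff)
     (auto intro: square_integrable_integral_op square_integrable_scale
       intro!: eventually_mono[OF AE_square_integrable_section] simp: integral_eq_cinner_section cinner_scaleC_left)

lemma integral_op_bounded: "integral_op k \<in> bounded_ops"
proof (rule bounded_opsI)
  fix f
  define C where "C = sqrt (LINT p|quadrant. (cmod (k p))\<^sup>2)"
  have "ennreal ((norm (integral_op k f))\<^sup>2)
      \<le> (\<integral>\<^sup>+x. ennreal ((norm f)\<^sup>2) * ennreal ((norm (kernel_section k x))\<^sup>2) \<partial>lborel_pos)"
    unfolding norm_integral_op
    by (intro nn_integral_mono)
       (auto simp flip: ennreal_mult' power_mult_distrib intro!: ennreal_leI power_mono cinner_cauchy_schwarz)
  also have "\<dots> = (\<integral>\<^sup>+x. ennreal ((norm f)\<^sup>2) * (\<integral>\<^sup>+y. ennreal ((cmod (k (x, y)))\<^sup>2) \<partial>lborel_pos) \<partial>lborel_pos)"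
    by (rule nn_integral_cong_AE) (use AE_square_integrable_section norm_kernel_section in \<open>auto elim: eventually_mono\<close>)
  also have "\<dots> = ennreal ((norm f)\<^sup>2) * (\<integral>\<^sup>+p. ennreal ((cmod (k p))\<^sup>2) \<partial>quadrant)"
    by (subst nn_integral_cmult) (simp_all add: nn_integral_kernel)
  also have "\<dots> = ennreal ((C * norm f)\<^sup>2)"
    by (simp add: nn_integral_square_integrable[OF k] C_def power_mult_distrib mult.commute flip: ennreal_mult')
  finally have "(norm (integral_op k f))\<^sup>2 \<le> (C * norm f)\<^sup>2"
    by simp
  then show "norm (integral_op k f) \<le> C * norm f"
    by (rule power2_le_imp_le) (simp add: C_def)
qed (rule integral_op_add integral_op_scaleC)+

lemma integral_op_schatten: "integral_op k \<in> schatten_class 2"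
  by (rule summable_singular_values[OF integral_op_bounded sum_norm_integral_op_le])

end

declare kernel_measurable [measurable del]

lemma square_integrable_swap_cnj:
  assumes "square_integrable quadrant k"
  shows "square_integrable quadrant (\<lambda>p. cnj (k (snd p, fst p)))"
proof -
  have [measurable]: "k \<in> borel_measurable quadrant"
    using assms unfolding square_integrable_def by (rule conjunct1)
  have int: "integrable quadrant (\<lambda>p. (cmod (k p))\<^sup>2)"
    using assms unfolding square_integrable_def by (rule conjunct2)
  have "integrable quadrant (\<lambda>(x, y). (cmod (k (y, x)))\<^sup>2)"
    by (rule lborel_pos2.integrable_product_swap[OF int])
  moreover have "(\<lambda>p. cnj (k (snd p, fst p))) \<in> borel_measurable quadrant"
    by measurable
  ultimately show ?thesis
    unfolding square_integrable_def case_prod_beta' complex_mod_cnj by (rule conjI[rotated])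
qed

lemma adjoint_integral_op:
  assumes k: "square_integrable quadrant k"
  shows "adjoint_op (integral_op k) = integral_op (\<lambda>p. cnj (k (snd p, fst p)))"
proof (intro ext l2_eqI)
  fix g f
  note k' = square_integrable_swap_cnj[OF k]
  have "cinner (adjoint_op (integral_op k) g) f = cnj (cinner (integral_op k f) g)"
    using cinner_adjoint_op[OF integral_op_bounded[OF k], of f g] cinner_commute by metis
  also have "\<dots> = (LINT p|quadrant. cnj (k p * rep_l2 f (snd p) * cnj (rep_l2 g (fst p))))"
    unfolding cinner_integral_op(1)[OF k] by (rule Bochner_Integration.integral_cnj[symmetric])
  also have "\<dots> = (LINT p|quadrant. cnj (k (snd p, fst p)) * rep_l2 g (snd p) * cnj (rep_l2 f (fst p)))"
    using lborel_pos2.integral_product_swap[OF borel_measurable_integrable[OF cinner_integral_op(2)[OF k', of g f]]]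
    by (simp add: case_prod_beta' mult_ac)
  also have "\<dots> = cinner (integral_op (\<lambda>p. cnj (k (snd p, fst p))) g) f"
    by (rule cinner_integral_op(1)[OF k', symmetric])
  finally show "cinner (adjoint_op (integral_op k) g) f = cinner (integral_op (\<lambda>p. cnj (k (snd p, fst p))) g) f" .
qed

text \<open>Definiteness of the Hilbert--Schmidt inner product on integral operators, the source of
  uniqueness of the orthogonal projection. The diagonal entries are the squared norms of the adjoint
  at the basis vectors, and the adjoint is again an integral operator.\<close>

lemma integral_op_trace_self:
  assumes k: "square_integrable quadrant k"
  shows "\<exists>t. has_trace (integral_op k \<circ> adjoint_op (integral_op k)) t \<and> (t = 0 \<longrightarrow> integral_op k = (\<lambda>f. 0))"
proof -
  define D where "D = integral_op k"
  have D: "D \<in> bounded_ops"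
    by (simp add: D_def integral_op_bounded[OF k])
  define t where "t = (LINT p|quadrant. (cmod (cnj (k (snd p, fst p))))\<^sup>2)"
  have sums: "(\<lambda>n. (norm (adjoint_op D (e n)))\<^sup>2) sums t" if "orthonormal_basis e" for e
    unfolding t_def D_def adjoint_integral_op[OF k]
    by (rule sums_norm_integral_op[OF square_integrable_swap_cnj[OF k] that])
  have "cinner ((D \<circ> adjoint_op D) f) f = of_real ((norm (adjoint_op D f))\<^sup>2)" for f
    by (simp only: o_apply cinner_adjoint_op[OF D] cinner_self)
  then have "has_trace (D \<circ> adjoint_op D) (of_real t)"
    unfolding has_trace_def using sums by (simp only: sums_of_real_iff) simp
  moreover have "D = (\<lambda>f. 0)" if "t = 0"
  proof
    fix f
    obtain e where e: "orthonormal_basis e"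
      using ex_orthonormal_basis by blast
    have "(norm (adjoint_op D (e n)))\<^sup>2 = 0" for n
      using sums[OF e] that suminf_eq_zero_iff[of "\<lambda>n. (norm (adjoint_op D (e n)))\<^sup>2"]
      by (auto simp: sums_iff)
    then have "cinner (D f) (e n) = 0" for n
      by (simp add: cinner_adjoint_op[OF D])
    then show "D f = 0"
      using e unfolding orthonormal_basis_def by blast
  qed
  ultimately show ?thesis
    by (intro exI[of _ "of_real t"]) (simp add: D_def)
qed

lemma integral_op_diff:
  assumes k: "square_integrable quadrant k" and k': "square_integrable quadrant k'"
  shows "square_integrable quadrant (\<lambda>p. k p - k' p)"
    and "integral_op (\<lambda>p. k p - k' p) = (\<lambda>f. integral_op k f - integral_op k' f)"
proof -
  show d: "square_integrable quadrant (\<lambda>p. k p - k' p)"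
    using square_integrable_add[OF k square_integrable_scale[OF k', of "-1"]] by simp
  show "integral_op (\<lambda>p. k p - k' p) = (\<lambda>f. integral_op k f - integral_op k' f)"
  proof (intro ext l2_eqI)
    fix f g
    show "cinner (integral_op (\<lambda>p. k p - k' p) f) g = cinner (integral_op k f - integral_op k' f) g"
      using cinner_integral_op(2)[OF k, of f g] cinner_integral_op(2)[OF k', of f g]
      by (simp add: cinner_diff_left cinner_integral_op(1)[OF k] cinner_integral_op(1)[OF k']
          cinner_integral_op(1)[OF d] left_diff_distrib)
  qed
qed

declare measurable_ident_lborel_pos [measurable del]

section \<open>Fourier integrals\<close>

lemma (in pair_sigma_finite) integrable_tensor:
  fixes f :: "'a \<Rightarrow> complex" and g :: "'b \<Rightarrow> complex"
  assumes f: "integrable M1 f" and g: "integrable M2 g"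
  shows "integrable (M1 \<Otimes>\<^sub>M M2) (\<lambda>p. f (fst p) * g (snd p))"
proof (rule Fubini_integrable)
  note [measurable] = borel_measurable_integrable[OF f] borel_measurable_integrable[OF g]
  show "(\<lambda>p. f (fst p) * g (snd p)) \<in> borel_measurable (M1 \<Otimes>\<^sub>M M2)"
    by measurable
  show "integrable M1 (\<lambda>x. LINT y|M2. norm (f (fst (x, y)) * g (snd (x, y))))"
    using f by (simp add: norm_mult)
  show "AE x in M1. integrable M2 (\<lambda>y. f (fst (x, y)) * g (snd (x, y)))"
    using g by simp
qed

lemma (in pair_sigma_finite) integral_tensor:
  fixes f :: "'a \<Rightarrow> complex" and g :: "'b \<Rightarrow> complex"
  assumes f: "integrable M1 f" and g: "integrable M2 g"
  shows "(LINT p|(M1 \<Otimes>\<^sub>M M2). f (fst p) * g (snd p)) = (LINT x|M1. f x) * (LINT y|M2. g y)"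
  using integral_fst'[OF integrable_tensor[OF f g]] by simp

text \<open>For a non-integrable f the integral has the default value 0, so the bound is
  unconditional.\<close>

lemma ennreal_norm_integral_le: "ennreal (norm (integral\<^sup>L M f)) \<le> (\<integral>\<^sup>+x. ennreal (norm (f x)) \<partial>M)"
  for f :: "'a \<Rightarrow> complex"
  by (cases "integrable M f") (simp_all add: integral_norm_bound_ennreal not_integrable_integral_eq)

text \<open>A summability factor for Fourier integrals. It tends to 1 as \<delta> tends to 0, and
  its own transform is 2 \<pi> times a normal density concentrating at 0.\<close>

definition gaussian :: "real \<Rightarrow> real \<Rightarrow> real" where
  "gaussian \<delta> \<tau> = exp (- (\<delta> * \<tau>)\<^sup>2 / 2)"

lemma gaussian_measurable [measurable]: "gaussian \<delta> \<in> borel_measurable borel"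
  unfolding gaussian_def by measurable

lemma gaussian_pos: "0 < gaussian \<delta> \<tau>"
  by (simp add: gaussian_def)

lemma gaussian_le_1: "gaussian \<delta> \<tau> \<le> 1"
  by (simp add: gaussian_def)

lemma std_normal_density_gaussian: "sqrt (2 * pi) * std_normal_density (\<delta> * \<tau>) = gaussian \<delta> \<tau>"
  by (simp add: std_normal_density_def gaussian_def)

lemma gaussian_integrable:
  assumes "\<delta> > 0"
  shows "integrable lborel (gaussian \<delta>)"
proof -
  have "integrable lborel (\<lambda>\<tau>. std_normal_density (0 + \<delta> * \<tau>))"
    by (rule lborel_integrable_real_affine) (use assms in auto)
  then have "integrable lborel (\<lambda>\<tau>. sqrt (2 * pi) * std_normal_density (\<delta> * \<tau>))"
    by simp
  then show ?thesis
    by (simp only: std_normal_density_gaussian)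
qed

text \<open>The characteristic function of the standard normal law, rescaled by t = r /
  \<delta>.\<close>

lemma fourier_gaussian:
  assumes "\<delta> > 0"
  shows "(LINT \<tau>|lborel. iexp (r * \<tau>) * of_real (gaussian \<delta> \<tau>)) = of_real (2 * pi * normal_density 0 \<delta> r)"
proof -
  define t where "t = r / \<delta>"
  have [simp]: "r = t * \<delta>"
    using assms by (simp add: t_def)
  have "(LINT x|std_normal_distribution. iexp (t * x)) = of_real (exp (- (t\<^sup>2) / 2))"
    using char_std_normal_distribution by (simp add: char_def fun_eq_iff)
  also have "(LINT x|std_normal_distribution. iexp (t * x)) = (LINT x|lborel. std_normal_density x *\<^sub>R iexp (t * x))"
    by (rule integral_density) auto
  also have "\<dots> = \<delta> *\<^sub>R (LINT \<tau>|lborel. std_normal_density (\<delta> * \<tau>) *\<^sub>R iexp (t * (\<delta> * \<tau>)))"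
    using lborel_integral_real_affine[of \<delta> "\<lambda>x. std_normal_density x *\<^sub>R iexp (t * x)" 0] assms by simp
  also have "(LINT \<tau>|lborel. std_normal_density (\<delta> * \<tau>) *\<^sub>R iexp (t * (\<delta> * \<tau>)))
      = (LINT \<tau>|lborel. of_real (1 / sqrt (2 * pi)) * (iexp (r * \<tau>) * of_real (gaussian \<delta> \<tau>)))"
    by (simp add: scaleR_conv_of_real mult_ac flip: std_normal_density_gaussian)
  also have "\<dots> = of_real (1 / sqrt (2 * pi)) * (LINT \<tau>|lborel. iexp (r * \<tau>) * of_real (gaussian \<delta> \<tau>))"
    by (rule integral_mult_right_zero)
  finally have "of_real (\<delta> / sqrt (2 * pi)) * (LINT \<tau>|lborel. iexp (r * \<tau>) * of_real (gaussian \<delta> \<tau>))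
      = of_real (exp (- (t\<^sup>2) / 2))"
    by (simp add: scaleR_conv_of_real)
  then have "(LINT \<tau>|lborel. iexp (r * \<tau>) * of_real (gaussian \<delta> \<tau>))
      = of_real (sqrt (2 * pi) / \<delta>) * of_real (exp (- (t\<^sup>2) / 2))"
    using assms by (simp add: field_simps)
  also have "\<dots> = of_real (2 * pi * normal_density 0 \<delta> r)"
  proof -
    have "sqrt (2 * pi) / \<delta> = 2 * pi * (1 / sqrt (2 * pi * \<delta>\<^sup>2))"
      using assms by (simp add: real_sqrt_mult field_simps)
    moreover have "- (t\<^sup>2) / 2 = - (r - 0)\<^sup>2 / (2 * \<delta>\<^sup>2)"
      using assms by (simp add: power_mult_distrib)
    ultimately show ?thesis
      by (simp only: normal_density_def of_real_mult[symmetric] mult.assoc)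
  qed
  finally show ?thesis .
qed

lemma iexp_add: "iexp (a + b) = iexp a * iexp b"
  by (simp add: exp_add distrib_left)

text \<open>The Gaussian makes the triple integral absolutely convergent, so the integration over
  \<tau> can be done first. The first transform runs over an abstract measure space with phase s:
  the line with its identity gives Plancherel, the quadrant with the level function the inversion
  formula.\<close>

lemma gaussian_parseval:
  fixes k :: "'a \<Rightarrow> complex" and \<omega> :: "real \<Rightarrow> complex"
  assumes N: "sigma_finite_measure N" and k: "integrable N k" and s[measurable]: "s \<in> borel_measurable N"
    and \<omega>: "integrable lborel \<omega>" and \<delta>: "\<delta> > 0"
  shows "(LINT \<tau>|lborel. (LINT n|N. k n * iexp (- (\<tau> * s n))) * (LINT t|lborel. \<omega> t * iexp (\<tau> * t)) * of_real (gaussian \<delta> \<tau>))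
    = of_real (2 * pi) * (LINT n|N. k n * (LINT t|lborel. \<omega> t * of_real (normal_density 0 \<delta> (t - s n))))"
proof -
  interpret N: sigma_finite_measure N by fact
  interpret NL: pair_sigma_finite N lborel ..
  interpret LQ: pair_sigma_finite lborel "N \<Otimes>\<^sub>M lborel" ..
  note [measurable] = borel_measurable_integrable[OF k] borel_measurable_integrable[OF \<omega>]
  have unimodular: "norm (iexp x) = 1" for x
    by simp
  define F where "F \<tau> q = k (fst q) * \<omega> (snd q) * (iexp ((snd q - s (fst q)) * \<tau>) * of_real (gaussian \<delta> \<tau>))" for \<tau> q
  have [measurable]: "(\<lambda>(\<tau>, q). F \<tau> q) \<in> borel_measurable (lborel \<Otimes>\<^sub>M (N \<Otimes>\<^sub>M lborel))"
    unfolding F_def by measurable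
  have gauss_int: "integrable lborel (\<lambda>\<tau>. complex_of_real (gaussian \<delta> \<tau>))"
    using gaussian_integrable[OF \<delta>] by (rule integrable_of_real)
  note kchi_int = NL.integrable_tensor[OF k \<omega>]
  have F_int: "integrable (lborel \<Otimes>\<^sub>M (N \<Otimes>\<^sub>M lborel)) (\<lambda>(\<tau>, q). F \<tau> q)"
  proof (rule Bochner_Integration.integrable_bound[OF LQ.integrable_tensor[OF gauss_int kchi_int]])
    show "AE p in lborel \<Otimes>\<^sub>M (N \<Otimes>\<^sub>M lborel). norm (case p of (\<tau>, q) \<Rightarrow> F \<tau> q)
        \<le> norm (complex_of_real (gaussian \<delta> (fst p)) * (k (fst (snd p)) * \<omega> (snd (snd p))))"
      by (intro AE_I2) (simp add: F_def norm_mult split_beta)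
  qed measurable
  have inner: "(LINT n|N. k n * iexp (- (\<tau> * s n))) * (LINT t|lborel. \<omega> t * iexp (\<tau> * t)) * of_real (gaussian \<delta> \<tau>)
      = (LINT q|(N \<Otimes>\<^sub>M lborel). F \<tau> q)" for \<tau>
  proof -
    have 1: "integrable N (\<lambda>n. k n * iexp (- (\<tau> * s n)))"
      by (rule Bochner_Integration.integrable_bound[OF k]) (auto simp: norm_mult)
    have 2: "integrable lborel (\<lambda>t. \<omega> t * iexp (\<tau> * t))"
      by (rule Bochner_Integration.integrable_bound[OF \<omega>]) (auto simp: norm_mult)
    have "F \<tau> q = k (fst q) * iexp (- (\<tau> * s (fst q))) * (\<omega> (snd q) * iexp (\<tau> * snd q)) * of_real (gaussian \<delta> \<tau>)" for q
      using iexp_add[of "- (\<tau> * s (fst q))" "\<tau> * snd q"]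
      by (simp add: F_def algebra_simps)
    then show ?thesis
      using NL.integral_tensor[OF 1 2] by simp
  qed
  have outer: "(LINT \<tau>|lborel. F \<tau> q) = of_real (2 * pi) * (k (fst q) * (\<omega> (snd q) * of_real (normal_density 0 \<delta> (snd q - s (fst q)))))" for q
    unfolding F_def integral_mult_right_zero fourier_gaussian[OF \<delta>] by (simp add: mult_ac)
  have "(LINT \<tau>|lborel. LINT q|(N \<Otimes>\<^sub>M lborel). F \<tau> q) = (LINT q|(N \<Otimes>\<^sub>M lborel). LINT \<tau>|lborel. F \<tau> q)"
    by (rule LQ.Fubini_integral[symmetric]) (use F_int in simp)
  also have "\<dots> = of_real (2 * pi) * (LINT q|(N \<Otimes>\<^sub>M lborel). k (fst q) * (\<omega> (snd q) * of_real (normal_density 0 \<delta> (snd q - s (fst q)))))"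
    unfolding outer by (rule integral_mult_right_zero)
  also have "(LINT q|(N \<Otimes>\<^sub>M lborel). k (fst q) * (\<omega> (snd q) * of_real (normal_density 0 \<delta> (snd q - s (fst q)))))
      = (LINT n|N. LINT t|lborel. k n * (\<omega> t * of_real (normal_density 0 \<delta> (t - s n))))"
  proof -
    have "integrable (N \<Otimes>\<^sub>M lborel) (\<lambda>q. k (fst q) * (\<omega> (snd q) * of_real (normal_density 0 \<delta> (snd q - s (fst q)))))"
    proof (rule Bochner_Integration.integrable_bound[OF integrable_mult_right[OF kchi_int, of "of_real (1 / sqrt (2 * pi * \<delta>\<^sup>2))"]])
      have "normal_density 0 \<delta> x \<le> 1 / sqrt (2 * pi * \<delta>\<^sup>2)" for x
        unfolding normal_density_def using \<delta> by (intro mult_left_le) auto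
      then have "norm (k (fst q) * (\<omega> (snd q) * of_real (normal_density 0 \<delta> (snd q - s (fst q)))))
          \<le> norm (k (fst q)) * (norm (\<omega> (snd q)) * (1 / sqrt (2 * pi * \<delta>\<^sup>2)))" for q
        unfolding norm_mult by (intro mult_left_mono) simp_all
      then show "AE q in N \<Otimes>\<^sub>M lborel. norm (k (fst q) * (\<omega> (snd q) * of_real (normal_density 0 \<delta> (snd q - s (fst q)))))
          \<le> norm (of_real (1 / sqrt (2 * pi * \<delta>\<^sup>2)) * (k (fst q) * \<omega> (snd q)))"
        by (intro AE_I2) (simp add: norm_mult norm_divide mult_ac)
    qed measurable
    from NL.integral_fst'[OF this] show ?thesis
      by simp
  qed
  finally show ?thesis
    unfolding inner by (simp only: integral_mult_right_zero)
qed

lemma gaussian_tendsto_1: "(\<lambda>j. gaussian (1 / real (Suc j)) \<tau>) \<longlonglongrightarrow> 1"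
proof -
  have "(\<lambda>j. exp (- (1 / real (Suc j) * \<tau>)\<^sup>2 / 2)) \<longlonglongrightarrow> exp (- (0 * \<tau>)\<^sup>2 / 2)"
    by (intro tendsto_intros lim_1_over_n[THEN LIMSEQ_Suc]) auto
  then show ?thesis
    by (simp add: gaussian_def)
qed

lemma nn_integral_normal_density_shift:
  assumes "\<delta> > 0"
  shows "(\<integral>\<^sup>+t. ennreal (normal_density 0 \<delta> (t - u)) \<partial>lborel) = 1"
    and "(\<integral>\<^sup>+t. ennreal (normal_density 0 \<delta> (u - t)) \<partial>lborel) = 1"
proof -
  have 1: "(\<integral>\<^sup>+t. ennreal (normal_density 0 \<delta> t) \<partial>lborel) = 1"
    using assms by (subst nn_integral_eq_integral) auto
  show "(\<integral>\<^sup>+t. ennreal (normal_density 0 \<delta> (t - u)) \<partial>lborel) = 1"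
    using nn_integral_real_affine[of "\<lambda>t. ennreal (normal_density 0 \<delta> t)" 1 "- u"] by (simp add: 1)
  show "(\<integral>\<^sup>+t. ennreal (normal_density 0 \<delta> (u - t)) \<partial>lborel) = 1"
    using nn_integral_real_affine[of "\<lambda>t. ennreal (normal_density 0 \<delta> t)" "-1" u] by (simp add: 1)
qed

text \<open>The Laplace bound asks only for this inequality. With the Gaussian inserted, |p(u) p(t)|
  is at most the mean of |p(u)|^2 and |p(t)|^2, and integrating out the other variable against a
  normal density of mass one gives the bound for every \<delta>. Fatou's lemma removes the
  Gaussian.\<close>

lemma plancherel_le:
  fixes p :: "real \<Rightarrow> complex"
  assumes p: "integrable lborel p"
  shows "(\<integral>\<^sup>+\<tau>. ennreal ((cmod (LINT u|lborel. p u * iexp (- (\<tau> * u))))\<^sup>2) \<partial>lborel)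
    \<le> ennreal (2 * pi) * (\<integral>\<^sup>+u. ennreal ((cmod (p u))\<^sup>2) \<partial>lborel)"
proof -
  note [measurable] = borel_measurable_integrable[OF p]
  define P where "P \<tau> = (LINT u|lborel. p u * iexp (- (\<tau> * u)))" for \<tau>
  have [measurable]: "P \<in> borel_measurable borel"
    unfolding P_def by measurable
  have P_le: "cmod (P \<tau>) \<le> (LINT u|lborel. cmod (p u))" for \<tau>
    unfolding P_def by (rule order_trans[OF integral_norm_bound]) (simp add: norm_mult)
  have cnj_P: "cnj (P \<tau>) = (LINT u|lborel. cnj (p u) * iexp (\<tau> * u))" for \<tau>
    unfolding P_def by (subst Bochner_Integration.integral_cnj[symmetric]) (simp add: exp_cnj)
  have approx: "(\<integral>\<^sup>+\<tau>. ennreal ((cmod (P \<tau>))\<^sup>2 * gaussian \<delta> \<tau>) \<partial>lborel)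
      \<le> ennreal (2 * pi) * (\<integral>\<^sup>+u. ennreal ((cmod (p u))\<^sup>2) \<partial>lborel)" if \<delta>: "\<delta> > 0" for \<delta>
  proof -
    have int: "integrable lborel (\<lambda>\<tau>. (cmod (P \<tau>))\<^sup>2 * gaussian \<delta> \<tau>)"
    proof (rule Bochner_Integration.integrable_bound[OF integrable_mult_right[OF gaussian_integrable[OF \<delta>], of "(LINT u|lborel. cmod (p u))\<^sup>2"]])
      show "AE \<tau> in lborel. norm ((cmod (P \<tau>))\<^sup>2 * gaussian \<delta> \<tau>) \<le> norm ((LINT u|lborel. cmod (p u))\<^sup>2 * gaussian \<delta> \<tau>)"
        using P_le by (intro AE_I2) (simp add: abs_mult mult_right_mono power_mono)
    qed measurable
    have "complex_of_real (LINT \<tau>|lborel. (cmod (P \<tau>))\<^sup>2 * gaussian \<delta> \<tau>)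
        = (LINT \<tau>|lborel. P \<tau> * cnj (P \<tau>) * of_real (gaussian \<delta> \<tau>))"
      unfolding complex_norm_square[symmetric] of_real_mult[symmetric] by (rule integral_complex_of_real[symmetric])
    also have "\<dots> = of_real (2 * pi) * (LINT u|lborel. p u * (LINT t|lborel. cnj (p t) * of_real (normal_density 0 \<delta> (t - u))))"
      unfolding cnj_P unfolding P_def
      by (rule gaussian_parseval[OF lborel.sigma_finite_measure_axioms p _ _ \<delta>, of "\<lambda>u. u"]) (use p in auto)
    finally have eq: "complex_of_real (LINT \<tau>|lborel. (cmod (P \<tau>))\<^sup>2 * gaussian \<delta> \<tau>)
        = (of_real (2 * pi) * (LINT u|lborel. p u * (LINT t|lborel. cnj (p t) * of_real (normal_density 0 \<delta> (t - u)))))" .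
    have "0 \<le> (LINT \<tau>|lborel. (cmod (P \<tau>))\<^sup>2 * gaussian \<delta> \<tau>)"
      by (rule integral_nonneg_AE) (simp add: less_imp_le[OF gaussian_pos])
    then have "ennreal (LINT \<tau>|lborel. (cmod (P \<tau>))\<^sup>2 * gaussian \<delta> \<tau>)
        = ennreal (cmod (of_real (2 * pi) * (LINT u|lborel. p u * (LINT t|lborel. cnj (p t) * of_real (normal_density 0 \<delta> (t - u))))))"
      unfolding eq[symmetric] by simp
    also have "\<dots> = ennreal (2 * pi) * ennreal (cmod (LINT u|lborel. p u * (LINT t|lborel. cnj (p t) * of_real (normal_density 0 \<delta> (t - u)))))"
      by (simp add: norm_mult ennreal_mult')
    also have "ennreal (cmod (LINT u|lborel. p u * (LINT t|lborel. cnj (p t) * of_real (normal_density 0 \<delta> (t - u)))))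
        \<le> (\<integral>\<^sup>+u. ennreal (cmod (p u * (LINT t|lborel. cnj (p t) * of_real (normal_density 0 \<delta> (t - u))))) \<partial>lborel)"
      by (rule ennreal_norm_integral_le)
    also have "\<dots> \<le> (\<integral>\<^sup>+u. \<integral>\<^sup>+t. ennreal (((cmod (p u))\<^sup>2 + (cmod (p t))\<^sup>2) / 2 * normal_density 0 \<delta> (t - u)) \<partial>lborel \<partial>lborel)"
    proof (rule nn_integral_mono)
      fix u
      have "ennreal (cmod (p u * (LINT t|lborel. cnj (p t) * of_real (normal_density 0 \<delta> (t - u)))))
          = ennreal (cmod (p u)) * ennreal (cmod (LINT t|lborel. cnj (p t) * of_real (normal_density 0 \<delta> (t - u))))"
        by (simp only: norm_mult ennreal_mult' norm_ge_zero)
      also have "\<dots> \<le> ennreal (cmod (p u)) * (\<integral>\<^sup>+t. ennreal (cmod (cnj (p t) * of_real (normal_density 0 \<delta> (t - u)))) \<partial>lborel)"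
        by (rule mult_left_mono[OF ennreal_norm_integral_le]) simp
      also have "\<dots> = (\<integral>\<^sup>+t. ennreal (cmod (p u) * cmod (p t) * normal_density 0 \<delta> (t - u)) \<partial>lborel)"
        by (subst nn_integral_cmult[symmetric]) (auto simp: norm_mult ennreal_mult' mult.assoc)
      also have "\<dots> \<le> (\<integral>\<^sup>+t. ennreal (((cmod (p u))\<^sup>2 + (cmod (p t))\<^sup>2) / 2 * normal_density 0 \<delta> (t - u)) \<partial>lborel)"
      proof (intro nn_integral_mono ennreal_leI mult_right_mono normal_density_nonneg)
        fix t
        show "cmod (p u) * cmod (p t) \<le> ((cmod (p u))\<^sup>2 + (cmod (p t))\<^sup>2) / 2"
          using sum_squares_bound[of "cmod (p u)" "cmod (p t)"] by simp
      qed
      finally show "ennreal (cmod (p u * (LINT t|lborel. cnj (p t) * of_real (normal_density 0 \<delta> (t - u)))))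
          \<le> (\<integral>\<^sup>+t. ennreal (((cmod (p u))\<^sup>2 + (cmod (p t))\<^sup>2) / 2 * normal_density 0 \<delta> (t - u)) \<partial>lborel)" .
    qed
    also have "\<dots> = (\<integral>\<^sup>+u. \<integral>\<^sup>+t. ennreal ((cmod (p u))\<^sup>2 / 2) * ennreal (normal_density 0 \<delta> (t - u))
          + ennreal ((cmod (p t))\<^sup>2 / 2) * ennreal (normal_density 0 \<delta> (t - u)) \<partial>lborel \<partial>lborel)"
      by (simp add: add_divide_distrib distrib_right flip: ennreal_mult' ennreal_plus)
    also have "\<dots> = (\<integral>\<^sup>+u. \<integral>\<^sup>+t. ennreal ((cmod (p u))\<^sup>2 / 2) * ennreal (normal_density 0 \<delta> (t - u)) \<partial>lborel \<partial>lborel)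
        + (\<integral>\<^sup>+u. \<integral>\<^sup>+t. ennreal ((cmod (p t))\<^sup>2 / 2) * ennreal (normal_density 0 \<delta> (t - u)) \<partial>lborel \<partial>lborel)"
      by (simp add: nn_integral_add)
    also have "(\<integral>\<^sup>+u. \<integral>\<^sup>+t. ennreal ((cmod (p t))\<^sup>2 / 2) * ennreal (normal_density 0 \<delta> (t - u)) \<partial>lborel \<partial>lborel)
        = (\<integral>\<^sup>+t. \<integral>\<^sup>+u. ennreal ((cmod (p t))\<^sup>2 / 2) * ennreal (normal_density 0 \<delta> (t - u)) \<partial>lborel \<partial>lborel)"
      by (rule lborel_pair.Fubini') measurable
    also have "(\<integral>\<^sup>+u. \<integral>\<^sup>+t. ennreal ((cmod (p u))\<^sup>2 / 2) * ennreal (normal_density 0 \<delta> (t - u)) \<partial>lborel \<partial>lborel)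
        + (\<integral>\<^sup>+t. \<integral>\<^sup>+u. ennreal ((cmod (p t))\<^sup>2 / 2) * ennreal (normal_density 0 \<delta> (t - u)) \<partial>lborel \<partial>lborel)
        = (\<integral>\<^sup>+u. ennreal ((cmod (p u))\<^sup>2 / 2) \<partial>lborel) + (\<integral>\<^sup>+u. ennreal ((cmod (p u))\<^sup>2 / 2) \<partial>lborel)"
      by (simp add: nn_integral_cmult nn_integral_normal_density_shift[OF \<delta>])
    also have "\<dots> = (\<integral>\<^sup>+u. ennreal ((cmod (p u))\<^sup>2 / 2) + ennreal ((cmod (p u))\<^sup>2 / 2) \<partial>lborel)"
      by (rule nn_integral_add[symmetric]) auto
    also have "\<dots> = (\<integral>\<^sup>+u. ennreal ((cmod (p u))\<^sup>2) \<partial>lborel)"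
      by (simp flip: ennreal_plus)
    finally have "ennreal (LINT \<tau>|lborel. (cmod (P \<tau>))\<^sup>2 * gaussian \<delta> \<tau>)
        \<le> ennreal (2 * pi) * (\<integral>\<^sup>+u. ennreal ((cmod (p u))\<^sup>2) \<partial>lborel)"
      by (simp add: mult_left_mono)
    then show ?thesis
      using int by (subst nn_integral_eq_integral) (auto simp: less_imp_le[OF gaussian_pos])
  qed
  have "(\<integral>\<^sup>+\<tau>. ennreal ((cmod (P \<tau>))\<^sup>2) \<partial>lborel)
      = (\<integral>\<^sup>+\<tau>. liminf (\<lambda>j. ennreal ((cmod (P \<tau>))\<^sup>2 * gaussian (1 / real (Suc j)) \<tau>)) \<partial>lborel)"
  proof (intro nn_integral_cong)
    fix \<tau>
    have "(\<lambda>j. ennreal ((cmod (P \<tau>))\<^sup>2 * gaussian (1 / real (Suc j)) \<tau>)) \<longlonglongrightarrow> ennreal ((cmod (P \<tau>))\<^sup>2 * 1)"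
      by (intro tendsto_ennrealI tendsto_mult tendsto_const gaussian_tendsto_1)
    then show "ennreal ((cmod (P \<tau>))\<^sup>2) = liminf (\<lambda>j. ennreal ((cmod (P \<tau>))\<^sup>2 * gaussian (1 / real (Suc j)) \<tau>))"
      by (simp add: lim_imp_Liminf)
  qed
  also have "\<dots> \<le> liminf (\<lambda>j. \<integral>\<^sup>+\<tau>. ennreal ((cmod (P \<tau>))\<^sup>2 * gaussian (1 / real (Suc j)) \<tau>) \<partial>lborel)"
    by (rule nn_integral_liminf) measurable
  also have "\<dots> \<le> ennreal (2 * pi) * (\<integral>\<^sup>+u. ennreal ((cmod (p u))\<^sup>2) \<partial>lborel)"
    by (intro Liminf_le always_eventually allI approx) auto
  finally show ?thesis
    by (simp add: P_def)
qed

text \<open>The Gaussian is removed by dominated convergence on both sides. On the left the assumed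
  integrability of the product dominates; on the right the smoothed \<omega> stays below B and
  converges at every point of continuity, which covers almost every value of s.\<close>

lemma parseval_polarized:
  fixes k :: "'a \<Rightarrow> complex" and \<omega> :: "real \<Rightarrow> complex"
  assumes N: "sigma_finite_measure N" and k: "integrable N k" and s[measurable]: "s \<in> borel_measurable N"
    and \<omega>: "integrable lborel \<omega>" and bounded: "\<And>t. cmod (\<omega> t) \<le> B"
    and cont: "AE n in N. isCont \<omega> (s n)"
    and int: "integrable lborel (\<lambda>\<tau>. (LINT n|N. k n * iexp (- (\<tau> * s n))) * (LINT t|lborel. \<omega> t * iexp (\<tau> * t)))"
  shows "(LINT \<tau>|lborel. (LINT n|N. k n * iexp (- (\<tau> * s n))) * (LINT t|lborel. \<omega> t * iexp (\<tau> * t)))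
    = of_real (2 * pi) * (LINT n|N. k n * \<omega> (s n))"
proof -
  note [measurable] = borel_measurable_integrable[OF k] borel_measurable_integrable[OF \<omega>]
  interpret N: sigma_finite_measure N by fact
  define F where "F \<tau> = (LINT n|N. k n * iexp (- (\<tau> * s n))) * (LINT t|lborel. \<omega> t * iexp (\<tau> * t))" for \<tau>
  have F_int: "integrable lborel F"
    using int by (simp add: F_def[abs_def])
  note [measurable] = borel_measurable_integrable[OF F_int]
  define \<delta> where "\<delta> j = 1 / real (Suc j)" for j
  have \<delta>: "\<delta> j > 0" for j
    by (simp add: \<delta>_def)
  define c where "c j n = (LINT t|lborel. \<omega> t * of_real (normal_density 0 (\<delta> j) (t - s n)))" for j n
  \<comment> \<open>The substitution t = s n + \<delta> r moves the dependence on j from the density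
    into the argument of \<omega>, where continuity can be used under a fixed normal law.\<close>
  have c_eq: "c j n = (LINT r|lborel. \<omega> (s n + \<delta> j * r) * of_real (std_normal_density r))" for j n
  proof -
    have "\<delta> j * normal_density 0 (\<delta> j) (\<delta> j * r) = std_normal_density r" for r
      using \<delta>[of j] by (simp add: normal_density_def real_sqrt_mult power_mult_distrib)
    then have *: "complex_of_real (\<delta> j) * of_real (normal_density 0 (\<delta> j) (\<delta> j * r)) = of_real (std_normal_density r)" for r
      by (simp flip: of_real_mult)
    have "c j n = \<delta> j *\<^sub>R (LINT r|lborel. \<omega> (s n + \<delta> j * r) * of_real (normal_density 0 (\<delta> j) (\<delta> j * r)))"
      unfolding c_def using \<delta>[of j]
      by (subst lborel_integral_real_affine[of "\<delta> j" _ "s n"]) auto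
    also have "\<dots> = (LINT r|lborel. of_real (\<delta> j) * (\<omega> (s n + \<delta> j * r) * of_real (normal_density 0 (\<delta> j) (\<delta> j * r))))"
      by (simp add: scaleR_conv_of_real)
    also have "\<dots> = (LINT r|lborel. \<omega> (s n + \<delta> j * r) * (of_real (\<delta> j) * of_real (normal_density 0 (\<delta> j) (\<delta> j * r))))"
      by (simp add: mult_ac)
    finally show ?thesis
      by (simp only: *)
  qed
  have normal_int: "integrable lborel (\<lambda>r. B * std_normal_density r)"
    by simp
  have c_le: "cmod (c j n) \<le> B" for j n
  proof -
    have "cmod (c j n) \<le> (LINT r|lborel. cmod (\<omega> (s n + \<delta> j * r) * of_real (std_normal_density r)))"
      unfolding c_eq by (rule integral_norm_bound)
    also have "\<dots> \<le> (LINT r|lborel. B * std_normal_density r)"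
    proof (rule Bochner_Integration.integral_mono[OF _ normal_int])
      show "integrable lborel (\<lambda>r. cmod (\<omega> (s n + \<delta> j * r) * of_real (std_normal_density r)))"
        by (rule Bochner_Integration.integrable_bound[OF normal_int])
           (use bounded in \<open>auto simp: norm_mult abs_mult intro!: mult_mono order_trans[OF bounded]\<close>)
    qed (use bounded in \<open>auto simp: norm_mult intro!: mult_right_mono\<close>)
    finally show ?thesis
      by simp
  qed
  have c_tendsto: "(\<lambda>j. c j n) \<longlonglongrightarrow> \<omega> (s n)" if "isCont \<omega> (s n)" for n
  proof -
    have "(\<lambda>j. LINT r|lborel. \<omega> (s n + \<delta> j * r) * of_real (std_normal_density r))
        \<longlonglongrightarrow> (LINT r|lborel. \<omega> (s n) * of_real (std_normal_density r))"
    proof (rule integral_dominated_convergence[OF _ _ normal_int])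
      show "AE r in lborel. (\<lambda>j. \<omega> (s n + \<delta> j * r) * of_real (std_normal_density r))
          \<longlonglongrightarrow> \<omega> (s n) * of_real (std_normal_density r)"
      proof (intro AE_I2 tendsto_mult tendsto_const)
        fix r
        have "(\<lambda>j. s n + \<delta> j * r) \<longlonglongrightarrow> s n + 0 * r"
          unfolding \<delta>_def by (intro tendsto_intros lim_1_over_n[THEN LIMSEQ_Suc])
        then show "(\<lambda>j. \<omega> (s n + \<delta> j * r)) \<longlonglongrightarrow> \<omega> (s n)"
          using that by (intro isCont_tendsto_compose[of "s n" \<omega>]) simp_all
      qed
    qed (use bounded in \<open>auto simp: norm_mult intro!: mult_right_mono\<close>)
    also have "(LINT r|lborel. \<omega> (s n) * of_real (std_normal_density r)) = \<omega> (s n)"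
      by simp
    finally show ?thesis
      by (simp add: c_eq)
  qed
  have lim_F: "(\<lambda>j. LINT \<tau>|lborel. F \<tau> * of_real (gaussian (\<delta> j) \<tau>)) \<longlonglongrightarrow> (LINT \<tau>|lborel. F \<tau>)"
  proof (rule integral_dominated_convergence[OF _ _ integrable_norm[OF F_int]])
    show "AE \<tau> in lborel. (\<lambda>j. F \<tau> * of_real (gaussian (\<delta> j) \<tau>)) \<longlonglongrightarrow> F \<tau>"
    proof (rule AE_I2)
      fix \<tau>
      have "(\<lambda>j. F \<tau> * of_real (gaussian (\<delta> j) \<tau>)) \<longlonglongrightarrow> F \<tau> * of_real 1"
        unfolding \<delta>_def by (intro tendsto_mult tendsto_const tendsto_of_real gaussian_tendsto_1)
      then show "(\<lambda>j. F \<tau> * of_real (gaussian (\<delta> j) \<tau>)) \<longlonglongrightarrow> F \<tau>"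
        by simp
    qed
    show "AE \<tau> in lborel. norm (F \<tau> * of_real (gaussian (\<delta> j) \<tau>)) \<le> norm (F \<tau>)" for j
      using gaussian_le_1[of "\<delta> j"] less_imp_le[OF gaussian_pos[of "\<delta> j"]]
      by (intro AE_I2) (simp add: norm_mult mult_left_le)
  qed measurable
  have eq: "(LINT \<tau>|lborel. F \<tau> * of_real (gaussian (\<delta> j) \<tau>)) = of_real (2 * pi) * (LINT n|N. k n * c j n)" for j
    unfolding F_def c_def by (rule gaussian_parseval[OF N k s \<omega> \<delta>])
  have "(\<lambda>j. of_real (2 * pi) * (LINT n|N. k n * c j n)) \<longlonglongrightarrow> of_real (2 * pi) * (LINT n|N. k n * \<omega> (s n))"
  proof (intro tendsto_mult tendsto_const integral_dominated_convergence[where w = "\<lambda>n. B * norm (k n)"])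
    show "AE n in N. (\<lambda>j. k n * c j n) \<longlonglongrightarrow> k n * \<omega> (s n)"
      using cont by eventually_elim (intro tendsto_mult tendsto_const c_tendsto)
    show "AE n in N. norm (k n * c j n) \<le> B * norm (k n)" for j
      using c_le by (intro AE_I2) (simp add: norm_mult mult.commute[of "cmod (k _)"] mult_right_mono)
    show "(\<lambda>n. k n * c j n) \<in> borel_measurable N" for j
      unfolding c_def by measurable
  qed (use k in auto)
  then have "(LINT \<tau>|lborel. F \<tau>) = of_real (2 * pi) * (LINT n|N. k n * \<omega> (s n))"
    by (rule LIMSEQ_unique[OF lim_F[unfolded eq]])
  then show ?thesis
    by (simp only: F_def)
qed

section \<open>Exponentials and level sets\<close>

text \<open>The Jacobian of x = u^(1/\<alpha>) on the half-line, extended by zero.\<close>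

definition pow_density :: "real \<Rightarrow> real \<Rightarrow> real" where
  "pow_density \<alpha> u = indicator {0<..} u * (u powr (1 / \<alpha> - 1) / \<alpha>)"

lemma pow_density_measurable [measurable]: "pow_density \<alpha> \<in> borel_measurable borel"
  unfolding pow_density_def by measurable

lemma pow_density_nonneg: "0 < \<alpha> \<Longrightarrow> 0 \<le> pow_density \<alpha> u"
  by (simp add: pow_density_def)

lemma powr_measurable_lborel_pos: "(\<lambda>x. x powr \<alpha>) \<in> borel_measurable lborel_pos"
  by (rule borel_measurable_lborel_pos) measurable

lemma distr_powr:
  assumes \<alpha>: "0 < \<alpha>"
  shows "distr lborel_pos borel (\<lambda>x. x powr \<alpha>) = density lborel (\<lambda>u. ennreal (pow_density \<alpha> u))"
proof -
  have left: "emeasure (distr lborel_pos borel (\<lambda>x. x powr \<alpha>)) {..c} = ennreal (if 0 < c then c powr (1 / \<alpha>) else 0)" for c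
  proof -
    have "emeasure (distr lborel_pos borel (\<lambda>x. x powr \<alpha>)) {..c}
        = emeasure lborel_pos ((\<lambda>x. x powr \<alpha>) -` {..c} \<inter> space lborel_pos)"
      by (rule emeasure_distr[OF powr_measurable_lborel_pos]) simp
    also have "(\<lambda>x. x powr \<alpha>) -` {..c} \<inter> space lborel_pos = (if 0 < c then {0<..c powr (1 / \<alpha>)} else {})"
    proof (cases "0 < c")
      case True
      have "x powr \<alpha> \<le> c \<longleftrightarrow> x \<le> c powr (1 / \<alpha>)" if "x > 0" for x
      proof
        assume "x powr \<alpha> \<le> c"
        then have "(x powr \<alpha>) powr (1 / \<alpha>) \<le> c powr (1 / \<alpha>)"
          using \<alpha> by (intro powr_mono2) auto
        then show "x \<le> c powr (1 / \<alpha>)"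
          using \<alpha> that by (simp add: powr_powr)
      next
        assume "x \<le> c powr (1 / \<alpha>)"
        then have "x powr \<alpha> \<le> (c powr (1 / \<alpha>)) powr \<alpha>"
          using \<alpha> that by (intro powr_mono2) auto
        then show "x powr \<alpha> \<le> c"
          using \<alpha> True by (simp add: powr_powr)
      qed
      then show ?thesis
        using True by auto
    next
      case False
      have "\<not> x powr \<alpha> \<le> c" if "x > 0" for x
      proof -
        have "0 < x powr \<alpha>"
          using that by simp
        with False show ?thesis
          by linarith
      qed
      then show ?thesis
        using False by auto
    qed
    also have "emeasure lborel_pos (if 0 < c then {0<..c powr (1 / \<alpha>)} else {}) = ennreal (if 0 < c then c powr (1 / \<alpha>) else 0)"
      unfolding lborel_pos_def by (subst emeasure_restrict_space) auto
    finally show ?thesis .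
  qed
  have right: "emeasure (density lborel (\<lambda>u. ennreal (pow_density \<alpha> u))) {..c} = ennreal (if 0 < c then c powr (1 / \<alpha>) else 0)" for c
  proof -
    have "emeasure (density lborel (\<lambda>u. ennreal (pow_density \<alpha> u))) {..c} = (\<integral>\<^sup>+u. ennreal (pow_density \<alpha> u) * indicator {..c} u \<partial>lborel)"
      by (rule emeasure_density) auto
    also have "\<dots> = ennreal (if 0 < c then c powr (1 / \<alpha>) else 0)"
    proof (cases "0 < c")
      case True
      have "((\<lambda>x. x powr (1 / \<alpha> - 1) / \<alpha>) has_integral (c powr (1 / \<alpha> - 1 + 1) / (1 / \<alpha> - 1 + 1) / \<alpha>)) {0..c}"
        using \<alpha> True by (intro has_integral_divide has_integral_powr_from_0) auto
      then have "(\<integral>\<^sup>+u. indicator {0..c} u * (u powr (1 / \<alpha> - 1) / \<alpha>) \<partial>lborel) = ennreal (c powr (1 / \<alpha>))"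
        using \<alpha> by (subst nn_integral_has_integral_lebesgue) auto
      moreover have "ennreal (pow_density \<alpha> u) * indicator {..c} u = ennreal (indicator {0..c} u * (u powr (1 / \<alpha> - 1) / \<alpha>))" for u
        using \<alpha> by (cases "u = 0") (auto simp: pow_density_def split: split_indicator)
      ultimately show ?thesis
        using True by simp
    next
      case False
      then have zero: "(\<lambda>u. ennreal (pow_density \<alpha> u) * indicator {..c} u) = (\<lambda>u. 0)"
        by (auto simp: pow_density_def fun_eq_iff split: split_indicator)
      show ?thesis
        using False unfolding zero by simp
    qed
    finally show ?thesis .
  qed
  show ?thesis
  proof (rule measure_eqI_generator_eq[where E = "range (\<lambda>c::real. {..c})" and \<Omega> = UNIV and A = "\<lambda>n. {..real n}"])
    show "Int_stable (range (\<lambda>c::real. {..c}))"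
      by (auto simp: Int_stable_def)
    show "(\<Union>i. {..real i}) = UNIV"
      using real_arch_simple by auto
    show "sets (distr lborel_pos borel (\<lambda>x. x powr \<alpha>)) = sigma_sets UNIV (range (\<lambda>c. {..c}))"
      by (simp add: borel_eq_atMost)
    show "sets (density lborel (\<lambda>u. ennreal (pow_density \<alpha> u))) = sigma_sets UNIV (range (\<lambda>c. {..c}))"
      by (simp add: borel_eq_atMost)
    show "emeasure (distr lborel_pos borel (\<lambda>x. x powr \<alpha>)) X = emeasure (density lborel (\<lambda>u. ennreal (pow_density \<alpha> u))) X"
      if "X \<in> range (\<lambda>c. {..c})" for X
      using that left right by auto
    show "emeasure (distr lborel_pos borel (\<lambda>x. x powr \<alpha>)) {..real i} \<noteq> \<infinity>" for i
      unfolding left by simp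
  qed auto
qed

lemma nn_integral_powr:
  assumes "0 < \<alpha>" and [measurable]: "F \<in> borel_measurable borel"
  shows "(\<integral>\<^sup>+x. F (x powr \<alpha>) \<partial>lborel_pos) = (\<integral>\<^sup>+u. ennreal (pow_density \<alpha> u) * F u \<partial>lborel)"
  using nn_integral_distr[OF powr_measurable_lborel_pos, of F \<alpha>] assms
  by (simp add: distr_powr nn_integral_density)

lemma integrable_powr:
  fixes G :: "real \<Rightarrow> complex"
  assumes \<alpha>: "0 < \<alpha>" and [measurable]: "G \<in> borel_measurable borel"
  shows "integrable lborel_pos (\<lambda>x. G (x powr \<alpha>)) \<longleftrightarrow> integrable lborel (\<lambda>u. pow_density \<alpha> u *\<^sub>R G u)"
  using integrable_distr_eq[OF powr_measurable_lborel_pos, of G \<alpha>]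
  by (simp add: distr_powr[OF \<alpha>] integrable_density pow_density_nonneg[OF \<alpha>])

lemma integral_powr:
  fixes G :: "real \<Rightarrow> complex"
  assumes \<alpha>: "0 < \<alpha>" and [measurable]: "G \<in> borel_measurable borel"
  shows "(LINT x|lborel_pos. G (x powr \<alpha>)) = (LINT u|lborel. pow_density \<alpha> u *\<^sub>R G u)"
  using integral_distr[OF powr_measurable_lborel_pos, of G \<alpha>]
  by (simp add: distr_powr[OF \<alpha>] integral_density pow_density_nonneg[OF \<alpha>])

lemma nn_integral_Gamma:
  assumes s: "0 < s" and c: "0 < (c :: real)"
  shows "(\<integral>\<^sup>+x. ennreal (x powr (s - 1) * exp (- c * x)) \<partial>lborel_pos) = ennreal (Gamma s * c powr - s)"
proof -
  have "ennreal (Gamma s) = (\<integral>\<^sup>+t. ennreal (indicator {0..} t * t powr (s - 1) / exp t) \<partial>lborel)"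
    using s by (rule Gamma_conv_nn_integral_real)
  also have "\<dots> = ennreal c * (\<integral>\<^sup>+x. ennreal (indicator {0..} (c * x) * (c * x) powr (s - 1) / exp (c * x)) \<partial>lborel)"
    using c by (subst nn_integral_real_affine[where c = c and t = 0]) auto
  also have "(\<integral>\<^sup>+x. ennreal (indicator {0..} (c * x) * (c * x) powr (s - 1) / exp (c * x)) \<partial>lborel)
      = (\<integral>\<^sup>+x. ennreal (c powr (s - 1)) * (ennreal (x powr (s - 1) * exp (- c * x)) * indicator {0<..} x) \<partial>lborel)"
  proof (intro nn_integral_cong)
    fix x :: real
    have "0 < x \<or> x = 0 \<or> x < 0"
      by linarith
    then show "ennreal (indicator {0..} (c * x) * (c * x) powr (s - 1) / exp (c * x))
        = ennreal (c powr (s - 1)) * (ennreal (x powr (s - 1) * exp (- c * x)) * indicator {0<..} x)"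
      using c by (auto simp: powr_mult exp_minus field_simps zero_le_mult_iff simp flip: ennreal_mult')
  qed
  also have "\<dots> = ennreal (c powr (s - 1)) * (\<integral>\<^sup>+x. ennreal (x powr (s - 1) * exp (- c * x)) \<partial>lborel_pos)"
    unfolding nn_integral_lborel_pos by (rule nn_integral_cmult) measurable
  also have "ennreal c * \<dots> = ennreal (c * c powr (s - 1)) * (\<integral>\<^sup>+x. ennreal (x powr (s - 1) * exp (- c * x)) \<partial>lborel_pos)"
    using c by (simp only: ennreal_mult' mult.assoc less_imp_le)
  also have "c * c powr (s - 1) = c powr s"
    using c powr_add[of c 1 "s - 1"] by simp
  finally have Gamma_eq: "ennreal (Gamma s)
      = ennreal (c powr s) * (\<integral>\<^sup>+x. ennreal (x powr (s - 1) * exp (- c * x)) \<partial>lborel_pos)" .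
  have "ennreal (Gamma s * c powr - s) = ennreal (c powr - s) * ennreal (Gamma s)"
    by (subst mult.commute, rule ennreal_mult') simp
  also have "\<dots> = ennreal (c powr - s) * (ennreal (c powr s) * (\<integral>\<^sup>+x. ennreal (x powr (s - 1) * exp (- c * x)) \<partial>lborel_pos))"
    by (simp only: Gamma_eq)
  also have "\<dots> = (\<integral>\<^sup>+x. ennreal (x powr (s - 1) * exp (- c * x)) \<partial>lborel_pos)"
    using c by (simp add: powr_minus flip: mult.assoc ennreal_mult')
  finally show ?thesis ..
qed

section \<open>Exponentials in x^\<alpha> and the weighted Laplace bound\<close>

definition ev_fun :: "real \<Rightarrow> complex \<Rightarrow> real \<Rightarrow> complex" where
  "ev_fun \<alpha> z x = exp (- z * of_real (x powr \<alpha>))"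

definition ev :: "real \<Rightarrow> complex \<Rightarrow> l2" where
  "ev \<alpha> z = abs_l2 (ev_fun \<alpha> z)"

definition ev_norm :: "real \<Rightarrow> real \<Rightarrow> real" where
  "ev_norm \<alpha> \<sigma> = sqrt (Gamma (1 / \<alpha>) / \<alpha> * (2 * \<sigma>) powr - (1 / \<alpha>))"

lemma cmod_ev_fun: "cmod (ev_fun \<alpha> z x) = exp (- Re z * x powr \<alpha>)"
  by (simp add: ev_fun_def)

lemma cnj_ev_fun: "cnj (ev_fun \<alpha> z x) = ev_fun \<alpha> (cnj z) x"
  by (simp add: ev_fun_def exp_cnj)

lemma ev_fun_measurable: "ev_fun \<alpha> z \<in> borel_measurable lborel_pos"
  unfolding ev_fun_def[abs_def] by (rule borel_measurable_lborel_pos) measurable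

lemma nn_integral_exp_powr:
  assumes \<alpha>: "0 < \<alpha>" and c: "0 < c"
  shows "(\<integral>\<^sup>+x. ennreal (exp (- c * x powr \<alpha>)) \<partial>lborel_pos) = ennreal (Gamma (1 / \<alpha>) / \<alpha> * c powr - (1 / \<alpha>))"
proof -
  have "(\<integral>\<^sup>+x. ennreal (exp (- c * x powr \<alpha>)) \<partial>lborel_pos) = (\<integral>\<^sup>+u. ennreal (pow_density \<alpha> u) * ennreal (exp (- c * u)) \<partial>lborel)"
    by (rule nn_integral_powr[OF \<alpha>]) measurable
  also have "\<dots> = (\<integral>\<^sup>+u. ennreal (1 / \<alpha>) * ennreal (u powr (1 / \<alpha> - 1) * exp (- c * u)) \<partial>lborel_pos)"
    unfolding nn_integral_lborel_pos using \<alpha>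
    by (intro nn_integral_cong) (auto simp: pow_density_def simp flip: ennreal_mult' split: split_indicator)
  also have "\<dots> = ennreal (1 / \<alpha>) * ennreal (Gamma (1 / \<alpha>) * c powr - (1 / \<alpha>))"
    using nn_integral_Gamma[of "1 / \<alpha>" c] \<alpha> c
    by (subst nn_integral_cmult) (auto intro!: borel_measurable_lborel_pos)
  finally show ?thesis
    using \<alpha> by (simp flip: ennreal_mult')
qed

lemma square_integrable_ev_fun:
  assumes "0 < \<alpha>" "0 < Re z"
  shows "square_integrable lborel_pos (ev_fun \<alpha> z)"
    and "(\<integral>\<^sup>+x. ennreal ((cmod (ev_fun \<alpha> z x))\<^sup>2) \<partial>lborel_pos) = ennreal ((ev_norm \<alpha> (Re z))\<^sup>2)"
proof -
  have "(cmod (ev_fun \<alpha> z x))\<^sup>2 = exp (- (2 * Re z) * x powr \<alpha>)" for x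
    by (simp add: cmod_ev_fun power2_eq_square flip: exp_add)
  moreover have "0 \<le> Gamma (1 / \<alpha>) / \<alpha> * (2 * Re z) powr - (1 / \<alpha>)"
    using assms by (intro mult_nonneg_nonneg divide_nonneg_nonneg) (auto simp: less_imp_le[OF Gamma_real_pos])
  ultimately show nn: "(\<integral>\<^sup>+x. ennreal ((cmod (ev_fun \<alpha> z x))\<^sup>2) \<partial>lborel_pos) = ennreal ((ev_norm \<alpha> (Re z))\<^sup>2)"
    using nn_integral_exp_powr[of \<alpha> "2 * Re z"] assms by (simp add: ev_norm_def)
  show "square_integrable lborel_pos (ev_fun \<alpha> z)"
    using nn by (subst square_integrable_iff_nn[OF ev_fun_measurable]) simp
qed

lemma ev_norm_pos: "0 < \<alpha> \<Longrightarrow> 0 < \<sigma> \<Longrightarrow> 0 < ev_norm \<alpha> \<sigma>"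
  by (simp add: ev_norm_def Gamma_real_pos)

lemma norm_ev:
  assumes "0 < \<alpha>" "0 < Re z"
  shows "norm (ev \<alpha> z) = ev_norm \<alpha> (Re z)"
proof -
  have "ennreal ((norm (ev \<alpha> z))\<^sup>2) = ennreal ((ev_norm \<alpha> (Re z))\<^sup>2)"
    using square_integrable_ev_fun[OF assms]
    by (simp add: ev_def norm_abs_l2 nn_integral_square_integrable)
  then show ?thesis
    using ev_norm_pos[OF assms] by (simp add: power2_eq_iff_nonneg)
qed

lemma cinner_ev:
  assumes "0 < \<alpha>" "0 < Re z"
  shows "cinner f (ev \<alpha> z) = (LINT x|lborel_pos. rep_l2 f x * ev_fun \<alpha> (cnj z) x)"
  using cinner_abs_l2[OF square_integrable_rep square_integrable_ev_fun(1)[OF assms], of f]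
  by (simp add: ev_def cnj_ev_fun)

lemma laplace_bound:
  fixes f :: "real \<Rightarrow> complex"
  assumes \<alpha>: "0 < \<alpha>" "\<alpha> < 1" and f: "square_integrable lborel_pos f"
  shows "(\<integral>\<^sup>+\<sigma>. \<integral>\<^sup>+\<tau>. ennreal (\<sigma> powr (1 / \<alpha> - 2) * (cmod (LINT x|lborel_pos. f x * ev_fun \<alpha> (Complex \<sigma> \<tau>) x))\<^sup>2) \<partial>lborel \<partial>lborel_pos)
    \<le> ennreal (2 * pi * Gamma (1 / \<alpha> - 1) * 2 powr - (1 / \<alpha> - 1) / \<alpha>) * (\<integral>\<^sup>+x. ennreal ((cmod (f x))\<^sup>2) \<partial>lborel_pos)"
proof -
  define a where "a = 1 / \<alpha> - 1"
  have a: "a > 0"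
    using \<alpha> by (simp add: a_def)
  \<comment> \<open>The function f in the variable u = x^\<alpha>, extended by zero to a Borel
    function on the line as the change of variables requires.\<close>
  define F where "F u = indicator {0<..} (u powr (1 / \<alpha>)) *\<^sub>R f (u powr (1 / \<alpha>))" for u
  have f_meas: "f \<in> borel_measurable lborel_pos"
    using f by (simp add: square_integrable_def)
  have F_meas[measurable]: "F \<in> borel_measurable borel"
    unfolding F_def by (rule measurable_compose[OF _ borel_measurable_extend_lborel_pos[OF f_meas]]) measurable
  have F_powr: "F (x powr \<alpha>) = f x" if "x > 0" for x
    using that \<alpha> by (simp add: F_def powr_powr)
  have slice: "(\<integral>\<^sup>+\<tau>. ennreal ((cmod (LINT x|lborel_pos. f x * ev_fun \<alpha> (Complex \<sigma> \<tau>) x))\<^sup>2) \<partial>lborel)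
      \<le> ennreal (2 * pi) * (\<integral>\<^sup>+u. ennreal ((pow_density \<alpha> u * cmod (F u) * exp (- \<sigma> * u))\<^sup>2) \<partial>lborel)"
    if \<sigma>: "\<sigma> > 0" for \<sigma>
  proof -
    define p where "p u = pow_density \<alpha> u *\<^sub>R (F u * of_real (exp (- \<sigma> * u)))" for u
    have "integrable lborel_pos (\<lambda>x. f x * cnj (ev_fun \<alpha> (of_real \<sigma>) x))"
      using \<alpha> \<sigma> by (intro square_integrable_mult_cnj f square_integrable_ev_fun) auto
    also have "integrable lborel_pos (\<lambda>x. f x * cnj (ev_fun \<alpha> (of_real \<sigma>) x))
        \<longleftrightarrow> integrable lborel_pos (\<lambda>x. F (x powr \<alpha>) * of_real (exp (- \<sigma> * x powr \<alpha>)))"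
    proof (intro Bochner_Integration.integrable_cong refl)
      fix x
      assume "x \<in> space lborel_pos"
      moreover have "cnj (ev_fun \<alpha> (of_real \<sigma>) x) = exp (of_real (- \<sigma> * x powr \<alpha>))"
        by (simp add: cnj_ev_fun) (simp add: ev_fun_def)
      ultimately show "f x * cnj (ev_fun \<alpha> (of_real \<sigma>) x) = F (x powr \<alpha>) * of_real (exp (- \<sigma> * x powr \<alpha>))"
        by (simp only: F_powr exp_of_real space_lborel_pos greaterThan_iff)
    qed
    finally have p: "integrable lborel p"
      using \<alpha> unfolding p_def by (subst (asm) integrable_powr) auto
    have "(LINT x|lborel_pos. f x * ev_fun \<alpha> (Complex \<sigma> \<tau>) x) = (LINT u|lborel. p u * iexp (- (\<tau> * u)))" for \<tau>
    proof -
      have ev: "ev_fun \<alpha> (Complex \<sigma> \<tau>) x = of_real (exp (- \<sigma> * x powr \<alpha>)) * iexp (- (\<tau> * x powr \<alpha>))" for x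
      proof -
        have "- Complex \<sigma> \<tau> * of_real (x powr \<alpha>) = of_real (- \<sigma> * x powr \<alpha>) + \<i> * of_real (- (\<tau> * x powr \<alpha>))"
          by (simp add: complex_eq_iff)
        then show ?thesis
          by (simp only: ev_fun_def exp_add exp_of_real)
      qed
      have "(LINT x|lborel_pos. f x * ev_fun \<alpha> (Complex \<sigma> \<tau>) x)
          = (LINT x|lborel_pos. F (x powr \<alpha>) * of_real (exp (- \<sigma> * x powr \<alpha>)) * iexp (- (\<tau> * x powr \<alpha>)))"
        by (intro Bochner_Integration.integral_cong) (auto simp: F_powr ev mult.assoc)
      also have "\<dots> = (LINT u|lborel. pow_density \<alpha> u *\<^sub>R (F u * of_real (exp (- \<sigma> * u)) * iexp (- (\<tau> * u))))"
        using \<alpha> by (intro integral_powr) auto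
      finally show ?thesis
        by (simp add: p_def)
    qed
    then show ?thesis
      using plancherel_le[OF p] pow_density_nonneg[OF \<alpha>(1)] by (simp add: p_def norm_mult mult.assoc)
  qed
  have meas2: "(\<lambda>(\<sigma>, u). ennreal (\<sigma> powr (a - 1)) * ennreal ((pow_density \<alpha> u * cmod (F u) * exp (- \<sigma> * u))\<^sup>2))
      \<in> borel_measurable (lborel_pos \<Otimes>\<^sub>M lborel)"
  proof -
    have [measurable]: "(\<lambda>p. fst p) \<in> borel_measurable (lborel_pos \<Otimes>\<^sub>M lborel)"
      by (rule measurable_compose[OF measurable_fst borel_measurable_lborel_pos]) simp
    show ?thesis
      unfolding split_beta by measurable
  qed
  interpret PL: pair_sigma_finite lborel_pos lborel ..
  have "(\<integral>\<^sup>+\<sigma>. \<integral>\<^sup>+\<tau>. ennreal (\<sigma> powr (1 / \<alpha> - 2) * (cmod (LINT x|lborel_pos. f x * ev_fun \<alpha> (Complex \<sigma> \<tau>) x))\<^sup>2) \<partial>lborel \<partial>lborel_pos)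
      = (\<integral>\<^sup>+\<sigma>. ennreal (\<sigma> powr (a - 1)) * (\<integral>\<^sup>+\<tau>. ennreal ((cmod (LINT x|lborel_pos. f x * ev_fun \<alpha> (Complex \<sigma> \<tau>) x))\<^sup>2) \<partial>lborel) \<partial>lborel_pos)"
  proof (intro nn_integral_cong)
    fix \<sigma>
    have [measurable]: "(\<lambda>\<tau>. LINT x|lborel_pos. f x * ev_fun \<alpha> (Complex \<sigma> \<tau>) x) \<in> borel_measurable lborel"
    proof (rule lborel_pos.borel_measurable_lebesgue_integral)
      have [measurable]: "(\<lambda>p. snd p) \<in> borel_measurable (lborel \<Otimes>\<^sub>M lborel_pos)"
        by (rule measurable_compose[OF measurable_snd borel_measurable_lborel_pos]) simp
      have [measurable]: "(\<lambda>p. f (snd p)) \<in> borel_measurable (lborel \<Otimes>\<^sub>M lborel_pos)"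
        by (rule measurable_compose[OF measurable_snd f_meas])
      have "(\<lambda>p. f (snd p) * exp (- (of_real \<sigma> + \<i> * of_real (fst p)) * of_real (snd p powr \<alpha>))) \<in> borel_measurable (lborel \<Otimes>\<^sub>M lborel_pos)"
        by measurable
      then show "(\<lambda>(\<tau>, x). f x * ev_fun \<alpha> (Complex \<sigma> \<tau>) x) \<in> borel_measurable (lborel \<Otimes>\<^sub>M lborel_pos)"
        by (simp add: split_beta ev_fun_def Complex_eq)
    qed
    show "(\<integral>\<^sup>+\<tau>. ennreal (\<sigma> powr (1 / \<alpha> - 2) * (cmod (LINT x|lborel_pos. f x * ev_fun \<alpha> (Complex \<sigma> \<tau>) x))\<^sup>2) \<partial>lborel)
        = ennreal (\<sigma> powr (a - 1)) * (\<integral>\<^sup>+\<tau>. ennreal ((cmod (LINT x|lborel_pos. f x * ev_fun \<alpha> (Complex \<sigma> \<tau>) x))\<^sup>2) \<partial>lborel)"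
      by (subst nn_integral_cmult[symmetric]) (auto simp: a_def ennreal_mult')
  qed
  also have "\<dots> \<le> (\<integral>\<^sup>+\<sigma>. ennreal (\<sigma> powr (a - 1)) * (ennreal (2 * pi) * (\<integral>\<^sup>+u. ennreal ((pow_density \<alpha> u * cmod (F u) * exp (- \<sigma> * u))\<^sup>2) \<partial>lborel)) \<partial>lborel_pos)"
    by (intro nn_integral_mono mult_left_mono slice) auto
  also have "\<dots> = (\<integral>\<^sup>+\<sigma>. ennreal (2 * pi) * (\<integral>\<^sup>+u. ennreal (\<sigma> powr (a - 1)) * ennreal ((pow_density \<alpha> u * cmod (F u) * exp (- \<sigma> * u))\<^sup>2) \<partial>lborel) \<partial>lborel_pos)"
    by (subst nn_integral_cmult) (auto simp: mult.left_commute)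
  also have "\<dots> = ennreal (2 * pi) * (\<integral>\<^sup>+\<sigma>. \<integral>\<^sup>+u. ennreal (\<sigma> powr (a - 1)) * ennreal ((pow_density \<alpha> u * cmod (F u) * exp (- \<sigma> * u))\<^sup>2) \<partial>lborel \<partial>lborel_pos)"
    using lborel.borel_measurable_nn_integral[OF meas2] by (intro nn_integral_cmult) simp
  also have "(\<integral>\<^sup>+\<sigma>. \<integral>\<^sup>+u. ennreal (\<sigma> powr (a - 1)) * ennreal ((pow_density \<alpha> u * cmod (F u) * exp (- \<sigma> * u))\<^sup>2) \<partial>lborel \<partial>lborel_pos)
      = (\<integral>\<^sup>+u. \<integral>\<^sup>+\<sigma>. ennreal (\<sigma> powr (a - 1)) * ennreal ((pow_density \<alpha> u * cmod (F u) * exp (- \<sigma> * u))\<^sup>2) \<partial>lborel_pos \<partial>lborel)"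
    using PL.Fubini'[OF meas2] by simp
  also have "\<dots> = (\<integral>\<^sup>+u. ennreal (Gamma a * 2 powr - a / \<alpha>) * (ennreal (pow_density \<alpha> u) * ennreal ((cmod (F u))\<^sup>2)) \<partial>lborel)"
  proof (intro nn_integral_cong)
    fix u :: real
    show "(\<integral>\<^sup>+\<sigma>. ennreal (\<sigma> powr (a - 1)) * ennreal ((pow_density \<alpha> u * cmod (F u) * exp (- \<sigma> * u))\<^sup>2) \<partial>lborel_pos)
        = ennreal (Gamma a * 2 powr - a / \<alpha>) * (ennreal (pow_density \<alpha> u) * ennreal ((cmod (F u))\<^sup>2))"
    proof (cases "u > 0")
      case False
      then show ?thesis
        by (simp add: pow_density_def)
    next
      case True
      have "(pow_density \<alpha> u * cmod (F u) * exp (- \<sigma> * u))\<^sup>2 = (pow_density \<alpha> u * cmod (F u))\<^sup>2 * exp (- (2 * u) * \<sigma>)" for \<sigma>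
        by (simp add: power_mult_distrib power2_eq_square[of "exp _"] flip: exp_add)
      then have "(\<integral>\<^sup>+\<sigma>. ennreal (\<sigma> powr (a - 1)) * ennreal ((pow_density \<alpha> u * cmod (F u) * exp (- \<sigma> * u))\<^sup>2) \<partial>lborel_pos)
          = (\<integral>\<^sup>+\<sigma>. ennreal ((pow_density \<alpha> u * cmod (F u))\<^sup>2) * ennreal (\<sigma> powr (a - 1) * exp (- (2 * u) * \<sigma>)) \<partial>lborel_pos)"
        by (intro nn_integral_cong) (simp add: mult_ac flip: ennreal_mult')
      also have "\<dots> = ennreal ((pow_density \<alpha> u * cmod (F u))\<^sup>2) * ennreal (Gamma a * (2 * u) powr - a)"
        using nn_integral_Gamma[OF a, of "2 * u"] True
        by (subst nn_integral_cmult) (auto intro!: borel_measurable_lborel_pos)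
      also have "\<dots> = ennreal ((pow_density \<alpha> u * (2 * u) powr - a) * Gamma a * (pow_density \<alpha> u * (cmod (F u))\<^sup>2))"
        using less_imp_le[OF Gamma_real_pos[OF a]] pow_density_nonneg[OF \<alpha>(1), of u]
        by (simp add: power_mult_distrib power2_eq_square mult_ac flip: ennreal_mult')
      \<comment> \<open>Plancherel leaves the Jacobian squared. The Gamma integral cancels exactly
        one copy, which dictates the exponent 1/\<alpha> - 2 of \<sigma>; the other copy turns du
        back into dx.\<close>
      also have "pow_density \<alpha> u * (2 * u) powr - a = 2 powr - a / \<alpha>"
        using True by (simp add: pow_density_def powr_mult powr_minus field_simps flip: a_def)
      finally show ?thesis
        using \<alpha> a pow_density_nonneg[OF \<alpha>(1), of u] by (simp add: Gamma_real_pos less_imp_le mult_ac flip: ennreal_mult')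
    qed
  qed
  also have "\<dots> = ennreal (Gamma a * 2 powr - a / \<alpha>) * (\<integral>\<^sup>+u. ennreal (pow_density \<alpha> u) * ennreal ((cmod (F u))\<^sup>2) \<partial>lborel)"
    by (rule nn_integral_cmult) measurable
  also have "(\<integral>\<^sup>+u. ennreal (pow_density \<alpha> u) * ennreal ((cmod (F u))\<^sup>2) \<partial>lborel) = (\<integral>\<^sup>+x. ennreal ((cmod (F (x powr \<alpha>)))\<^sup>2) \<partial>lborel_pos)"
    using \<alpha> by (intro nn_integral_powr[symmetric]) auto
  also have "\<dots> = (\<integral>\<^sup>+x. ennreal ((cmod (f x))\<^sup>2) \<partial>lborel_pos)"
    by (intro nn_integral_cong) (simp add: F_powr)
  also have "ennreal (2 * pi) * (ennreal (Gamma a * 2 powr - a / \<alpha>) * \<dots>)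
      = ennreal (2 * pi * Gamma a * 2 powr - a / \<alpha>) * \<dots>"
    using \<alpha> a by (simp add: Gamma_real_pos less_imp_le flip: mult.assoc ennreal_mult')
  finally show ?thesis
    by (simp only: a_def)
qed

section \<open>Distribution of the level function\<close>

definition level_fun :: "real \<Rightarrow> real \<Rightarrow> real \<times> real \<Rightarrow> real" where
  "level_fun \<alpha> \<beta> p = fst p powr \<alpha> + snd p powr \<beta>"

text \<open>Euler's Beta(1/\<alpha>, 1/\<beta>) divided by \<alpha>\<beta>, the convolution of the
  two power densities at level 1. It is kept as an integral because only its positivity and
  finiteness enter.\<close>

definition level_const :: "real \<Rightarrow> real \<Rightarrow> real" where
  "level_const \<alpha> \<beta> = enn2real (\<integral>\<^sup>+r. ennreal (pow_density \<alpha> r * pow_density \<beta> (1 - r)) \<partial>lborel)"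

lemma level_const:
  assumes "0 < \<alpha>" "\<alpha> < 1" "0 < \<beta>" "\<beta> < 1"
  shows "0 < level_const \<alpha> \<beta>"
    and "(\<integral>\<^sup>+r. ennreal (pow_density \<alpha> r * pow_density \<beta> (1 - r)) \<partial>lborel) = ennreal (level_const \<alpha> \<beta>)"
proof -
  let ?I = "\<integral>\<^sup>+r. ennreal (pow_density \<alpha> r * pow_density \<beta> (1 - r)) \<partial>lborel"
  \<comment> \<open>For \<gamma> < 1 the exponent 1/\<gamma> - 1 is positive, so the density is
    bounded near 0 and increases up to its value at 1.\<close>
  have le: "pow_density \<gamma> r \<le> 1 / \<gamma>" if "r \<le> 1" "0 < \<gamma>" "\<gamma> < 1" for \<gamma> r
    using that powr_mono2[of "1 / \<gamma> - 1" r 1] by (auto simp: pow_density_def divide_right_mono split: split_indicator)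
  have "?I \<le> (\<integral>\<^sup>+r. ennreal (1 / \<alpha> * (1 / \<beta>)) * indicator {0..1::real} r \<partial>lborel)"
  proof (intro nn_integral_mono)
    fix r :: real
    show "ennreal (pow_density \<alpha> r * pow_density \<beta> (1 - r)) \<le> ennreal (1 / \<alpha> * (1 / \<beta>)) * indicator {0..1} r"
    proof (cases "0 \<le> r \<and> r \<le> 1")
      case True
      then have "pow_density \<alpha> r * pow_density \<beta> (1 - r) \<le> 1 / \<alpha> * (1 / \<beta>)"
        using assms by (intro mult_mono le pow_density_nonneg) auto
      then show ?thesis
        using True by (simp add: ennreal_leI del: times_divide_eq_left times_divide_eq_right)
    next
      case False
      then have zero: "pow_density \<alpha> r * pow_density \<beta> (1 - r) = 0"
        by (auto simp: pow_density_def)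
      show ?thesis
        unfolding zero by simp
    qed
  qed
  also have "\<dots> < \<infinity>"
    by (simp add: nn_integral_cmult_indicator)
  finally have fin: "?I < \<infinity>" .
  then show eq: "?I = ennreal (level_const \<alpha> \<beta>)"
    by (simp add: level_const_def ennreal_enn2real less_top)
  have "?I \<noteq> 0"
  proof
    assume "?I = 0"
    then have "AE r in lborel. ennreal (pow_density \<alpha> r * pow_density \<beta> (1 - r)) = 0"
      by (subst (asm) nn_integral_0_iff_AE) auto
    moreover have "\<not> ennreal (pow_density \<alpha> r * pow_density \<beta> (1 - r)) = 0" if "0 < r" "r < 1" for r
      using that assms by (simp add: pow_density_def ennreal_eq_0_iff not_le)
    ultimately have "AE r in lborel. r \<notin> {0<..<1::real}"
      by (auto elim!: eventually_mono)
    then have "emeasure lborel {0<..<1::real} = 0"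
      by (subst AE_iff_measurable[symmetric, where P = "\<lambda>r. r \<notin> {0<..<1::real}"]) auto
    then show False
      by simp
  qed
  then show "0 < level_const \<alpha> \<beta>"
    using eq by (metis ennreal_eq_0_iff not_le)
qed

lemma level_fun_measurable: "level_fun \<alpha> \<beta> \<in> borel_measurable quadrant"
proof -
  have [measurable]: "(\<lambda>p. fst p) \<in> borel_measurable quadrant" "(\<lambda>p. snd p) \<in> borel_measurable quadrant"
    by (rule measurable_compose[OF measurable_fst borel_measurable_lborel_pos] measurable_compose[OF measurable_snd borel_measurable_lborel_pos], simp)+
  show ?thesis
    unfolding level_fun_def by measurable
qed

lemma pow_density_mult: "0 < t \<Longrightarrow> pow_density \<alpha> (t * r) = t powr (1 / \<alpha> - 1) * pow_density \<alpha> r"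
  by (auto simp: pow_density_def powr_mult zero_less_mult_iff split: split_indicator)

text \<open>In the variables u = x^\<alpha> and v = y^\<beta> the level is u + v, so its law is the
  convolution of two power densities. Scaling by u = t r reduces the convolution to level 1; the two
  exponents 1/\<alpha> - 1 and 1/\<beta> - 1, plus one from du, make up the power of t.\<close>

lemma nn_integral_level:
  assumes \<alpha>: "0 < \<alpha>" "\<alpha> < 1" and \<beta>: "0 < \<beta>" "\<beta> < 1" and [measurable]: "F \<in> borel_measurable borel"
  shows "(\<integral>\<^sup>+p. F (level_fun \<alpha> \<beta> p) \<partial>quadrant)
    = (\<integral>\<^sup>+t. ennreal (level_const \<alpha> \<beta> * (indicator {0<..} t * t powr (1 / \<alpha> + 1 / \<beta> - 1))) * F t \<partial>lborel)"
proof -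
  have "(\<integral>\<^sup>+p. F (level_fun \<alpha> \<beta> p) \<partial>quadrant) = (\<integral>\<^sup>+x. \<integral>\<^sup>+y. F (level_fun \<alpha> \<beta> (x, y)) \<partial>lborel_pos \<partial>lborel_pos)"
    by (rule lborel_pos.nn_integral_fst[symmetric]) (rule measurable_compose[OF level_fun_measurable], measurable)
  also have "\<dots> = (\<integral>\<^sup>+x. \<integral>\<^sup>+v. ennreal (pow_density \<beta> v) * F (x powr \<alpha> + v) \<partial>lborel \<partial>lborel_pos)"
    unfolding level_fun_def fst_conv snd_conv using nn_integral_powr[OF \<beta>(1), of "\<lambda>v. F (_ + v)"]
    by (intro nn_integral_cong) simp
  also have "\<dots> = (\<integral>\<^sup>+u. ennreal (pow_density \<alpha> u) * (\<integral>\<^sup>+v. ennreal (pow_density \<beta> v) * F (u + v) \<partial>lborel) \<partial>lborel)"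
    by (rule nn_integral_powr[OF \<alpha>(1)]) measurable
  also have "\<dots> = (\<integral>\<^sup>+u. \<integral>\<^sup>+t. ennreal (pow_density \<alpha> u) * (ennreal (pow_density \<beta> (t - u)) * F t) \<partial>lborel \<partial>lborel)"
  proof (intro nn_integral_cong)
    fix u :: real
    have "(\<integral>\<^sup>+v. ennreal (pow_density \<beta> v) * F (u + v) \<partial>lborel) = (\<integral>\<^sup>+t. ennreal (pow_density \<beta> (t - u)) * F t \<partial>lborel)"
      using nn_integral_real_affine[of "\<lambda>v. ennreal (pow_density \<beta> v) * F (u + v)" 1 "- u"] by simp
    then show "ennreal (pow_density \<alpha> u) * (\<integral>\<^sup>+v. ennreal (pow_density \<beta> v) * F (u + v) \<partial>lborel)
        = (\<integral>\<^sup>+t. ennreal (pow_density \<alpha> u) * (ennreal (pow_density \<beta> (t - u)) * F t) \<partial>lborel)"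
      by (simp add: nn_integral_cmult)
  qed
  also have "\<dots> = (\<integral>\<^sup>+t. \<integral>\<^sup>+u. ennreal (pow_density \<alpha> u) * (ennreal (pow_density \<beta> (t - u)) * F t) \<partial>lborel \<partial>lborel)"
    by (rule lborel_pair.Fubini') measurable
  also have "\<dots> = (\<integral>\<^sup>+t. ennreal (level_const \<alpha> \<beta> * (indicator {0<..} t * t powr (1 / \<alpha> + 1 / \<beta> - 1))) * F t \<partial>lborel)"
  proof (intro nn_integral_cong)
    fix t :: real
    have "(\<integral>\<^sup>+u. ennreal (pow_density \<alpha> u) * (ennreal (pow_density \<beta> (t - u)) * F t) \<partial>lborel)
        = (\<integral>\<^sup>+u. ennreal (pow_density \<alpha> u * pow_density \<beta> (t - u)) \<partial>lborel) * F t"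
      using pow_density_nonneg[OF \<alpha>(1)] pow_density_nonneg[OF \<beta>(1)]
      by (subst nn_integral_multc[symmetric]) (auto simp: ennreal_mult' mult.assoc)
    also have "(\<integral>\<^sup>+u. ennreal (pow_density \<alpha> u * pow_density \<beta> (t - u)) \<partial>lborel)
        = ennreal (level_const \<alpha> \<beta> * (indicator {0<..} t * t powr (1 / \<alpha> + 1 / \<beta> - 1)))"
    proof (cases "0 < t")
      case True
      have "(\<integral>\<^sup>+u. ennreal (pow_density \<alpha> u * pow_density \<beta> (t - u)) \<partial>lborel)
          = ennreal t * (\<integral>\<^sup>+r. ennreal (pow_density \<alpha> (t * r) * pow_density \<beta> (t * (1 - r))) \<partial>lborel)"
        using True by (subst nn_integral_real_affine[where c = t and t = 0]) (auto simp: algebra_simps)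
      also have "\<dots> = ennreal t * (\<integral>\<^sup>+r. ennreal (t powr (1 / \<alpha> - 1) * t powr (1 / \<beta> - 1)) * ennreal (pow_density \<alpha> r * pow_density \<beta> (1 - r)) \<partial>lborel)"
        unfolding pow_density_mult[OF True]
        by (intro arg_cong2[where f = "(*)"] refl nn_integral_cong, subst ennreal_mult'[symmetric]) (simp_all add: mult_ac)
      also have "\<dots> = ennreal t * (ennreal (t powr (1 / \<alpha> - 1) * t powr (1 / \<beta> - 1)) * ennreal (level_const \<alpha> \<beta>))"
        by (subst nn_integral_cmult) (auto simp: level_const[OF \<alpha> \<beta>])
      also have "\<dots> = ennreal (level_const \<alpha> \<beta> * (t powr 1 * t powr (1 / \<alpha> - 1) * t powr (1 / \<beta> - 1)))"
        using True less_imp_le[OF level_const(1)[OF \<alpha> \<beta>]] by (simp add: mult_ac flip: ennreal_mult')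
      also have "t powr 1 * t powr (1 / \<alpha> - 1) * t powr (1 / \<beta> - 1) = t powr (1 / \<alpha> + 1 / \<beta> - 1)"
        by (simp only: powr_add[symmetric]) (rule arg_cong[where f = "(powr) t"], simp)
      finally show ?thesis
        using True by simp
    next
      case False
      then have zero: "pow_density \<alpha> u * pow_density \<beta> (t - u) = 0" for u
        by (simp add: pow_density_def indicator_def)
      show ?thesis
        using False unfolding zero by simp
    qed
    finally show "(\<integral>\<^sup>+u. ennreal (pow_density \<alpha> u) * (ennreal (pow_density \<beta> (t - u)) * F t) \<partial>lborel)
        = ennreal (level_const \<alpha> \<beta> * (indicator {0<..} t * t powr (1 / \<alpha> + 1 / \<beta> - 1))) * F t" .
  qed
  finally show ?thesis .
qed

lemma distr_level_fun:
  assumes "0 < \<alpha>" "\<alpha> < 1" "0 < \<beta>" "\<beta> < 1"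
  shows "distr quadrant borel (level_fun \<alpha> \<beta>)
    = density lborel (\<lambda>t. ennreal (level_const \<alpha> \<beta> * (indicator {0<..} t * t powr (1 / \<alpha> + 1 / \<beta> - 1))))"
proof (rule measure_eqI)
  fix A
  assume "A \<in> sets (distr quadrant borel (level_fun \<alpha> \<beta>))"
  then have [measurable]: "A \<in> sets borel"
    by simp
  have "emeasure (distr quadrant borel (level_fun \<alpha> \<beta>)) A = (\<integral>\<^sup>+t. indicator A t \<partial>distr quadrant borel (level_fun \<alpha> \<beta>))"
    by simp
  also have "\<dots> = (\<integral>\<^sup>+p. indicator A (level_fun \<alpha> \<beta> p) \<partial>quadrant)"
    by (rule nn_integral_distr[OF level_fun_measurable]) measurable
  also have "\<dots> = (\<integral>\<^sup>+t. ennreal (level_const \<alpha> \<beta> * (indicator {0<..} t * t powr (1 / \<alpha> + 1 / \<beta> - 1))) * indicator A t \<partial>lborel)"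
    by (rule nn_integral_level[OF assms]) measurable
  also have "\<dots> = emeasure (density lborel (\<lambda>t. ennreal (level_const \<alpha> \<beta> * (indicator {0<..} t * t powr (1 / \<alpha> + 1 / \<beta> - 1))))) A"
    by (rule emeasure_density[symmetric]) measurable
  finally show "emeasure (distr quadrant borel (level_fun \<alpha> \<beta>)) A
      = emeasure (density lborel (\<lambda>t. ennreal (level_const \<alpha> \<beta> * (indicator {0<..} t * t powr (1 / \<alpha> + 1 / \<beta> - 1))))) A" .
qed simp

lemma integral_level_fun:
  fixes G :: "real \<Rightarrow> complex"
  assumes "0 < \<alpha>" "\<alpha> < 1" "0 < \<beta>" "\<beta> < 1" and [measurable]: "G \<in> borel_measurable borel"
  shows "(LINT p|quadrant. G (level_fun \<alpha> \<beta> p))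
    = (LINT t|lborel. (level_const \<alpha> \<beta> * (indicator {0<..} t * t powr (1 / \<alpha> + 1 / \<beta> - 1))) *\<^sub>R G t)"
  using integral_distr[OF level_fun_measurable, of G \<alpha> \<beta>] less_imp_le[OF level_const(1)[OF assms(1-4)]]
  by (simp add: distr_level_fun[OF assms(1-4)] integral_density)

lemma bounded_ops_id: "(\<lambda>f. f) \<in> bounded_ops"
  by (rule bounded_opsI[where C = 1]) auto

section \<open>Averaging over a family of rank-one operators\<close>

text \<open>Isolates what the operator-theoretic part uses about the exponentials: measurability and
  one absolute bound. The factor \<open>norm (e z) * norm (d z)\<close> stands in
  \<open>frame_bound\<close> because it dominates the symbol of any operator of norm at most
  one.\<close>

locale averaging_frame =
  fixes M :: "'z measure" and e d :: "'z \<Rightarrow> l2" and C :: real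
  assumes sigma_finite: "sigma_finite_measure M"
    and measurable_e: "\<And>f. (\<lambda>z. cinner f (e z)) \<in> borel_measurable M"
    and measurable_d: "\<And>f. (\<lambda>z. cinner f (d z)) \<in> borel_measurable M"
    and measurable_norm: "(\<lambda>z. norm (e z) * norm (d z)) \<in> borel_measurable M"
    and frame_bound: "\<And>f g. (\<integral>\<^sup>+z. ennreal (norm (e z) * norm (d z) * (cmod (cinner f (e z)) * cmod (cinner (d z) g))) \<partial>M)
      \<le> ennreal (C * norm f * norm g)"
    and C_nonneg: "0 \<le> C"
begin

lemma measurable_e': "(\<lambda>z. cinner (e z) f) \<in> borel_measurable M"
  by (subst cinner_commute) (intro measurable_cnj measurable_e)

lemma measurable_d': "(\<lambda>z. cinner (d z) f) \<in> borel_measurable M"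
  by (subst cinner_commute) (intro measurable_cnj measurable_d)

lemma measurable_symbol: "R \<in> bounded_ops \<Longrightarrow> (\<lambda>z. cinner (e z) (R (d z))) \<in> borel_measurable M"
  by (rule borel_measurable_cinner_op[OF measurable_e' measurable_d])

lemma symbol_bound:
  assumes R: "R \<in> bounded_ops"
  shows "cmod (cinner (e z) (R (d z))) \<le> onorm R * (norm (e z) * norm (d z))"
  using order_trans[OF cinner_cauchy_schwarz[of "e z" "R (d z)"]
      mult_left_mono[OF bounded_ops_norm[OF R, of "d z"] norm_ge_zero[of "e z"]]]
  by (simp add: mult_ac)

text \<open>The inner product of f with the average applied to g. The average is in the
  conjugate-linear slot, so the conjugate of the coefficient <R d_z, e_z> appears.\<close>

definition form :: "(l2 \<Rightarrow> l2) \<Rightarrow> l2 \<Rightarrow> l2 \<Rightarrow> complex" where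
  "form R f g = (LINT z|M. cinner f (e z) * cinner (d z) g * cinner (e z) (R (d z)))"

lemma
  assumes R: "R \<in> bounded_ops"
  shows form_integrable: "integrable M (\<lambda>z. cinner f (e z) * cinner (d z) g * cinner (e z) (R (d z)))"
    and form_bound: "cmod (form R f g) \<le> C * onorm R * norm f * norm g"
proof -
  let ?F = "\<lambda>z. cinner f (e z) * cinner (d z) g * cinner (e z) (R (d z))"
  have meas: "?F \<in> borel_measurable M"
    by (intro borel_measurable_times measurable_e measurable_d' measurable_symbol R)
  have meas_frame: "(\<lambda>z. ennreal (norm (e z) * norm (d z) * (cmod (cinner f (e z)) * cmod (cinner (d z) g)))) \<in> borel_measurable M"
    by (rule measurable_compose[OF borel_measurable_times[OF measurable_norm] measurable_ennreal])
       (intro borel_measurable_times measurable_compose[OF measurable_e borel_measurable_norm]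
         measurable_compose[OF measurable_d' borel_measurable_norm])
  have "(\<integral>\<^sup>+z. ennreal (cmod (?F z)) \<partial>M)
      \<le> (\<integral>\<^sup>+z. ennreal (onorm R) * ennreal (norm (e z) * norm (d z) * (cmod (cinner f (e z)) * cmod (cinner (d z) g))) \<partial>M)"
  proof (rule nn_integral_mono)
    fix z
    have "cmod (?F z) \<le> cmod (cinner f (e z)) * cmod (cinner (d z) g) * (onorm R * (norm (e z) * norm (d z)))"
      unfolding norm_mult by (intro mult_left_mono symbol_bound R) auto
    then have "ennreal (cmod (?F z)) \<le> ennreal (onorm R * (norm (e z) * norm (d z) * (cmod (cinner f (e z)) * cmod (cinner (d z) g))))"
      by (intro ennreal_leI) (simp add: mult_ac)
    then show "ennreal (cmod (?F z)) \<le> ennreal (onorm R) * ennreal (norm (e z) * norm (d z) * (cmod (cinner f (e z)) * cmod (cinner (d z) g)))"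
      by (simp only: ennreal_mult'[OF bounded_ops_onorm_nonneg[OF R]])
  qed
  also have "\<dots> = ennreal (onorm R) * (\<integral>\<^sup>+z. ennreal (norm (e z) * norm (d z) * (cmod (cinner f (e z)) * cmod (cinner (d z) g))) \<partial>M)"
    by (rule nn_integral_cmult[OF meas_frame])
  also have "\<dots> \<le> ennreal (onorm R) * ennreal (C * norm f * norm g)"
    by (intro mult_left_mono frame_bound) simp
  also have "\<dots> = ennreal (C * onorm R * norm f * norm g)"
    using bounded_ops_onorm_nonneg[OF R] by (simp add: mult_ac flip: ennreal_mult')
  finally have le: "(\<integral>\<^sup>+z. ennreal (cmod (?F z)) \<partial>M) \<le> ennreal (C * onorm R * norm f * norm g)" .
  then show "integrable M ?F"
    by (intro integrableI_bounded[OF meas]) (simp add: le_less_trans)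
  have "ennreal (cmod (form R f g)) \<le> ennreal (C * onorm R * norm f * norm g)"
    unfolding form_def by (rule order_trans[OF ennreal_norm_integral_le le])
  then show "cmod (form R f g) \<le> C * onorm R * norm f * norm g"
    using C_nonneg bounded_ops_onorm_nonneg[OF R] by simp
qed

definition avg :: "(l2 \<Rightarrow> l2) \<Rightarrow> l2 \<Rightarrow> l2" where
  "avg R = (SOME X. X \<in> bounded_ops \<and> (\<forall>f g. cinner f (X g) = form R f g) \<and> (\<forall>g. norm (X g) \<le> C * onorm R * norm g))"

lemma
  assumes R: "R \<in> bounded_ops"
  shows avg_bounded: "avg R \<in> bounded_ops"
    and cinner_avg: "cinner f (avg R g) = form R f g"
    and norm_avg: "norm (avg R g) \<le> C * onorm R * norm g"
proof -
  have "\<exists>X \<in> bounded_ops. (\<forall>f g. cinner f (X g) = form R f g) \<and> (\<forall>g. norm (X g) \<le> C * onorm R * norm g)"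
  proof (rule sesquilinear_form_operator)
    show "form R (f + f') g = form R f g + form R f' g" for f f' g
      using form_integrable[OF R, of f g] form_integrable[OF R, of f' g]
      by (simp add: form_def cinner_add_left distrib_right)
    show "form R f (g + g') = form R f g + form R f g'" for f g g'
      using form_integrable[OF R, of f g] form_integrable[OF R, of f g']
      by (simp add: form_def cinner_add_right distrib_right distrib_left)
    show "form R (c *\<^sub>C f) g = c * form R f g" for c f g
      by (simp add: form_def cinner_scaleC_left mult.assoc)
    show "form R f (c *\<^sub>C g) = cnj c * form R f g" for c f g
      by (simp add: form_def cinner_scaleC_right mult.assoc mult.left_commute[of _ "cnj c"])
  qed (rule form_bound[OF R])
  then have "\<exists>X. X \<in> bounded_ops \<and> (\<forall>f g. cinner f (X g) = form R f g) \<and> (\<forall>g. norm (X g) \<le> C * onorm R * norm g)"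
    by blast
  from someI_ex[OF this] have "avg R \<in> bounded_ops \<and> (\<forall>f g. cinner f (avg R g) = form R f g) \<and> (\<forall>g. norm (avg R g) \<le> C * onorm R * norm g)"
    unfolding avg_def .
  then show "avg R \<in> bounded_ops" "cinner f (avg R g) = form R f g" "norm (avg R g) \<le> C * onorm R * norm g"
    by simp_all
qed

lemma avg_eqI:
  assumes "R \<in> bounded_ops" "\<And>f g. cinner f (X g) = form R f g"
  shows "avg R = X"
  by (intro ext l2_eqI_right) (simp add: cinner_avg assms)

lemma onorm_avg: "R \<in> bounded_ops \<Longrightarrow> onorm (avg R) \<le> C * onorm R"
  using norm_avg C_nonneg bounded_ops_onorm_nonneg by (intro onorm_bound) auto

lemma avg_add:
  assumes S: "S \<in> bounded_ops" and T: "T \<in> bounded_ops"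
  shows "avg (\<lambda>f. S f + T f) = (\<lambda>f. avg S f + avg T f)"
proof (rule avg_eqI[OF bounded_ops_plus[OF S T]])
  fix f g
  show "cinner f (avg S g + avg T g) = form (\<lambda>f. S f + T f) f g"
    using form_integrable[OF S, of f g] form_integrable[OF T, of f g]
    by (simp add: cinner_add_right cinner_avg S T form_def distrib_left)
qed

lemma avg_scaleC:
  assumes T: "T \<in> bounded_ops"
  shows "avg (\<lambda>f. c *\<^sub>C T f) = (\<lambda>f. c *\<^sub>C avg T f)"
proof (rule avg_eqI[OF bounded_ops_cmult[OF T]])
  fix f g
  show "cinner f (c *\<^sub>C avg T g) = form (\<lambda>f. c *\<^sub>C T f) f g"
    by (simp add: cinner_scaleC_right cinner_avg T form_def mult.left_commute[of _ "cnj c"])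
qed

context
  fixes N :: "'w measure" and u v :: "'w \<Rightarrow> l2" and T :: "l2 \<Rightarrow> l2"
  assumes N: "sigma_finite_measure N" and rep: "integral_rep N u v T"
begin

text \<open>The frame bound is applied to each rank-one component and integrated over N, where
  \<open>norm (u n) * norm (v n)\<close> is integrable. The symbol of such a T is thus integrable
  against \<open>norm (e z) * norm (d z)\<close>, whereas for a general bounded operator it is
  merely bounded by a multiple of it.\<close>

lemma avg_Fubini:
  assumes R: "R \<in> bounded_ops"
  shows "integrable (M \<Otimes>\<^sub>M N) (\<lambda>p. cinner (u (snd p)) (e (fst p)) * cinner (d (fst p)) (v (snd p)) * cinner (e (fst p)) (R (d (fst p))))"
    and "(\<integral>\<^sup>+z. ennreal (norm (e z) * norm (d z) * cmod (cinner (T (d z)) (e z))) \<partial>M) < \<infinity>"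
proof -
  interpret M: sigma_finite_measure M
    by (rule sigma_finite)
  interpret N: sigma_finite_measure N
    by (rule N)
  interpret MN: pair_sigma_finite M N ..
  have u: "(\<lambda>n. cinner (u n) h) \<in> borel_measurable N" and v: "(\<lambda>n. cinner h (v n)) \<in> borel_measurable N"
    and int: "integrable N (\<lambda>n. norm (u n) * norm (v n))"
    and T_eq: "cinner (T h) k = (LINT n|N. cinner h (v n) * cinner (u n) k)" for h k
    using rep by (auto simp: integral_rep_def)
  let ?P = "M \<Otimes>\<^sub>M N"
  have ue: "(\<lambda>p. cinner (u (snd p)) (e (fst p))) \<in> borel_measurable ?P"
    by (rule borel_measurable_cinner_op[OF _ _ bounded_ops_id])
       (rule measurable_compose[OF measurable_snd u] measurable_compose[OF measurable_fst measurable_e])+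
  have dv: "(\<lambda>p. cinner (d (fst p)) (v (snd p))) \<in> borel_measurable ?P"
    by (rule borel_measurable_cinner_op[OF _ _ bounded_ops_id])
       (rule measurable_compose[OF measurable_snd v] measurable_compose[OF measurable_fst measurable_d'])+
  have eRd: "(\<lambda>p. cinner (e (fst p)) (R (d (fst p)))) \<in> borel_measurable ?P"
    by (rule measurable_compose[OF measurable_fst measurable_symbol[OF R]])
  have ed: "(\<lambda>p. norm (e (fst p)) * norm (d (fst p))) \<in> borel_measurable ?P"
    by (rule measurable_compose[OF measurable_fst measurable_norm])
  define W where "W p = norm (e (fst p)) * norm (d (fst p)) * (cmod (cinner (u (snd p)) (e (fst p))) * cmod (cinner (d (fst p)) (v (snd p))))" for p
  have W: "W \<in> borel_measurable ?P"
    unfolding W_def[abs_def] by (intro borel_measurable_times ed borel_measurable_norm ue dv measurable_compose[OF ue borel_measurable_norm] measurable_compose[OF dv borel_measurable_norm])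
  then have W': "(\<lambda>p. ennreal (W p)) \<in> borel_measurable ?P"
    by simp
  have "(\<integral>\<^sup>+p. ennreal (W p) \<partial>?P) = (\<integral>\<^sup>+n. \<integral>\<^sup>+z. ennreal (W (z, n)) \<partial>M \<partial>N)"
    by (rule MN.nn_integral_snd[symmetric]) (use W' in \<open>simp add: split_beta'\<close>)
  also have "\<dots> \<le> (\<integral>\<^sup>+n. ennreal C * ennreal (norm (u n) * norm (v n)) \<partial>N)"
  proof (intro nn_integral_mono)
    fix n
    have "(\<integral>\<^sup>+z. ennreal (W (z, n)) \<partial>M) \<le> ennreal (C * norm (u n) * norm (v n))"
      unfolding W_def fst_conv snd_conv by (rule frame_bound)
    also have "\<dots> = ennreal C * ennreal (norm (u n) * norm (v n))"
      using C_nonneg by (simp add: mult.assoc flip: ennreal_mult')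
    finally show "(\<integral>\<^sup>+z. ennreal (W (z, n)) \<partial>M) \<le> ennreal C * ennreal (norm (u n) * norm (v n))" .
  qed
  also have "\<dots> = ennreal C * (\<integral>\<^sup>+n. ennreal (norm (u n) * norm (v n)) \<partial>N)"
    using borel_measurable_integrable[OF int] by (intro nn_integral_cmult) simp
  also have "\<dots> < \<infinity>"
    using int by (simp add: nn_integral_eq_integral ennreal_mult_less_top)
  finally have W_fin: "(\<integral>\<^sup>+p. ennreal (W p) \<partial>?P) < \<infinity>" .
  have W_nonneg: "0 \<le> W p" for p
    by (simp add: W_def)
  have int_W: "integrable ?P (\<lambda>p. onorm R * W p)"
    by (intro integrable_mult_right integrableI_bounded W) (use W_fin W_nonneg in simp)
  show "integrable ?P (\<lambda>p. cinner (u (snd p)) (e (fst p)) * cinner (d (fst p)) (v (snd p)) * cinner (e (fst p)) (R (d (fst p))))"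
  proof (rule Bochner_Integration.integrable_bound[OF int_W])
    show "(\<lambda>p. cinner (u (snd p)) (e (fst p)) * cinner (d (fst p)) (v (snd p)) * cinner (e (fst p)) (R (d (fst p)))) \<in> borel_measurable ?P"
      by (intro borel_measurable_times ue dv eRd)
    show "AE p in ?P. norm (cinner (u (snd p)) (e (fst p)) * cinner (d (fst p)) (v (snd p)) * cinner (e (fst p)) (R (d (fst p)))) \<le> norm (onorm R * W p)"
    proof (rule AE_I2)
      fix p
      have "norm (cinner (u (snd p)) (e (fst p)) * cinner (d (fst p)) (v (snd p)) * cinner (e (fst p)) (R (d (fst p))))
          \<le> cmod (cinner (u (snd p)) (e (fst p))) * cmod (cinner (d (fst p)) (v (snd p))) * (onorm R * (norm (e (fst p)) * norm (d (fst p))))"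
        unfolding norm_mult by (intro mult_left_mono symbol_bound R) auto
      also have "\<dots> = onorm R * W p"
        by (simp add: W_def mult_ac)
      finally show "norm (cinner (u (snd p)) (e (fst p)) * cinner (d (fst p)) (v (snd p)) * cinner (e (fst p)) (R (d (fst p)))) \<le> norm (onorm R * W p)"
        by simp
    qed
  qed
  have "(\<integral>\<^sup>+z. ennreal (norm (e z) * norm (d z) * cmod (cinner (T (d z)) (e z))) \<partial>M) \<le> (\<integral>\<^sup>+z. \<integral>\<^sup>+n. ennreal (W (z, n)) \<partial>N \<partial>M)"
  proof (intro nn_integral_mono)
    fix z
    have uv: "(\<lambda>n. ennreal (cmod (cinner (d z) (v n) * cinner (u n) (e z)))) \<in> borel_measurable N"
      by (rule measurable_compose[OF measurable_compose[OF borel_measurable_times[OF v u] borel_measurable_norm] measurable_ennreal])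
    have "ennreal (cmod (cinner (T (d z)) (e z))) \<le> (\<integral>\<^sup>+n. ennreal (cmod (cinner (d z) (v n) * cinner (u n) (e z))) \<partial>N)"
      unfolding T_eq by (rule ennreal_norm_integral_le)
    then have "ennreal (norm (e z) * norm (d z)) * ennreal (cmod (cinner (T (d z)) (e z)))
        \<le> ennreal (norm (e z) * norm (d z)) * (\<integral>\<^sup>+n. ennreal (cmod (cinner (d z) (v n) * cinner (u n) (e z))) \<partial>N)"
      by (rule mult_left_mono) simp
    also have "\<dots> = (\<integral>\<^sup>+n. ennreal (W (z, n)) \<partial>N)"
      by (subst nn_integral_cmult[OF uv, symmetric]) (simp add: W_def norm_mult mult_ac flip: ennreal_mult')
    finally show "ennreal (norm (e z) * norm (d z) * cmod (cinner (T (d z)) (e z))) \<le> (\<integral>\<^sup>+n. ennreal (W (z, n)) \<partial>N)"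
      by (simp add: ennreal_mult')
  qed
  also have "\<dots> = (\<integral>\<^sup>+p. ennreal (W p) \<partial>?P)"
    by (rule N.nn_integral_fst[OF W'])
  finally show "(\<integral>\<^sup>+z. ennreal (norm (e z) * norm (d z) * cmod (cinner (T (d z)) (e z))) \<partial>M) < \<infinity>"
    using W_fin by (rule le_less_trans)
qed

text \<open>Integrability of the symbol against the frame norms is exactly the absolute convergence
  demanded by \<open>integral_rep\<close>. Averaging therefore keeps the class of operators whose
  traces can be computed.\<close>

lemma avg_integral_rep:
  assumes T: "T \<in> bounded_ops"
  shows "integral_rep M (\<lambda>z. cinner (T (d z)) (e z) *\<^sub>C e z) d (avg T)"
proof -
  have sym_meas: "(\<lambda>z. cinner (T (d z)) (e z)) \<in> borel_measurable M"
    by (subst cinner_commute) (intro measurable_cnj measurable_symbol T)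
  have "integrable M (\<lambda>z. norm (cinner (T (d z)) (e z) *\<^sub>C e z) * norm (d z))"
  proof (rule integrableI_bounded)
    have "(\<lambda>z. cmod (cinner (T (d z)) (e z)) * (norm (e z) * norm (d z))) \<in> borel_measurable M"
      by (intro borel_measurable_times borel_measurable_norm sym_meas measurable_norm measurable_compose[OF sym_meas borel_measurable_norm])
    then show "(\<lambda>z. norm (cinner (T (d z)) (e z) *\<^sub>C e z) * norm (d z)) \<in> borel_measurable M"
      by (simp add: mult.assoc)
    show "(\<integral>\<^sup>+z. ennreal (norm (norm (cinner (T (d z)) (e z) *\<^sub>C e z) * norm (d z))) \<partial>M) < \<infinity>"
      using avg_Fubini(2)[OF T] by (simp add: mult_ac)
  qed
  moreover have "cinner (avg T h) k = (LINT z|M. cinner h (d z) * cinner (cinner (T (d z)) (e z) *\<^sub>C e z) k)" for h k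
  proof -
    have "cinner (avg T h) k = cnj (form T k h)"
      by (subst cinner_commute) (simp add: cinner_avg[OF T])
    also have "\<dots> = (LINT z|M. cnj (cinner k (e z) * cinner (d z) h * cinner (e z) (T (d z))))"
      unfolding form_def by (rule Bochner_Integration.integral_cnj[symmetric])
    also have "\<dots> = (LINT z|M. cinner h (d z) * cinner (cinner (T (d z)) (e z) *\<^sub>C e z) k)"
    proof (intro Bochner_Integration.integral_cong refl)
      fix z
      show "cnj (cinner k (e z) * cinner (d z) h * cinner (e z) (T (d z))) = cinner h (d z) * cinner (cinner (T (d z)) (e z) *\<^sub>C e z) k"
        by (simp add: cinner_scaleC_left cinner_commute[of "e z" k] cinner_commute[of h "d z"] cinner_commute[of "T (d z)" "e z"] mult_ac)
    qed
    finally show ?thesis .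
  qed
  ultimately show ?thesis
    unfolding integral_rep_def
    by (auto simp: cinner_scaleC_left intro!: borel_measurable_times sym_meas measurable_e' measurable_d)
qed

text \<open>Both traces are iterated integrals of the same function F of z and n, taken in opposite
  orders. The common value is asserted through \<open>has_trace\<close> because the existence of
  both traces is part of the claim.\<close>

lemma avg_trace:
  assumes T: "T \<in> bounded_ops" and R: "R \<in> bounded_ops"
  shows "\<exists>t. has_trace (avg T \<circ> adjoint_op R) t \<and> has_trace (T \<circ> adjoint_op (avg R)) t"
proof -
  interpret M: sigma_finite_measure M
    by (rule sigma_finite)
  interpret N: sigma_finite_measure N
    by (rule N)
  interpret MN: pair_sigma_finite M N ..
  define F where "F z n = cinner (u n) (e z) * cinner (d z) (v n) * cinner (e z) (R (d z))" for z n
  have "has_trace (avg T \<circ> adjoint_op R) (LINT z|M. cinner (cinner (T (d z)) (e z) *\<^sub>C e z) (R (d z)))"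
    by (rule integral_rep_trace[OF avg_integral_rep[OF T] R])
  moreover have "has_trace (T \<circ> adjoint_op (avg R)) (LINT n|N. cinner (u n) (avg R (v n)))"
    by (rule integral_rep_trace[OF rep avg_bounded[OF R]])
  moreover have "(LINT z|M. cinner (cinner (T (d z)) (e z) *\<^sub>C e z) (R (d z))) = (LINT n|N. cinner (u n) (avg R (v n)))"
  proof -
    have "cinner (cinner (T (d z)) (e z) *\<^sub>C e z) (R (d z)) = (LINT n|N. F z n)" for z
    proof -
      have "cinner (T (d z)) (e z) = (LINT n|N. cinner (d z) (v n) * cinner (u n) (e z))"
        using rep by (simp add: integral_rep_def)
      then show ?thesis
        by (simp add: F_def cinner_scaleC_left mult.commute[of "cinner (u _) (e z)"])
    qed
    moreover have "cinner (u n) (avg R (v n)) = (LINT z|M. F z n)" for n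
      by (simp add: cinner_avg[OF R] form_def F_def)
    moreover have "(LINT n|N. LINT z|M. F z n) = (LINT z|M. LINT n|N. F z n)"
      by (rule MN.Fubini_integral) (use avg_Fubini(1)[OF R] in \<open>simp add: F_def split_beta'\<close>)
    ultimately show ?thesis
      by simp
  qed
  ultimately show ?thesis
    by (intro exI[of _ "LINT n|N. cinner (u n) (avg R (v n))"]) simp
qed

end

end

section \<open>Cauchy--Schwarz and measurability for the half-plane and for symbols\<close>

lemma nn_integral_cauchy_schwarz:
  fixes f g :: "'a \<Rightarrow> real"
  assumes [measurable]: "f \<in> borel_measurable M" "g \<in> borel_measurable M"
    and nonneg: "\<And>x. x \<in> space M \<Longrightarrow> 0 \<le> f x" "\<And>x. x \<in> space M \<Longrightarrow> 0 \<le> g x"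
    and f: "(\<integral>\<^sup>+x. ennreal ((f x)\<^sup>2) \<partial>M) \<le> ennreal (A\<^sup>2)" and g: "(\<integral>\<^sup>+x. ennreal ((g x)\<^sup>2) \<partial>M) \<le> ennreal (B\<^sup>2)"
    and AB: "0 \<le> A" "0 \<le> B"
  shows "(\<integral>\<^sup>+x. ennreal (f x * g x) \<partial>M) \<le> ennreal (A * B)"
proof -
  define I where "I = (\<integral>\<^sup>+x. ennreal (f x) * ennreal (g x) \<partial>M)"
  have "I\<^sup>2 \<le> (\<integral>\<^sup>+x. (ennreal (f x))\<^sup>2 \<partial>M) * (\<integral>\<^sup>+x. (ennreal (g x))\<^sup>2 \<partial>M)"
    unfolding I_def by (rule Cauchy_Schwarz_nn_integral) measurable
  also have "(\<integral>\<^sup>+x. (ennreal (f x))\<^sup>2 \<partial>M) = (\<integral>\<^sup>+x. ennreal ((f x)\<^sup>2) \<partial>M)"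
    by (intro nn_integral_cong) (simp add: nonneg ennreal_power)
  also have "(\<integral>\<^sup>+x. (ennreal (g x))\<^sup>2 \<partial>M) = (\<integral>\<^sup>+x. ennreal ((g x)\<^sup>2) \<partial>M)"
    by (intro nn_integral_cong) (simp add: nonneg ennreal_power)
  also have "(\<integral>\<^sup>+x. ennreal ((f x)\<^sup>2) \<partial>M) * (\<integral>\<^sup>+x. ennreal ((g x)\<^sup>2) \<partial>M) \<le> ennreal (A\<^sup>2) * ennreal (B\<^sup>2)"
    by (intro mult_mono f g) auto
  also have "\<dots> = ennreal ((A * B)\<^sup>2)"
    by (simp add: power_mult_distrib flip: ennreal_mult')
  finally have le: "I\<^sup>2 \<le> ennreal ((A * B)\<^sup>2)" .
  have "I \<le> ennreal (A * B)"
  proof (cases I rule: ennreal_cases)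
    case (real r)
    then have "r\<^sup>2 \<le> (A * B)\<^sup>2"
      using le by (simp add: ennreal_power)
    then have "r \<le> A * B"
      by (rule power2_le_imp_le) (use AB in simp)
    then show ?thesis
      by (simp add: real ennreal_leI)
  next
    case top
    then show ?thesis
      using le by (simp add: power2_eq_square top_unique)
  qed
  also have "I = (\<integral>\<^sup>+x. ennreal (f x * g x) \<partial>M)"
    unfolding I_def by (intro nn_integral_cong) (simp add: nonneg ennreal_mult')
  finally show ?thesis .
qed

lemma ev_fun_measurable_joint:
  assumes f: "f \<in> borel_measurable lborel_pos"
  shows "(\<lambda>z. LINT x|lborel_pos. f x * ev_fun \<alpha> (Complex (fst z) (snd z)) x) \<in> borel_measurable (lborel_pos \<Otimes>\<^sub>M lborel)"
proof (rule lborel_pos.borel_measurable_lebesgue_integral)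
  let ?M = "(lborel_pos \<Otimes>\<^sub>M lborel) \<Otimes>\<^sub>M lborel_pos"
  have [measurable]: "(\<lambda>p. snd p) \<in> borel_measurable ?M"
    by (rule measurable_compose[OF measurable_snd borel_measurable_lborel_pos]) simp
  have [measurable]: "(\<lambda>p. f (snd p)) \<in> borel_measurable ?M"
    by (rule measurable_compose[OF measurable_snd f])
  have [measurable]: "(\<lambda>p. fst (fst p)) \<in> borel_measurable ?M"
    by (rule measurable_compose[OF measurable_compose[OF measurable_fst measurable_fst] borel_measurable_lborel_pos]) simp
  have [measurable]: "(\<lambda>p. snd (fst p)) \<in> borel_measurable ?M"
    using measurable_compose[OF measurable_fst measurable_snd] by simp
  have "(\<lambda>p. f (snd p) * exp (- (of_real (fst (fst p)) + \<i> * of_real (snd (fst p))) * of_real (snd p powr \<alpha>))) \<in> borel_measurable ?M"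
    by measurable
  then show "(\<lambda>(z, x). f x * ev_fun \<alpha> (Complex (fst z) (snd z)) x) \<in> borel_measurable ?M"
    by (simp add: split_beta ev_fun_def Complex_eq)
qed

text \<open>A symbol enters only through its kernel, so its measurability has to be recovered. The
  slice of the kernel at x = r^(1/\<alpha>) determines the symbol at all levels t > r; letting r
  decrease to 0 covers the half-line.\<close>

lemma borel_measurable_of_level_fun:
  fixes \<psi> :: "real \<Rightarrow> complex"
  assumes \<alpha>: "0 < \<alpha>" and \<beta>: "0 < \<beta>" and k: "(\<lambda>p. \<psi> (level_fun \<alpha> \<beta> p)) \<in> borel_measurable quadrant"
  shows "(\<lambda>t. indicator {0<..} t *\<^sub>R \<psi> t) \<in> borel_measurable borel"
proof (rule borel_measurable_LIMSEQ_metric)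
  define r where "r n = 1 / real (Suc n)" for n
  have r: "r n > 0" for n
    by (simp add: r_def)
  let ?f = "\<lambda>n t. indicator {0<..} (t - r n) *\<^sub>R \<psi> (r n + (t - r n))"
  show "(\<lambda>n. ?f n t) \<longlonglongrightarrow> indicator {0<..} t *\<^sub>R \<psi> t" for t
  proof (cases "t > 0")
    case True
    have "r \<longlonglongrightarrow> 0"
      unfolding r_def by (rule lim_1_over_n[THEN LIMSEQ_Suc])
    then have "eventually (\<lambda>n. r n < t) sequentially"
      using True by (rule order_tendstoD)
    then show ?thesis
      using True by (intro tendsto_eventually) (auto elim!: eventually_mono)
  next
    case False
    then have "\<not> 0 < t - r n" for n
      using r[of n] by linarith
    then show ?thesis
      using False by simp
  qed
  show "?f n \<in> borel_measurable borel" for n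
  proof -
    have x: "r n powr (1 / \<alpha>) \<in> space lborel_pos"
      using r[of n] by simp
    have "(\<lambda>y. \<psi> (level_fun \<alpha> \<beta> (r n powr (1 / \<alpha>), y))) \<in> borel_measurable lborel_pos"
      by (rule measurable_compose[OF measurable_Pair1'[OF x] k])
    then have 1: "(\<lambda>y. indicator {0<..} y *\<^sub>R \<psi> (level_fun \<alpha> \<beta> (r n powr (1 / \<alpha>), y))) \<in> borel_measurable borel"
      by (rule borel_measurable_extend_lborel_pos)
    have "(\<lambda>t. indicator {0<..} (max 0 (t - r n) powr (1 / \<beta>)) *\<^sub>R \<psi> (level_fun \<alpha> \<beta> (r n powr (1 / \<alpha>), max 0 (t - r n) powr (1 / \<beta>)))) \<in> borel_measurable borel"
      by (rule measurable_compose[OF _ 1]) measurable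
    also have "(\<lambda>t. indicator {0<..} (max 0 (t - r n) powr (1 / \<beta>)) *\<^sub>R \<psi> (level_fun \<alpha> \<beta> (r n powr (1 / \<alpha>), max 0 (t - r n) powr (1 / \<beta>)))) = ?f n"
    proof
      fix t
      show "indicator {0<..} (max 0 (t - r n) powr (1 / \<beta>)) *\<^sub>R \<psi> (level_fun \<alpha> \<beta> (r n powr (1 / \<alpha>), max 0 (t - r n) powr (1 / \<beta>))) = ?f n t"
        using \<alpha> \<beta> r[of n] by (cases "0 < t - r n") (simp_all add: level_fun_def powr_powr max_def)
    qed
    finally show ?thesis .
  qed
qed

section \<open>The averaging projection\<close>

locale averaging_params =
  fixes \<alpha> \<beta> :: real
  assumes \<alpha>: "0 < \<alpha>" "\<alpha> < 1" and \<beta>: "0 < \<beta>" "\<beta> < 1"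
begin

section \<open>The frame of exponentials and its bound\<close>

definition m :: real where "m = 1 / \<alpha> + 1 / \<beta> - 1"

lemma m_gt_1: "1 < m"
proof -
  have "1 < 1 / \<alpha>" "1 < 1 / \<beta>"
    using \<alpha> \<beta> by simp_all
  then show ?thesis
    by (simp add: m_def)
qed

abbreviation "s \<equiv> level_fun \<alpha> \<beta>"
abbreviation "B \<equiv> level_const \<alpha> \<beta>"

lemma B_pos: "0 < B"
  by (rule level_const(1)[OF \<alpha> \<beta>])

lemma s_pos: "p \<in> space quadrant \<Longrightarrow> 0 < s p"
  by (auto simp: level_fun_def space_pair_measure intro: add_pos_pos)

text \<open>
  The level set of \<open>s\<close> at height \<open>t\<close> has density \<open>B t\<^sup>m\<close>.  The constant is chosen so that
  \<open>2 \<pi> B t\<^sup>m \<integral> weight \<sigma> exp (-2 \<sigma> t) d\<sigma> = 1\<close>, which makes the inversion formula exact.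
\<close>

definition weight :: "real \<Rightarrow> real" where
  "weight \<sigma> = 2 powr m / (2 * pi * Gamma m * B) * \<sigma> powr (m - 1)"

lemma weight_pos: "0 < \<sigma> \<Longrightarrow> 0 < weight \<sigma>"
  using m_gt_1 B_pos by (simp add: weight_def Gamma_real_pos)

lemma weight_nonneg: "0 \<le> weight \<sigma>"
  using m_gt_1 B_pos by (simp add: weight_def Gamma_real_pos less_imp_le)

abbreviation half_plane :: "(real \<times> real) measure" where
  "half_plane \<equiv> lborel_pos \<Otimes>\<^sub>M lborel"

definition V :: "(real \<times> real) measure" where
  "V = density half_plane (\<lambda>z. ennreal (weight (fst z)))"

definition pt :: "real \<times> real \<Rightarrow> complex" where
  "pt z = Complex (fst z) (snd z)"

definition e :: "real \<times> real \<Rightarrow> l2" where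
  "e z = ev \<alpha> (cnj (pt z))"

definition d :: "real \<times> real \<Rightarrow> l2" where
  "d z = ev \<beta> (pt z)"

definition w :: "real \<times> real \<Rightarrow> real" where
  "w z = ev_norm \<alpha> (fst z) * ev_norm \<beta> (fst z)"

lemma space_V: "z \<in> space V \<longleftrightarrow> 0 < fst z"
  by (cases z) (auto simp: V_def space_pair_measure)

lemma sets_V [measurable_cong]: "sets V = sets half_plane"
  by (simp add: V_def)

lemma fst_measurable [measurable]: "(\<lambda>z. fst z) \<in> borel_measurable half_plane"
  by (rule measurable_compose[OF measurable_fst borel_measurable_lborel_pos]) simp

lemma snd_measurable [measurable]: "(\<lambda>z. snd z) \<in> borel_measurable half_plane"
  using measurable_snd[of lborel_pos lborel] by simp

lemma weight_measurable [measurable]: "weight \<in> borel_measurable borel"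
  unfolding weight_def[abs_def] by measurable

lemma norm_e: "z \<in> space V \<Longrightarrow> norm (e z) = ev_norm \<alpha> (fst z)"
  and norm_d: "z \<in> space V \<Longrightarrow> norm (d z) = ev_norm \<beta> (fst z)"
  using \<alpha> \<beta> by (auto simp: e_def d_def norm_ev pt_def space_V)

lemma norm_ed: "z \<in> space V \<Longrightarrow> norm (e z) * norm (d z) = w z"
  by (simp add: norm_e norm_d w_def)

lemma w_pos: "z \<in> space V \<Longrightarrow> 0 < w z"
  using \<alpha> \<beta> by (simp add: w_def ev_norm_pos space_V)

lemma w_measurable [measurable]: "w \<in> borel_measurable half_plane"
  unfolding w_def[abs_def] ev_norm_def by measurable

lemma cinner_e: "z \<in> space V \<Longrightarrow> cinner f (e z) = (LINT x|lborel_pos. rep_l2 f x * ev_fun \<alpha> (pt z) x)"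
  using \<alpha> by (simp add: e_def cinner_ev space_V pt_def)

text \<open>A Laplace transform of the conjugate of g at the very point \<open>pt z\<close> that
  occurs in \<open>cinner_e\<close>. This agreement is why e carries a conjugate parameter and d
  does not.\<close>

lemma cinner_d: "z \<in> space V \<Longrightarrow> cinner (d z) g = (LINT y|lborel_pos. cnj (rep_l2 g y) * ev_fun \<beta> (pt z) y)"
proof -
  assume "z \<in> space V"
  then have "cinner (d z) g = cnj (LINT y|lborel_pos. rep_l2 g y * ev_fun \<beta> (cnj (pt z)) y)"
    using \<beta> by (subst cinner_commute) (simp add: d_def cinner_ev space_V pt_def)
  then show ?thesis
    by (simp add: cnj_ev_fun flip: Bochner_Integration.integral_cnj)
qed

lemma sigma_finite_V: "sigma_finite_measure V"
proof -
  interpret pair_sigma_finite lborel_pos lborel ..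
  show ?thesis
    unfolding V_def by (subst sigma_finite_iff_density_finite) auto
qed

lemma cinner_e_measurable: "(\<lambda>z. cinner f (e z)) \<in> borel_measurable V"
  using ev_fun_measurable_joint[OF rep_l2_measurable, of f \<alpha>]
  by (subst measurable_cong[OF cinner_e]) (simp_all add: pt_def measurable_cong_sets[OF sets_V refl])

lemma cinner_d_measurable: "(\<lambda>z. cinner f (d z)) \<in> borel_measurable V"
proof -
  have "(\<lambda>z. cnj (cinner (d z) f)) \<in> borel_measurable V"
    using ev_fun_measurable_joint[OF measurable_cnj[OF rep_l2_measurable], of f \<beta>]
    by (intro measurable_cnj, subst measurable_cong[OF cinner_d]) (simp_all add: pt_def measurable_cong_sets[OF sets_V refl])
  then show ?thesis
    by (simp flip: cinner_commute)
qed

definition laplace_const :: "real \<Rightarrow> real" where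
  "laplace_const \<gamma> = 2 * pi * Gamma (1 / \<gamma> - 1) * 2 powr - (1 / \<gamma> - 1) / \<gamma>"

lemma laplace_const_pos: "0 < \<gamma> \<Longrightarrow> \<gamma> < 1 \<Longrightarrow> 0 < laplace_const \<gamma>"
  by (simp add: laplace_const_def Gamma_real_pos)

text \<open>The Laplace bound with the square root of the weight moved inside the square, ready for
  Cauchy--Schwarz over the half-plane.\<close>

lemma laplace_bound_half_plane:
  assumes \<gamma>: "0 < \<gamma>" "\<gamma> < 1" and f: "square_integrable lborel_pos f"
    and norm: "(\<integral>\<^sup>+x. ennreal ((cmod (f x))\<^sup>2) \<partial>lborel_pos) = ennreal (r\<^sup>2)"
  shows "(\<integral>\<^sup>+z. ennreal ((fst z powr ((1 / \<gamma> - 2) / 2) * cmod (LINT x|lborel_pos. f x * ev_fun \<gamma> (pt z) x))\<^sup>2) \<partial>half_plane)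
    \<le> ennreal ((sqrt (laplace_const \<gamma>) * r)\<^sup>2)"
proof -
  have f_meas: "f \<in> borel_measurable lborel_pos"
    using f by (simp add: square_integrable_def)
  note [measurable] = ev_fun_measurable_joint[OF f_meas, of \<gamma>]
  have sq: "(\<sigma> powr ((1 / \<gamma> - 2) / 2) * c)\<^sup>2 = \<sigma> powr (1 / \<gamma> - 2) * c\<^sup>2" for \<sigma> c :: real
    by (simp add: power_mult_distrib power2_eq_square[of "_ powr _"] flip: powr_add)
  have "(\<integral>\<^sup>+z. ennreal ((fst z powr ((1 / \<gamma> - 2) / 2) * cmod (LINT x|lborel_pos. f x * ev_fun \<gamma> (pt z) x))\<^sup>2) \<partial>half_plane)
      = (\<integral>\<^sup>+\<sigma>. \<integral>\<^sup>+\<tau>. ennreal (\<sigma> powr (1 / \<gamma> - 2) * (cmod (LINT x|lborel_pos. f x * ev_fun \<gamma> (Complex \<sigma> \<tau>) x))\<^sup>2) \<partial>lborel \<partial>lborel_pos)"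
    unfolding sq pt_def by (subst lborel.nn_integral_fst[symmetric]) simp_all
  also have "\<dots> \<le> ennreal (laplace_const \<gamma>) * ennreal (r\<^sup>2)"
    using laplace_bound[OF \<gamma> f] by (simp add: norm laplace_const_def)
  also have "\<dots> = ennreal ((sqrt (laplace_const \<gamma>) * r)\<^sup>2)"
    using laplace_const_pos[OF \<gamma>] by (simp add: power_mult_distrib flip: ennreal_mult')
  finally show ?thesis .
qed

definition weight_const :: real where
  "weight_const = 2 powr m / (2 * pi * Gamma m * B) * sqrt (Gamma (1 / \<alpha>) / \<alpha> * 2 powr - (1 / \<alpha>)) * sqrt (Gamma (1 / \<beta>) / \<beta> * 2 powr - (1 / \<beta>))"

lemma weight_const_nonneg: "0 \<le> weight_const"
  using m_gt_1 B_pos \<alpha> \<beta> by (simp add: weight_const_def Gamma_real_pos less_imp_le)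

lemma ev_norm_eq: "0 < \<gamma> \<Longrightarrow> 0 < \<sigma> \<Longrightarrow> ev_norm \<gamma> \<sigma> = sqrt (Gamma (1 / \<gamma>) / \<gamma> * 2 powr - (1 / \<gamma>)) * \<sigma> powr - (1 / (2 * \<gamma>))"
proof -
  assume "0 < \<gamma>" "0 < \<sigma>"
  have sqrt: "sqrt (\<sigma> powr - (1 / \<gamma>)) = \<sigma> powr - (1 / (2 * \<gamma>))"
    using \<open>0 < \<sigma>\<close> by (simp add: powr_half_sqrt[symmetric] powr_powr mult.commute)
  have mult: "(2 * \<sigma>) powr - (1 / \<gamma>) = 2 powr - (1 / \<gamma>) * \<sigma> powr - (1 / \<gamma>)"
    using \<open>0 < \<sigma>\<close> by (simp add: powr_mult)
  show ?thesis
    unfolding ev_norm_def mult sqrt[symmetric] by (simp only: mult.assoc[symmetric] real_sqrt_mult)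
qed

text \<open>The exponents satisfy m - 1 - 1/(2\<alpha>) - 1/(2\<beta>) = (1/\<alpha> - 2)/2 +
  (1/\<beta> - 2)/2. The measure and the norms of the frame thus combine into the square roots of
  the two Laplace weights, with no power of \<sigma> left over.\<close>

lemma weight_w:
  assumes "0 < fst z"
  shows "weight (fst z) * w z = weight_const * (fst z powr ((1 / \<alpha> - 2) / 2) * fst z powr ((1 / \<beta> - 2) / 2))"
proof -
  have "m - 1 + - (1 / (2 * \<alpha>)) + - (1 / (2 * \<beta>)) = (1 / \<alpha> - 2) / 2 + (1 / \<beta> - 2) / 2"
    by (simp add: m_def diff_divide_distrib)
  then have "fst z powr (m - 1) * fst z powr - (1 / (2 * \<alpha>)) * fst z powr - (1 / (2 * \<beta>))
      = fst z powr ((1 / \<alpha> - 2) / 2) * fst z powr ((1 / \<beta> - 2) / 2)"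
    by (simp only: powr_add[symmetric])
  then show ?thesis
    using assms \<alpha> \<beta> by (simp add: weight_def w_def weight_const_def ev_norm_eq mult_ac)
qed

definition frame_const :: real where
  "frame_const = weight_const * sqrt (laplace_const \<alpha>) * sqrt (laplace_const \<beta>)"

lemma frame_const_nonneg: "0 \<le> frame_const"
  using weight_const_nonneg laplace_const_pos[OF \<alpha>] laplace_const_pos[OF \<beta>] by (simp add: frame_const_def)

lemma frame_bound:
  "(\<integral>\<^sup>+z. ennreal (norm (e z) * norm (d z) * (cmod (cinner f (e z)) * cmod (cinner (d z) g))) \<partial>V)
    \<le> ennreal (frame_const * norm f * norm g)"
proof -
  define P where "P z = (LINT x|lborel_pos. rep_l2 f x * ev_fun \<alpha> (pt z) x)" for z
  define Q where "Q z = (LINT y|lborel_pos. cnj (rep_l2 g y) * ev_fun \<beta> (pt z) y)" for z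
  have [measurable]: "P \<in> borel_measurable half_plane" "Q \<in> borel_measurable half_plane"
    unfolding P_def[abs_def] Q_def[abs_def] pt_def
    by (rule ev_fun_measurable_joint rep_l2_measurable measurable_cnj)+
  have "(\<integral>\<^sup>+z. ennreal (norm (e z) * norm (d z) * (cmod (cinner f (e z)) * cmod (cinner (d z) g))) \<partial>V)
      = (\<integral>\<^sup>+z. ennreal (w z * (cmod (P z) * cmod (Q z))) \<partial>V)"
    by (intro nn_integral_cong) (simp add: norm_ed cinner_e cinner_d P_def Q_def)
  also have "\<dots> = (\<integral>\<^sup>+z. ennreal (weight (fst z)) * ennreal (w z * (cmod (P z) * cmod (Q z))) \<partial>half_plane)"
    unfolding V_def by (rule nn_integral_density) measurable
  also have "\<dots> = (\<integral>\<^sup>+z. ennreal weight_const * ennreal ((fst z powr ((1 / \<alpha> - 2) / 2) * cmod (P z)) * (fst z powr ((1 / \<beta> - 2) / 2) * cmod (Q z))) \<partial>half_plane)"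
  proof (intro nn_integral_cong)
    fix z
    assume "z \<in> space half_plane"
    then have z: "0 < fst z"
      by (auto simp: space_pair_measure)
    have "weight (fst z) * (w z * (cmod (P z) * cmod (Q z)))
        = weight_const * ((fst z powr ((1 / \<alpha> - 2) / 2) * cmod (P z)) * (fst z powr ((1 / \<beta> - 2) / 2) * cmod (Q z)))"
      unfolding mult.assoc[of "weight _", symmetric] weight_w[OF z] by (simp add: mult_ac)
    then show "ennreal (weight (fst z)) * ennreal (w z * (cmod (P z) * cmod (Q z)))
        = ennreal weight_const * ennreal ((fst z powr ((1 / \<alpha> - 2) / 2) * cmod (P z)) * (fst z powr ((1 / \<beta> - 2) / 2) * cmod (Q z)))"
      by (simp only: ennreal_mult'[OF weight_nonneg, symmetric] ennreal_mult'[OF weight_const_nonneg, symmetric])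
  qed
  also have "\<dots> = ennreal weight_const * (\<integral>\<^sup>+z. ennreal ((fst z powr ((1 / \<alpha> - 2) / 2) * cmod (P z)) * (fst z powr ((1 / \<beta> - 2) / 2) * cmod (Q z))) \<partial>half_plane)"
    by (rule nn_integral_cmult) measurable
  also have "\<dots> \<le> ennreal weight_const * ennreal ((sqrt (laplace_const \<alpha>) * norm f) * (sqrt (laplace_const \<beta>) * norm g))"
  proof (intro mult_left_mono nn_integral_cauchy_schwarz)
    show "(\<integral>\<^sup>+z. ennreal ((fst z powr ((1 / \<alpha> - 2) / 2) * cmod (P z))\<^sup>2) \<partial>half_plane) \<le> ennreal ((sqrt (laplace_const \<alpha>) * norm f)\<^sup>2)"
      unfolding P_def by (rule laplace_bound_half_plane[OF \<alpha> square_integrable_rep nn_integral_rep_l2])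
    show "(\<integral>\<^sup>+z. ennreal ((fst z powr ((1 / \<beta> - 2) / 2) * cmod (Q z))\<^sup>2) \<partial>half_plane) \<le> ennreal ((sqrt (laplace_const \<beta>) * norm g)\<^sup>2)"
      unfolding Q_def using nn_integral_rep_l2[of g]
      by (intro laplace_bound_half_plane[OF \<beta> square_integrable_cnj[OF square_integrable_rep]]) simp
  qed (use laplace_const_pos[OF \<alpha>] laplace_const_pos[OF \<beta>] in auto)
  also have "\<dots> = ennreal (frame_const * norm f * norm g)"
    using weight_const_nonneg by (simp add: frame_const_def mult_ac flip: ennreal_mult')
  finally show ?thesis .
qed

sublocale averaging_frame V e d frame_const
proof (rule averaging_frame.intro)
  show "sigma_finite_measure V"
    by (rule sigma_finite_V)
  show "(\<lambda>z. norm (e z) * norm (d z)) \<in> borel_measurable V"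
    by (subst measurable_cong[OF norm_ed]) (simp_all add: measurable_cong_sets[OF sets_V refl])
qed (rule cinner_e_measurable cinner_d_measurable frame_bound frame_const_nonneg)+

section \<open>Superpositions of exponential kernels\<close>

definition E :: "real \<times> real \<Rightarrow> real \<times> real \<Rightarrow> complex" where
  "E z p = exp (- cnj (pt z) * of_real (s p))"

lemma E_eq: "E z p = ev_fun \<alpha> (cnj (pt z)) (fst p) * ev_fun \<beta> (cnj (pt z)) (snd p)"
  by (simp add: E_def ev_fun_def level_fun_def algebra_simps flip: exp_add)

lemma cnj_E: "cnj (E z p) = ev_fun \<alpha> (pt z) (fst p) * ev_fun \<beta> (pt z) (snd p)"
  by (simp add: E_eq cnj_ev_fun)

lemma cmod_E: "cmod (E z p) = exp (- fst z * s p)"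
  by (simp add: E_def pt_def)

lemma s_measurable [measurable]: "s \<in> borel_measurable quadrant"
  by (rule level_fun_measurable)

lemma E_measurable [measurable]: "(\<lambda>q. E (fst q) (snd q)) \<in> borel_measurable (V \<Otimes>\<^sub>M quadrant)"
proof -
  have [measurable]: "(\<lambda>q. fst (fst q)) \<in> borel_measurable (half_plane \<Otimes>\<^sub>M quadrant)"
    "(\<lambda>q. snd (fst q)) \<in> borel_measurable (half_plane \<Otimes>\<^sub>M quadrant)"
    "(\<lambda>q. s (snd q)) \<in> borel_measurable (half_plane \<Otimes>\<^sub>M quadrant)"
    by (rule measurable_compose[OF measurable_fst fst_measurable] measurable_compose[OF measurable_fst snd_measurable]
        measurable_compose[OF measurable_snd s_measurable])+
  have "(\<lambda>q. exp (- (of_real (fst (fst q)) - \<i> * of_real (snd (fst q))) * of_real (s (snd q)))) \<in> borel_measurable (half_plane \<Otimes>\<^sub>M quadrant)"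
    by measurable
  then have "(\<lambda>q. E (fst q) (snd q)) \<in> borel_measurable (half_plane \<Otimes>\<^sub>M quadrant)"
    by (simp add: E_def pt_def Complex_eq)
  then show ?thesis
    by (simp add: measurable_cong_sets[OF sets_pair_measure_cong[OF sets_V refl] refl])
qed

lemma E_measurable' [measurable]: "z \<in> space V \<Longrightarrow> E z \<in> borel_measurable quadrant"
  using measurable_compose[OF measurable_Pair1' E_measurable] by simp

lemma sq_ev:
  assumes "z \<in> space V"
  shows "square_integrable lborel_pos (ev_fun \<alpha> (pt z))" "square_integrable lborel_pos (ev_fun \<alpha> (cnj (pt z)))"
    "square_integrable lborel_pos (ev_fun \<beta> (pt z))" "square_integrable lborel_pos (ev_fun \<beta> (cnj (pt z)))"
  using assms \<alpha> \<beta> by (auto intro!: square_integrable_ev_fun simp: space_V pt_def)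

lemma nn_integral_E:
  assumes z: "z \<in> space V"
  shows "(\<integral>\<^sup>+p. ennreal ((cmod (E z p))\<^sup>2) \<partial>quadrant) = ennreal ((w z)\<^sup>2)"
proof -
  note [measurable] = ev_fun_measurable
  have "(\<integral>\<^sup>+p. ennreal ((cmod (E z p))\<^sup>2) \<partial>quadrant)
      = (\<integral>\<^sup>+x. \<integral>\<^sup>+y. ennreal ((cmod (E z (x, y)))\<^sup>2) \<partial>lborel_pos \<partial>lborel_pos)"
    using z by (intro lborel_pos.nn_integral_fst[symmetric]) measurable
  also have "\<dots> = (\<integral>\<^sup>+x. \<integral>\<^sup>+y. ennreal ((cmod (ev_fun \<alpha> (cnj (pt z)) x))\<^sup>2) * ennreal ((cmod (ev_fun \<beta> (cnj (pt z)) y))\<^sup>2) \<partial>lborel_pos \<partial>lborel_pos)"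
    by (simp add: E_eq norm_mult power_mult_distrib ennreal_mult')
  also have "\<dots> = ennreal ((ev_norm \<alpha> (fst z))\<^sup>2) * ennreal ((ev_norm \<beta> (fst z))\<^sup>2)"
    using z \<alpha> \<beta> by (simp add: nn_integral_cmult nn_integral_multc square_integrable_ev_fun(2) space_V pt_def)
  finally show ?thesis
    by (simp add: w_def power_mult_distrib flip: ennreal_mult')
qed

lemma square_integrable_E: "z \<in> space V \<Longrightarrow> square_integrable quadrant (E z)"
  by (subst square_integrable_iff_nn) (simp_all add: E_measurable' nn_integral_E)

lemma integrable_ev:
  assumes "z \<in> space V" "square_integrable lborel_pos f"
  shows "integrable lborel_pos (\<lambda>x. f x * ev_fun \<alpha> (pt z) x)" "integrable lborel_pos (\<lambda>x. f x * ev_fun \<alpha> (cnj (pt z)) x)"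
    "integrable lborel_pos (\<lambda>x. f x * ev_fun \<beta> (pt z) x)" "integrable lborel_pos (\<lambda>x. f x * ev_fun \<beta> (cnj (pt z)) x)"
  using square_integrable_mult_cnj[OF assms(2) sq_ev(2)[OF assms(1)]] square_integrable_mult_cnj[OF assms(2) sq_ev(1)[OF assms(1)]]
    square_integrable_mult_cnj[OF assms(2) sq_ev(4)[OF assms(1)]] square_integrable_mult_cnj[OF assms(2) sq_ev(3)[OF assms(1)]]
  by (simp_all add: cnj_ev_fun)

lemma cinner_e_d:
  assumes z: "z \<in> space V"
  shows "cinner f (e z) * cinner (d z) g = (LINT p|quadrant. rep_l2 f (fst p) * cnj (rep_l2 g (snd p)) * cnj (E z p))"
proof -
  have "(LINT p|quadrant. (rep_l2 f (fst p) * ev_fun \<alpha> (pt z) (fst p)) * (cnj (rep_l2 g (snd p)) * ev_fun \<beta> (pt z) (snd p)))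
      = cinner f (e z) * cinner (d z) g"
    unfolding cinner_e[OF z] cinner_d[OF z]
    using z by (intro lborel_pos2.integral_tensor integrable_ev square_integrable_cnj) auto
  then show ?thesis
    by (simp add: cnj_E mult_ac)
qed

lemma cinner_d_e:
  assumes z: "z \<in> space V"
  shows "cinner g (d z) * cinner (e z) f = (LINT p|quadrant. rep_l2 g (snd p) * cnj (rep_l2 f (fst p)) * E z p)"
proof -
  have "cinner g (d z) * cinner (e z) f = cnj (cinner f (e z) * cinner (d z) g)"
    using cinner_commute[of g "d z"] cinner_commute[of "e z" f] by (simp add: mult.commute)
  also have "\<dots> = (LINT p|quadrant. cnj (rep_l2 f (fst p) * cnj (rep_l2 g (snd p)) * cnj (E z p)))"
    unfolding cinner_e_d[OF z] by (rule Bochner_Integration.integral_cnj[symmetric])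
  finally show ?thesis
    by (simp add: mult_ac)
qed

text \<open>The symbol of the superposition of the kernels \<open>E z\<close> with coefficients h
  z.\<close>

definition Phi :: "(real \<times> real \<Rightarrow> complex) \<Rightarrow> real \<Rightarrow> complex" where
  "Phi h t = (LINT z|V. h z * exp (- cnj (pt z) * of_real t))"

lemma Phi_s: "Phi h (s p) = (LINT z|V. h z * E z p)"
  by (simp add: Phi_def E_def)

sublocale VQ: pair_sigma_finite V quadrant
  by (intro pair_sigma_finite.intro sigma_finite_V lborel_pos2.sigma_finite_measure_axioms)

context
  fixes h :: "real \<times> real \<Rightarrow> complex"
  assumes h: "h \<in> borel_measurable V" and fin: "(\<integral>\<^sup>+z. ennreal (w z * cmod (h z)) \<partial>V) < \<infinity>"
begin

lemma Phi_measurable: "Phi h \<in> borel_measurable borel"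
proof -
  have [measurable]: "(\<lambda>q. fst (snd q)) \<in> borel_measurable (borel \<Otimes>\<^sub>M half_plane)"
    "(\<lambda>q. snd (snd q)) \<in> borel_measurable (borel \<Otimes>\<^sub>M half_plane)"
    "(\<lambda>q. h (snd q)) \<in> borel_measurable (borel \<Otimes>\<^sub>M half_plane)"
    by (rule measurable_compose[OF measurable_snd fst_measurable] measurable_compose[OF measurable_snd snd_measurable]
        measurable_compose[OF measurable_snd] h[unfolded measurable_cong_sets[OF sets_V refl]])+
  have "(\<lambda>q. h (snd q) * exp (- (of_real (fst (snd q)) - \<i> * of_real (snd (snd q))) * of_real (fst q)))
      \<in> borel_measurable (borel \<Otimes>\<^sub>M half_plane)"
    by measurable
  then have "(\<lambda>(t, z). h z * exp (- cnj (pt z) * of_real t)) \<in> borel_measurable (borel \<Otimes>\<^sub>M V)"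
    by (simp add: pt_def Complex_eq split_beta measurable_cong_sets[OF sets_pair_measure_cong[OF refl sets_V] refl])
  then show ?thesis
    unfolding Phi_def[abs_def] by (rule VQ.M1.borel_measurable_lebesgue_integral)
qed

text \<open>Minkowski's integral inequality: w z is the L2 norm of \<open>E z\<close>, so the
  superposition converges absolutely in L2. It is proved by splitting |h E| into the square root of
  w |h| and the square root of |h|/w times |E|; the squares of both factors have total integral
  S.\<close>

lemma Phi_square_integrable: "square_integrable quadrant (\<lambda>p. Phi h (s p))"
proof (subst square_integrable_iff_nn)
  note [measurable] = h
  have w_meas[measurable]: "w \<in> borel_measurable V"
    by (simp add: measurable_cong_sets[OF sets_V refl])
  show "(\<lambda>p. Phi h (s p)) \<in> borel_measurable quadrant"
    by (rule measurable_compose[OF s_measurable Phi_measurable])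
  define S where "S = (\<integral>\<^sup>+z. ennreal (w z * cmod (h z)) \<partial>V)"
  have EV: "(\<lambda>z. E z p) \<in> borel_measurable V" if "p \<in> space quadrant" for p
    using measurable_compose[OF measurable_Pair2'[OF that] E_measurable] by simp
  have "(\<integral>\<^sup>+p. ennreal ((cmod (Phi h (s p)))\<^sup>2) \<partial>quadrant)
      \<le> (\<integral>\<^sup>+p. S * (\<integral>\<^sup>+z. ennreal (cmod (h z) / w z * (cmod (E z p))\<^sup>2) \<partial>V) \<partial>quadrant)"
  proof (intro nn_integral_mono)
    fix p
    assume p: "p \<in> space quadrant"
    note [measurable] = EV[OF p]
    have "ennreal ((cmod (Phi h (s p)))\<^sup>2) = (ennreal (cmod (Phi h (s p))))\<^sup>2"
      by (simp add: ennreal_power)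
    also have "\<dots> \<le> (\<integral>\<^sup>+z. ennreal (cmod (h z * E z p)) \<partial>V)\<^sup>2"
      unfolding Phi_s by (intro power_mono ennreal_norm_integral_le) simp
    also have "(\<integral>\<^sup>+z. ennreal (cmod (h z * E z p)) \<partial>V)
        = (\<integral>\<^sup>+z. ennreal (sqrt (w z * cmod (h z))) * ennreal (sqrt (cmod (h z) / w z) * cmod (E z p)) \<partial>V)"
    proof (intro nn_integral_cong)
      fix z
      assume "z \<in> space V"
      then have "sqrt (w z * cmod (h z)) * sqrt (cmod (h z) / w z) = cmod (h z)"
        using w_pos[of z] by (simp add: real_sqrt_mult[symmetric])
      then have "cmod (h z * E z p) = sqrt (w z * cmod (h z)) * (sqrt (cmod (h z) / w z) * cmod (E z p))"
        by (simp only: norm_mult mult.assoc[symmetric])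
      then show "ennreal (cmod (h z * E z p)) = ennreal (sqrt (w z * cmod (h z))) * ennreal (sqrt (cmod (h z) / w z) * cmod (E z p))"
        using w_pos[OF \<open>z \<in> space V\<close>] by (simp only: ennreal_mult'[OF real_sqrt_ge_zero[OF mult_nonneg_nonneg[OF less_imp_le norm_ge_zero]]])
    qed
    also have "\<dots>\<^sup>2 \<le> (\<integral>\<^sup>+z. (ennreal (sqrt (w z * cmod (h z))))\<^sup>2 \<partial>V) * (\<integral>\<^sup>+z. (ennreal (sqrt (cmod (h z) / w z) * cmod (E z p)))\<^sup>2 \<partial>V)"
      by (rule Cauchy_Schwarz_nn_integral) measurable
    also have "(\<integral>\<^sup>+z. (ennreal (sqrt (w z * cmod (h z))))\<^sup>2 \<partial>V) = S"
      unfolding S_def by (intro nn_integral_cong) (simp add: ennreal_power less_imp_le[OF w_pos])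
    also have "(\<integral>\<^sup>+z. (ennreal (sqrt (cmod (h z) / w z) * cmod (E z p)))\<^sup>2 \<partial>V) = (\<integral>\<^sup>+z. ennreal (cmod (h z) / w z * (cmod (E z p))\<^sup>2) \<partial>V)"
      by (intro nn_integral_cong) (simp add: ennreal_power power_mult_distrib less_imp_le[OF w_pos])
    finally show "ennreal ((cmod (Phi h (s p)))\<^sup>2) \<le> S * (\<integral>\<^sup>+z. ennreal (cmod (h z) / w z * (cmod (E z p))\<^sup>2) \<partial>V)" .
  qed
  also have "\<dots> = S * (\<integral>\<^sup>+p. \<integral>\<^sup>+z. ennreal (cmod (h z) / w z * (cmod (E z p))\<^sup>2) \<partial>V \<partial>quadrant)"
  proof (rule nn_integral_cmult)
    have "(\<lambda>(p, z). ennreal (cmod (h z) / w z * (cmod (E z p))\<^sup>2)) \<in> borel_measurable (quadrant \<Otimes>\<^sub>M V)"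
    proof -
      have [measurable]: "(\<lambda>q. E (snd q) (fst q)) \<in> borel_measurable (quadrant \<Otimes>\<^sub>M V)"
        using measurable_compose[OF measurable_Pair[OF measurable_snd measurable_fst] E_measurable] by simp
      show ?thesis
        unfolding split_beta by measurable
    qed
    then show "(\<lambda>p. \<integral>\<^sup>+z. ennreal (cmod (h z) / w z * (cmod (E z p))\<^sup>2) \<partial>V) \<in> borel_measurable quadrant"
      by (rule VQ.M1.borel_measurable_nn_integral)
  qed
  also have "(\<integral>\<^sup>+p. \<integral>\<^sup>+z. ennreal (cmod (h z) / w z * (cmod (E z p))\<^sup>2) \<partial>V \<partial>quadrant)
      = (\<integral>\<^sup>+z. \<integral>\<^sup>+p. ennreal (cmod (h z) / w z * (cmod (E z p))\<^sup>2) \<partial>quadrant \<partial>V)"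
  proof (rule VQ.Fubini')
    show "(\<lambda>(z, p). ennreal (cmod (h z) / w z * (cmod (E z p))\<^sup>2)) \<in> borel_measurable (V \<Otimes>\<^sub>M quadrant)"
      unfolding split_beta by measurable
  qed
  also have "\<dots> = S"
    unfolding S_def
  proof (intro nn_integral_cong)
    fix z
    assume z: "z \<in> space V"
    note [measurable] = E_measurable'[OF z]
    have nonneg: "0 \<le> cmod (h z) / w z"
      using less_imp_le[OF w_pos[OF z]] by simp
    have "(\<integral>\<^sup>+p. ennreal (cmod (h z) / w z * (cmod (E z p))\<^sup>2) \<partial>quadrant)
        = ennreal (cmod (h z) / w z) * (\<integral>\<^sup>+p. ennreal ((cmod (E z p))\<^sup>2) \<partial>quadrant)"
      unfolding ennreal_mult'[OF nonneg] by (rule nn_integral_cmult) measurable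
    also have "\<dots> = ennreal (cmod (h z) / w z * (w z)\<^sup>2)"
      by (simp only: nn_integral_E[OF z] ennreal_mult'[OF nonneg])
    also have "cmod (h z) / w z * (w z)\<^sup>2 = w z * cmod (h z)"
      using w_pos[OF z] by (simp add: power2_eq_square)
    finally show "(\<integral>\<^sup>+p. ennreal (cmod (h z) / w z * (cmod (E z p))\<^sup>2) \<partial>quadrant) = ennreal (w z * cmod (h z))" .
  qed
  also have "S * S < \<infinity>"
    using fin by (simp add: S_def ennreal_mult_less_top)
  finally show "(\<integral>\<^sup>+p. ennreal ((cmod (Phi h (s p)))\<^sup>2) \<partial>quadrant) < \<infinity>" .
qed

lemma
  assumes k: "square_integrable quadrant k"
  shows Phi_Fubini: "(LINT z|V. h z * (LINT p|quadrant. k p * E z p)) = (LINT p|quadrant. k p * Phi h (s p))"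
    and Phi_integrable: "integrable V (\<lambda>z. h z * (LINT p|quadrant. k p * E z p))"
proof -
  note [measurable] = h
  have k_meas[measurable]: "k \<in> borel_measurable quadrant"
    using k by (simp add: square_integrable_def)
  define A where "A = sqrt (LINT p|quadrant. (cmod (k p))\<^sup>2)"
  have A: "(\<integral>\<^sup>+p. ennreal ((cmod (k p))\<^sup>2) \<partial>quadrant) = ennreal (A\<^sup>2)" "0 \<le> A"
    by (simp_all add: nn_integral_square_integrable[OF k] A_def)
  have meas: "(\<lambda>q. h (fst q) * (k (snd q) * E (fst q) (snd q))) \<in> borel_measurable (V \<Otimes>\<^sub>M quadrant)"
    by measurable
  have int: "integrable (V \<Otimes>\<^sub>M quadrant) (\<lambda>q. h (fst q) * (k (snd q) * E (fst q) (snd q)))"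
  proof (rule integrableI_bounded[OF meas])
    have "(\<integral>\<^sup>+q. ennreal (cmod (h (fst q) * (k (snd q) * E (fst q) (snd q)))) \<partial>(V \<Otimes>\<^sub>M quadrant))
        = (\<integral>\<^sup>+z. \<integral>\<^sup>+p. ennreal (cmod (h z * (k p * E z p))) \<partial>quadrant \<partial>V)"
      by (subst lborel_pos2.nn_integral_fst[symmetric]) (use meas in simp_all)
    also have "\<dots> \<le> (\<integral>\<^sup>+z. ennreal A * ennreal (w z * cmod (h z)) \<partial>V)"
    proof (intro nn_integral_mono)
      fix z
      assume z: "z \<in> space V"
      note [measurable] = E_measurable'[OF z]
      have "(\<integral>\<^sup>+p. ennreal (cmod (h z * (k p * E z p))) \<partial>quadrant) = ennreal (cmod (h z)) * (\<integral>\<^sup>+p. ennreal (cmod (k p) * cmod (E z p)) \<partial>quadrant)"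
        by (subst nn_integral_cmult[symmetric]) (simp_all add: norm_mult ennreal_mult')
      also have "\<dots> \<le> ennreal (cmod (h z)) * ennreal (A * w z)"
        by (intro mult_left_mono nn_integral_cauchy_schwarz) (use A nn_integral_E[OF z] less_imp_le[OF w_pos[OF z]] in auto)
      also have "\<dots> = ennreal A * ennreal (w z * cmod (h z))"
        using A(2) by (simp add: mult_ac flip: ennreal_mult')
      finally show "(\<integral>\<^sup>+p. ennreal (cmod (h z * (k p * E z p))) \<partial>quadrant) \<le> ennreal A * ennreal (w z * cmod (h z))" .
    qed
    also have "\<dots> = ennreal A * (\<integral>\<^sup>+z. ennreal (w z * cmod (h z)) \<partial>V)"
      by (rule nn_integral_cmult) (simp add: measurable_cong_sets[OF sets_V refl] h[unfolded measurable_cong_sets[OF sets_V refl]])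
    also have "\<dots> < \<infinity>"
      using fin by (simp add: ennreal_mult_less_top)
    finally show "(\<integral>\<^sup>+q. ennreal (norm (h (fst q) * (k (snd q) * E (fst q) (snd q)))) \<partial>(V \<Otimes>\<^sub>M quadrant)) < \<infinity>" .
  qed
  show "integrable V (\<lambda>z. h z * (LINT p|quadrant. k p * E z p))"
    using VQ.integrable_fst'[OF int] by simp
  have "(LINT p|quadrant. LINT z|V. h z * (k p * E z p)) = (LINT z|V. LINT p|quadrant. h z * (k p * E z p))"
    by (rule VQ.Fubini_integral) (use int in \<open>simp add: split_beta'\<close>)
  moreover have "(LINT z|V. h z * (k p * E z p)) = k p * Phi h (s p)" for p
    by (simp add: Phi_s mult.left_commute[of _ "k p"])
  ultimately show "(LINT z|V. h z * (LINT p|quadrant. k p * E z p)) = (LINT p|quadrant. k p * Phi h (s p))"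
    by simp
qed

end

lemma distorted_kernel_eq: "distorted_kernel \<alpha> \<beta> \<phi> = (\<lambda>p. \<phi> (s p))"
  by (auto simp: distorted_kernel_def level_fun_def)

lemma hs_distorted_hankelI:
  "square_integrable quadrant (\<lambda>p. \<phi> (s p)) \<Longrightarrow> integral_op (\<lambda>p. \<phi> (s p)) \<in> hs_distorted_hankel \<alpha> \<beta>"
  unfolding hs_distorted_hankel_def distorted_hankel_def distorted_kernel_eq
  using integral_op_schatten by auto

lemma hs_distorted_hankelE:
  assumes "G \<in> hs_distorted_hankel \<alpha> \<beta>"
  obtains \<phi> where "square_integrable quadrant (\<lambda>p. \<phi> (s p))" "G = integral_op (\<lambda>p. \<phi> (s p))"
  using assms unfolding hs_distorted_hankel_def distorted_hankel_def distorted_kernel_eq by auto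

text \<open>For such T the symbol h satisfies the integrability condition of \<open>Phi\<close> by
  \<open>avg_Fubini\<close>, and Fubini's theorem moves the superposition from operators to kernels,
  all of which depend on s alone.\<close>

lemma avg_in_hs_distorted_hankel:
  assumes N: "sigma_finite_measure N" and rep: "integral_rep N u v T" and T: "T \<in> bounded_ops"
  shows "avg T \<in> hs_distorted_hankel \<alpha> \<beta>"
proof -
  define h where "h z = cinner (T (d z)) (e z)" for z
  have h: "h \<in> borel_measurable V"
    unfolding h_def[abs_def] by (subst cinner_commute) (intro measurable_cnj measurable_symbol T)
  have "(\<integral>\<^sup>+z. ennreal (w z * cmod (h z)) \<partial>V) = (\<integral>\<^sup>+z. ennreal (norm (e z) * norm (d z) * cmod (cinner (T (d z)) (e z))) \<partial>V)"
    by (intro nn_integral_cong) (simp add: norm_ed h_def)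
  then have fin: "(\<integral>\<^sup>+z. ennreal (w z * cmod (h z)) \<partial>V) < \<infinity>"
    using avg_Fubini(2)[OF N rep T] by simp
  note sq = Phi_square_integrable[OF h fin]
  have "avg T = integral_op (\<lambda>p. Phi h (s p))"
  proof (intro ext l2_eqI)
    fix g f
    have pair: "square_integrable quadrant (\<lambda>p. rep_l2 g (snd p) * cnj (rep_l2 f (fst p)))"
      by (rule square_integrable_pair)
    have "cinner (avg T g) f = (LINT z|V. cinner g (d z) * cinner (h z *\<^sub>C e z) f)"
      using avg_integral_rep[OF N rep T] by (simp add: integral_rep_def h_def)
    also have "\<dots> = (LINT z|V. h z * (LINT p|quadrant. rep_l2 g (snd p) * cnj (rep_l2 f (fst p)) * E z p))"
    proof (intro Bochner_Integration.integral_cong refl)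
      fix z
      assume "z \<in> space V"
      from cinner_d_e[OF this, of g f]
      show "cinner g (d z) * cinner (h z *\<^sub>C e z) f = h z * (LINT p|quadrant. rep_l2 g (snd p) * cnj (rep_l2 f (fst p)) * E z p)"
        by (simp add: cinner_scaleC_left mult.left_commute[of "cinner g (d z)"])
    qed
    also have "\<dots> = (LINT p|quadrant. rep_l2 g (snd p) * cnj (rep_l2 f (fst p)) * Phi h (s p))"
      by (rule Phi_Fubini[OF h fin pair])
    also have "\<dots> = cinner (integral_op (\<lambda>p. Phi h (s p)) g) f"
      unfolding cinner_integral_op(1)[OF sq] by (simp add: mult_ac)
    finally show "cinner (avg T g) f = cinner (integral_op (\<lambda>p. Phi h (s p)) g) f" .
  qed
  then show ?thesis
    using hs_distorted_hankelI[OF sq] by simp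
qed

section \<open>The inversion formula for cut-off symbols\<close>

lemma weight_integral:
  assumes t: "0 < t"
  shows "has_bochner_integral lborel_pos (\<lambda>\<sigma>. B * (2 * pi) * weight \<sigma> * t powr m * exp (- (2 * t) * \<sigma>)) 1"
proof (rule has_bochner_integral_nn_integral)
  show "(\<lambda>\<sigma>. B * (2 * pi) * weight \<sigma> * t powr m * exp (- (2 * t) * \<sigma>)) \<in> borel_measurable lborel_pos"
    by (rule borel_measurable_lborel_pos) measurable
  show "AE \<sigma> in lborel_pos. 0 \<le> B * (2 * pi) * weight \<sigma> * t powr m * exp (- (2 * t) * \<sigma>)"
    using B_pos weight_nonneg by (intro AE_I2) simp
  have \<Gamma>: "0 < Gamma m"
    using m_gt_1 by (simp add: Gamma_real_pos)
  define c where "c = 2 powr m / Gamma m * t powr m"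
  have c: "0 \<le> c"
    using \<Gamma> by (simp add: c_def)
  have "B * (2 * pi) * weight \<sigma> * t powr m * exp (- (2 * t) * \<sigma>) = c * (\<sigma> powr (m - 1) * exp (- (2 * t) * \<sigma>))" for \<sigma>
    using B_pos \<Gamma> by (simp add: weight_def c_def)
  then have "(\<integral>\<^sup>+\<sigma>. ennreal (B * (2 * pi) * weight \<sigma> * t powr m * exp (- (2 * t) * \<sigma>)) \<partial>lborel_pos)
      = (\<integral>\<^sup>+\<sigma>. ennreal c * ennreal (\<sigma> powr (m - 1) * exp (- (2 * t) * \<sigma>)) \<partial>lborel_pos)"
    by (simp only: ennreal_mult'[OF c])
  also have "\<dots> = ennreal c * ennreal (Gamma m * (2 * t) powr - m)"
  proof -
    have "(\<lambda>\<sigma>. ennreal (\<sigma> powr (m - 1) * exp (- (2 * t) * \<sigma>))) \<in> borel_measurable lborel_pos"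
      by (rule borel_measurable_lborel_pos) measurable
    then show ?thesis
      using nn_integral_Gamma[of m "2 * t"] m_gt_1 t by (simp add: nn_integral_cmult)
  qed
  also have "\<dots> = ennreal (c * (Gamma m * (2 * t) powr - m))"
    by (simp only: ennreal_mult'[OF c])
  also have "c * (Gamma m * (2 * t) powr - m) = 1"
  proof -
    have "2 powr m > 0" "t powr m > 0"
      using t by simp_all
    then show ?thesis
      using \<Gamma> t by (simp add: c_def powr_mult powr_minus field_simps)
  qed
  finally show "(\<integral>\<^sup>+\<sigma>. ennreal (B * (2 * pi) * weight \<sigma> * t powr m * exp (- (2 * t) * \<sigma>)) \<partial>lborel_pos) = ennreal 1" .
qed simp

text \<open>Up to the factor \<open>B\<close>, the Fourier transform of \<open>omega q \<sigma>\<close> is the pairing of the cut-off symbol with \<open>E (\<sigma>, \<tau>)\<close>.\<close>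

definition omega :: "real \<Rightarrow> real \<Rightarrow> real \<Rightarrow> complex" where
  "omega q \<sigma> t = of_real (indicator {0<..} t * t powr m * (indicator {..q} t * exp (- t)) * exp (- \<sigma> * t))"

lemma omega_measurable [measurable]: "omega q \<sigma> \<in> borel_measurable borel"
  unfolding omega_def[abs_def] by measurable

lemma omega_le:
  assumes "0 < \<sigma>"
  shows "cmod (omega q \<sigma> t) \<le> \<bar>q\<bar> powr m * indicator {0..q} t"
proof (cases "0 < t \<and> t \<le> q")
  case True
  have "t powr m * (exp (- t) * exp (- \<sigma> * t)) \<le> q powr m * (1 * 1)"
    using True assms m_gt_1 by (intro mult_mono powr_mono2) auto
  then show ?thesis
    using True by (simp add: omega_def norm_mult mult.assoc)
next
  case False
  then show ?thesis
    by (auto simp: omega_def)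
qed

lemma omega_bounded: "0 < \<sigma> \<Longrightarrow> cmod (omega q \<sigma> t) \<le> \<bar>q\<bar> powr m"
  by (rule order_trans[OF omega_le]) (auto simp: indicator_def)

lemma omega_integrable:
  assumes "0 < \<sigma>"
  shows "integrable lborel (omega q \<sigma>)"
proof (rule Bochner_Integration.integrable_bound)
  show "integrable lborel (\<lambda>t. \<bar>q\<bar> powr m * indicator {0..q} t)"
    by (intro integrable_mult_right integrable_real_indicator) (simp_all add: emeasure_lborel_Icc_eq)
  show "AE t in lborel. norm (omega q \<sigma> t) \<le> norm (\<bar>q\<bar> powr m * indicator {0..q} t)"
    using omega_le[OF assms] by (intro AE_I2) simp
qed simp

lemma isCont_omega:
  assumes "0 < t" "t \<noteq> q"
  shows "isCont (omega q \<sigma>) t"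
proof (cases "t < q")
  case True
  have "eventually (\<lambda>x. x \<in> {0<..<q}) (nhds t)"
    using assms True by (intro eventually_nhds_in_open) auto
  then have "eventually (\<lambda>x. omega q \<sigma> x = of_real (x powr m * exp (- x) * exp (- \<sigma> * x))) (nhds t)"
    by eventually_elim (simp add: omega_def)
  moreover have "isCont (\<lambda>x. complex_of_real (x powr m * exp (- x) * exp (- \<sigma> * x))) t"
    using assms by (intro continuous_intros) auto
  ultimately show ?thesis
    by (rule isCont_cong[THEN iffD2])
next
  case False
  have "eventually (\<lambda>x. x \<in> {q<..}) (nhds t)"
    using assms False by (intro eventually_nhds_in_open) auto
  then have "eventually (\<lambda>x. omega q \<sigma> x = 0) (nhds t)"
    by eventually_elim (simp add: omega_def)
  moreover have "isCont (\<lambda>x. 0 :: complex) t"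
    by simp
  ultimately show ?thesis
    by (rule isCont_cong[THEN iffD2])
qed

text \<open>The law of \<open>s\<close> has a density, so the one level at which a cut-off jumps is
  negligible.\<close>

lemma AE_level_neq: "AE p in quadrant. s p \<noteq> q"
proof -
  have "AE t in distr quadrant borel s. t \<noteq> q"
    unfolding distr_level_fun[OF \<alpha> \<beta>]
    by (subst AE_density) (auto intro: eventually_mono[OF AE_lborel_singleton[of q]])
  then show ?thesis
    by (subst (asm) AE_distr_iff) auto
qed

lemma square_integrable_cutoff:
  "square_integrable quadrant (\<lambda>p. complex_of_real (indicator {..q} (s p) * exp (- s p)))"
proof (subst square_integrable_iff_nn)
  have unit: "(1, 0) \<in> space V"
    by (simp add: space_V)
  have "(\<integral>\<^sup>+p. ennreal ((cmod (complex_of_real (indicator {..q} (s p) * exp (- s p))))\<^sup>2) \<partial>quadrant)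
      \<le> (\<integral>\<^sup>+p. ennreal ((cmod (E (1, 0) p))\<^sup>2) \<partial>quadrant)"
    by (intro nn_integral_mono ennreal_leI power_mono) (auto simp: cmod_E indicator_def)
  also have "\<dots> < \<infinity>"
    by (simp add: nn_integral_E[OF unit])
  finally show "(\<integral>\<^sup>+p. ennreal ((cmod (complex_of_real (indicator {..q} (s p) * exp (- s p))))\<^sup>2) \<partial>quadrant) < \<infinity>" .
qed measurable

lemma square_integrable_tensor: "square_integrable quadrant (\<lambda>p. rep_l2 f (fst p) * cnj (rep_l2 g (snd p)))"
  using square_integrable_cnj[OF square_integrable_pair[of g f]] by (simp add: mult.commute)

lemma frame_product_measurable: "(\<lambda>z. cinner f (e z) * cinner (d z) g) \<in> borel_measurable V"
  by (intro borel_measurable_times cinner_e_measurable measurable_d')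

lemma frame_product_finite: "(\<integral>\<^sup>+z. ennreal (w z * cmod (cinner f (e z) * cinner (d z) g)) \<partial>V) < \<infinity>"
proof -
  have "(\<integral>\<^sup>+z. ennreal (w z * cmod (cinner f (e z) * cinner (d z) g)) \<partial>V)
      = (\<integral>\<^sup>+z. ennreal (norm (e z) * norm (d z) * (cmod (cinner f (e z)) * cmod (cinner (d z) g))) \<partial>V)"
    by (intro nn_integral_cong) (simp add: norm_ed norm_mult)
  then show ?thesis
    using frame_bound[of f g] by (simp add: le_less_trans)
qed

text \<open>For fixed \<sigma>, H is the Fourier transform in \<tau> of k exp(-\<sigma> s) over the
  quadrant with phase s, and K is B times that of \<open>omega q \<sigma>\<close> on the line.
  Parseval evaluates omega at the level of each point, and what remains depends on \<sigma> through
  a density of total mass one. Hence k and \<open>Phi H\<close> have the same integral against every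
  cut-off.\<close>

lemma inversion_level:
  fixes f g :: l2 and q :: real
  defines "H \<equiv> \<lambda>z. cinner f (e z) * cinner (d z) g"
    and "k \<equiv> \<lambda>p. rep_l2 f (fst p) * cnj (rep_l2 g (snd p))"
    and "\<kappa> \<equiv> \<lambda>p. complex_of_real (indicator {..q} (s p) * exp (- s p))"
  shows "(LINT p|quadrant. \<kappa> p * Phi H (s p)) = (LINT p|quadrant. \<kappa> p * k p)"
proof -
  have H_meas: "H \<in> borel_measurable V"
    unfolding H_def by (rule frame_product_measurable)
  have fin: "(\<integral>\<^sup>+z. ennreal (w z * cmod (H z)) \<partial>V) < \<infinity>"
    unfolding H_def by (rule frame_product_finite)
  have k_sq: "square_integrable quadrant k"
    unfolding k_def by (rule square_integrable_tensor)
  have \<kappa>_sq: "square_integrable quadrant \<kappa>"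
    unfolding \<kappa>_def by (rule square_integrable_cutoff)
  have [measurable]: "k \<in> borel_measurable quadrant" "\<kappa> \<in> borel_measurable quadrant"
    using k_sq \<kappa>_sq by (simp_all add: square_integrable_def)
  define K where "K z = (LINT p|quadrant. \<kappa> p * E z p)" for z
  have K_eq: "K (\<sigma>, \<tau>) = of_real B * (LINT t|lborel. omega q \<sigma> t * iexp (\<tau> * t))" for \<sigma> \<tau>
  proof -
    define G where "G t = complex_of_real (indicator {..q} t * exp (- t)) * exp (- cnj (pt (\<sigma>, \<tau>)) * of_real t)" for t
    have [measurable]: "G \<in> borel_measurable borel"
      unfolding G_def[abs_def] by measurable
    have "K (\<sigma>, \<tau>) = (LINT p|quadrant. G (s p))"
      by (simp add: K_def G_def \<kappa>_def E_def)
    also have "\<dots> = (LINT t|lborel. (B * (indicator {0<..} t * t powr (1 / \<alpha> + 1 / \<beta> - 1))) *\<^sub>R G t)"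
      by (rule integral_level_fun[OF \<alpha> \<beta>]) measurable
    also have "\<dots> = (LINT t|lborel. of_real B * (omega q \<sigma> t * iexp (\<tau> * t)))"
    proof (intro Bochner_Integration.integral_cong refl)
      fix t
      have "- cnj (pt (\<sigma>, \<tau>)) * of_real t = of_real (- \<sigma> * t) + \<i> * of_real (\<tau> * t)"
        by (simp add: pt_def complex_eq_iff)
      then have "exp (- cnj (pt (\<sigma>, \<tau>)) * of_real t) = of_real (exp (- \<sigma> * t)) * iexp (\<tau> * t)"
        by (simp only: exp_add exp_of_real)
      then show "(B * (indicator {0<..} t * t powr (1 / \<alpha> + 1 / \<beta> - 1))) *\<^sub>R G t = of_real B * (omega q \<sigma> t * iexp (\<tau> * t))"
        by (simp only: G_def omega_def scaleR_conv_of_real of_real_mult mult.assoc m_def)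
    qed
    finally show ?thesis
      by (simp only: integral_mult_right_zero)
  qed
  have HK_int: "integrable V (\<lambda>z. H z * K z)"
    unfolding K_def by (rule Phi_integrable[OF H_meas fin \<kappa>_sq])
  have HK_meas: "(\<lambda>z. H z * K z) \<in> borel_measurable half_plane"
    using borel_measurable_integrable[OF HK_int] by (simp add: measurable_cong_sets[OF sets_V refl])
  have HK_int': "integrable half_plane (\<lambda>z. weight (fst z) *\<^sub>R (H z * K z))"
    using HK_int unfolding V_def by (subst (asm) integrable_density[OF HK_meas]) (simp_all add: weight_nonneg)
  interpret PL: pair_sigma_finite lborel_pos lborel ..
  interpret PQ: pair_sigma_finite lborel_pos quadrant
    by (intro pair_sigma_finite.intro lborel_pos.sigma_finite_measure_axioms lborel_pos2.sigma_finite_measure_axioms)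
  interpret QP: pair_sigma_finite quadrant lborel_pos
    by (intro pair_sigma_finite.intro lborel_pos.sigma_finite_measure_axioms lborel_pos2.sigma_finite_measure_axioms)
  \<comment> \<open>What Parseval produces at height \<sigma>: one factor exp(-\<sigma> s) comes
    from H and one from omega, and s^m comes from the density of the levels. The prefactor is the
    one normalised in \<open>weight_integral\<close>.\<close>
  define F where "F \<sigma> p = of_real (B * (2 * pi) * weight \<sigma> * s p powr m * exp (- (2 * s p) * \<sigma>)) * (\<kappa> p * k p)" for \<sigma> p
  have F_meas: "(\<lambda>q. F (fst q) (snd q)) \<in> borel_measurable (lborel_pos \<Otimes>\<^sub>M quadrant)"
    and F_meas': "(\<lambda>q. F (snd q) (fst q)) \<in> borel_measurable (quadrant \<Otimes>\<^sub>M lborel_pos)"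
  proof -
    have [measurable]: "(\<lambda>q. fst q) \<in> borel_measurable (lborel_pos \<Otimes>\<^sub>M quadrant)"
      by (rule measurable_compose[OF measurable_fst borel_measurable_lborel_pos]) simp
    have [measurable]: "(\<lambda>q. snd q) \<in> borel_measurable (quadrant \<Otimes>\<^sub>M lborel_pos)"
      by (rule measurable_compose[OF measurable_snd borel_measurable_lborel_pos]) simp
    show "(\<lambda>q. F (fst q) (snd q)) \<in> borel_measurable (lborel_pos \<Otimes>\<^sub>M quadrant)"
      unfolding F_def by measurable
    show "(\<lambda>q. F (snd q) (fst q)) \<in> borel_measurable (quadrant \<Otimes>\<^sub>M lborel_pos)"
      unfolding F_def by measurable
  qed
  \<comment> \<open>Parseval requires integrability in \<tau>. It is a premise here, because
    Fubini's theorem grants it only for almost every \<sigma>.\<close>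
  have slice: "(LINT \<tau>|lborel. weight \<sigma> *\<^sub>R (H (\<sigma>, \<tau>) * K (\<sigma>, \<tau>))) = (LINT p|quadrant. F \<sigma> p)"
    if \<sigma>: "0 < \<sigma>" and int: "integrable lborel (\<lambda>\<tau>. weight \<sigma> *\<^sub>R (H (\<sigma>, \<tau>) * K (\<sigma>, \<tau>)))" for \<sigma>
  proof -
    define k\<^sub>\<sigma> where "k\<^sub>\<sigma> p = k p * of_real (exp (- \<sigma> * s p))" for p
    have H_eq: "H (\<sigma>, \<tau>) = (LINT p|quadrant. k\<^sub>\<sigma> p * iexp (- (\<tau> * s p)))" for \<tau>
    proof -
      have "cnj (E (\<sigma>, \<tau>) p) = of_real (exp (- \<sigma> * s p)) * iexp (- (\<tau> * s p))" for p
      proof -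
        have "- pt (\<sigma>, \<tau>) * of_real (s p) = of_real (- \<sigma> * s p) + \<i> * of_real (- (\<tau> * s p))"
          by (simp add: pt_def complex_eq_iff)
        moreover have "cnj (E (\<sigma>, \<tau>) p) = exp (- pt (\<sigma>, \<tau>) * of_real (s p))"
          by (simp add: E_def exp_cnj)
        ultimately show ?thesis
          by (simp only: exp_add exp_of_real)
      qed
      then show ?thesis
        unfolding H_def using \<sigma> by (subst cinner_e_d) (simp_all add: space_V k\<^sub>\<sigma>_def k_def mult.assoc)
    qed
    have "integrable quadrant (\<lambda>p. k p * cnj (E (\<sigma>, 0) p))"
      using \<sigma> by (intro square_integrable_mult_cnj k_sq square_integrable_E) (simp add: space_V)
    also have "(\<lambda>p. k p * cnj (E (\<sigma>, 0) p)) = k\<^sub>\<sigma>"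
    proof
      fix p
      have "cnj (E (\<sigma>, 0) p) = exp (of_real (- \<sigma> * s p))"
        by (simp add: E_def exp_cnj pt_def Complex_eq)
      then show "k p * cnj (E (\<sigma>, 0) p) = k\<^sub>\<sigma> p"
        by (simp only: k\<^sub>\<sigma>_def exp_of_real)
    qed
    finally have k\<^sub>\<sigma>: "integrable quadrant k\<^sub>\<sigma>" .
    have HK: "weight \<sigma> *\<^sub>R (H (\<sigma>, \<tau>) * K (\<sigma>, \<tau>))
        = of_real (B * weight \<sigma>) * ((LINT p|quadrant. k\<^sub>\<sigma> p * iexp (- (\<tau> * s p))) * (LINT t|lborel. omega q \<sigma> t * iexp (\<tau> * t)))" for \<tau>
      unfolding H_eq K_eq by (simp add: scaleR_conv_of_real mult_ac)
    have c: "complex_of_real (B * weight \<sigma>) \<noteq> 0"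
      using B_pos weight_pos[OF \<sigma>] by simp
    have int': "integrable lborel (\<lambda>\<tau>. (LINT p|quadrant. k\<^sub>\<sigma> p * iexp (- (\<tau> * s p))) * (LINT t|lborel. omega q \<sigma> t * iexp (\<tau> * t)))"
      using integrable_mult_right[OF int[unfolded HK], of "inverse (of_real (B * weight \<sigma>))"]
      by (simp only: mult.assoc[symmetric] left_inverse[OF c] mult_1_left)
    have cont: "AE p in quadrant. isCont (omega q \<sigma>) (s p)"
      using AE_level_neq[of q] by (rule AE_mp) (intro AE_I2 impI isCont_omega s_pos)
    have "(LINT \<tau>|lborel. weight \<sigma> *\<^sub>R (H (\<sigma>, \<tau>) * K (\<sigma>, \<tau>)))
        = of_real (B * weight \<sigma>) * (of_real (2 * pi) * (LINT p|quadrant. k\<^sub>\<sigma> p * omega q \<sigma> (s p)))"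
      unfolding HK integral_mult_right_zero
      by (subst parseval_polarized[OF lborel_pos2.sigma_finite_measure_axioms k\<^sub>\<sigma> s_measurable omega_integrable[OF \<sigma>] omega_bounded[OF \<sigma>] cont int']) simp
    also have "\<dots> = (LINT p|quadrant. of_real (B * weight \<sigma>) * (of_real (2 * pi) * (k\<^sub>\<sigma> p * omega q \<sigma> (s p))))"
      by (simp only: integral_mult_right_zero)
    also have "\<dots> = (LINT p|quadrant. F \<sigma> p)"
    proof (intro Bochner_Integration.integral_cong refl)
      fix p
      assume "p \<in> space quadrant"
      then have "0 < s p"
        by (rule s_pos)
      have "exp (- (2 * s p) * \<sigma>) = exp (- \<sigma> * s p) * exp (- \<sigma> * s p)"
        by (simp flip: exp_add)
      then have "F \<sigma> p = of_real (B * (2 * pi) * weight \<sigma> * s p powr m * (exp (- \<sigma> * s p) * exp (- \<sigma> * s p))) * (\<kappa> p * k p)"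
        by (simp only: F_def)
      then show "of_real (B * weight \<sigma>) * (of_real (2 * pi) * (k\<^sub>\<sigma> p * omega q \<sigma> (s p))) = F \<sigma> p"
        using \<open>0 < s p\<close> by (simp add: k\<^sub>\<sigma>_def omega_def \<kappa>_def mult_ac)
    qed
    finally show ?thesis .
  qed
  have norm_F: "has_bochner_integral lborel_pos (\<lambda>\<sigma>. norm (F \<sigma> p)) (cmod (\<kappa> p * k p))"
    and F_int: "has_bochner_integral lborel_pos (\<lambda>\<sigma>. F \<sigma> p) (\<kappa> p * k p)" if "p \<in> space quadrant" for p
  proof -
    note unit = weight_integral[OF s_pos[OF that]]
    have "has_bochner_integral lborel_pos (\<lambda>\<sigma>. B * (2 * pi) * weight \<sigma> * s p powr m * exp (- (2 * s p) * \<sigma>) * cmod (\<kappa> p * k p)) (1 * cmod (\<kappa> p * k p))"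
      by (rule has_bochner_integral_mult_left) (use unit in simp)
    moreover have "norm (F \<sigma> p) = B * (2 * pi) * weight \<sigma> * s p powr m * exp (- (2 * s p) * \<sigma>) * cmod (\<kappa> p * k p)" for \<sigma>
      using B_pos weight_nonneg[of \<sigma>] by (simp add: F_def norm_mult)
    ultimately show "has_bochner_integral lborel_pos (\<lambda>\<sigma>. norm (F \<sigma> p)) (cmod (\<kappa> p * k p))"
      by simp
    have "has_bochner_integral lborel_pos (\<lambda>\<sigma>. complex_of_real (B * (2 * pi) * weight \<sigma> * s p powr m * exp (- (2 * s p) * \<sigma>)) * (\<kappa> p * k p)) (of_real 1 * (\<kappa> p * k p))"
      by (intro has_bochner_integral_mult_left has_bochner_integral_of_real unit)
    then show "has_bochner_integral lborel_pos (\<lambda>\<sigma>. F \<sigma> p) (\<kappa> p * k p)"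
      by (simp add: F_def)
  qed
  have \<kappa>k: "integrable quadrant (\<lambda>p. \<kappa> p * k p)"
    using square_integrable_mult_cnj[OF k_sq square_integrable_cnj[OF \<kappa>_sq]] by (simp add: mult.commute)
  \<comment> \<open>The weight is nonnegative with mass one, so the integral of |F| over \<sigma> is
    just |\<kappa> k|, an integrable function on the quadrant.\<close>
  have F_Fubini: "integrable (quadrant \<Otimes>\<^sub>M lborel_pos) (\<lambda>q. F (snd q) (fst q))"
  proof (rule QP.Fubini_integrable[OF F_meas'])
    have "integrable quadrant (\<lambda>p. cmod (\<kappa> p * k p))"
      using \<kappa>k by (rule integrable_norm)
    also have "integrable quadrant (\<lambda>p. cmod (\<kappa> p * k p)) \<longleftrightarrow> integrable quadrant (\<lambda>p. LINT \<sigma>|lborel_pos. norm (F (snd (p, \<sigma>)) (fst (p, \<sigma>))))"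
      by (intro Bochner_Integration.integrable_cong refl)
         (simp only: fst_conv snd_conv has_bochner_integral_integral_eq[OF norm_F])
    finally show "integrable quadrant (\<lambda>p. LINT \<sigma>|lborel_pos. norm (F (snd (p, \<sigma>)) (fst (p, \<sigma>))))" .
    show "AE p in quadrant. integrable lborel_pos (\<lambda>\<sigma>. F (snd (p, \<sigma>)) (fst (p, \<sigma>)))"
      using F_int by (intro AE_I2) (simp add: has_bochner_integral_iff)
  qed
  have "(LINT p|quadrant. \<kappa> p * Phi H (s p)) = (LINT z|V. H z * K z)"
    unfolding K_def by (rule Phi_Fubini[OF H_meas fin \<kappa>_sq, symmetric])
  also have "\<dots> = (LINT z|half_plane. weight (fst z) *\<^sub>R (H z * K z))"
    unfolding V_def by (rule integral_density[OF HK_meas]) (simp_all add: weight_nonneg)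
  also have "\<dots> = (LINT \<sigma>|lborel_pos. LINT \<tau>|lborel. weight \<sigma> *\<^sub>R (H (\<sigma>, \<tau>) * K (\<sigma>, \<tau>)))"
    using PL.integral_fst'[OF HK_int'] by simp
  also have "\<dots> = (LINT \<sigma>|lborel_pos. LINT p|quadrant. F \<sigma> p)"
  proof (rule integral_cong_AE)
    show "(\<lambda>\<sigma>. LINT \<tau>|lborel. weight \<sigma> *\<^sub>R (H (\<sigma>, \<tau>) * K (\<sigma>, \<tau>))) \<in> borel_measurable lborel_pos"
      using borel_measurable_integrable[OF PL.integrable_fst'[OF HK_int']] by simp
    show "(\<lambda>\<sigma>. LINT p|quadrant. F \<sigma> p) \<in> borel_measurable lborel_pos"
      by (rule lborel_pos2.borel_measurable_lebesgue_integral) (use F_meas in \<open>simp add: split_beta'\<close>)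
    show "AE \<sigma> in lborel_pos. (LINT \<tau>|lborel. weight \<sigma> *\<^sub>R (H (\<sigma>, \<tau>) * K (\<sigma>, \<tau>))) = (LINT p|quadrant. F \<sigma> p)"
      using PL.AE_integrable_fst'[OF HK_int'] by (rule AE_mp) (intro AE_I2 impI slice, simp_all)
  qed
  also have "\<dots> = (LINT p|quadrant. LINT \<sigma>|lborel_pos. F \<sigma> p)"
    by (rule QP.Fubini_integral) (use F_Fubini in \<open>simp add: split_beta'\<close>)
  also have "\<dots> = (LINT p|quadrant. \<kappa> p * k p)"
    by (intro Bochner_Integration.integral_cong refl has_bochner_integral_integral_eq F_int)
  finally show ?thesis .
qed

end

text \<open>\<open>cinner_integral_op\<close> speaks of chosen representatives. The symbol of a
  distorted Hankel operator needs the explicit exponentials, which agree with them almost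
  everywhere.\<close>

lemma cinner_integral_op_abs:
  assumes k: "square_integrable quadrant k"
    and f: "square_integrable lborel_pos f" and g: "square_integrable lborel_pos g"
  shows "cinner (integral_op k (abs_l2 f)) (abs_l2 g) = (LINT p|quadrant. k p * f (snd p) * cnj (g (fst p)))"
  unfolding cinner_integral_op(1)[OF k]
proof (rule integral_cong_AE)
  have [measurable]: "k \<in> borel_measurable quadrant" "f \<in> borel_measurable lborel_pos" "g \<in> borel_measurable lborel_pos"
    using k f g by (simp_all add: square_integrable_def)
  show "(\<lambda>p. k p * rep_l2 (abs_l2 f) (snd p) * cnj (rep_l2 (abs_l2 g) (fst p))) \<in> borel_measurable quadrant"
    "(\<lambda>p. k p * f (snd p) * cnj (g (fst p))) \<in> borel_measurable quadrant"
    by measurable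
  have "AE p in quadrant. rep_l2 (abs_l2 f) (snd p) = f (snd p) \<and> rep_l2 (abs_l2 g) (fst p) = g (fst p)"
  proof (rule lborel_pos2.AE_pair_measure)
    show "{p \<in> space quadrant. rep_l2 (abs_l2 f) (snd p) = f (snd p) \<and> rep_l2 (abs_l2 g) (fst p) = g (fst p)} \<in> sets quadrant"
      by measurable
    show "AE x in lborel_pos. AE y in lborel_pos. rep_l2 (abs_l2 f) (snd (x, y)) = f (snd (x, y)) \<and> rep_l2 (abs_l2 g) (fst (x, y)) = g (fst (x, y))"
      using rep_abs_l2[OF g] by eventually_elim (use rep_abs_l2[OF f] in \<open>simp add: eventually_mono\<close>)
  qed
  then show "AE p in quadrant. k p * rep_l2 (abs_l2 f) (snd p) * cnj (rep_l2 (abs_l2 g) (fst p)) = k p * f (snd p) * cnj (g (fst p))"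
    by eventually_elim simp
qed

section \<open>Closure properties of the compact operators\<close>

lemma compact_ops_bounded: "T \<in> compact_ops \<Longrightarrow> T \<in> bounded_ops"
  by (simp add: compact_ops_def)

lemma compact_ops_zero: "(\<lambda>f. 0) \<in> compact_ops"
proof (rule compact_opsI[OF bounded_ops_zero])
  fix \<epsilon> :: real
  assume "\<epsilon> > 0"
  then show "\<exists>K\<in>bounded_ops. \<exists>n. rank_at_most n K \<and> onorm (\<lambda>f. 0 - K f) \<le> \<epsilon>"
    using bounded_ops_zero rank_at_most_zero[of 0]
    by (intro bexI[of _ "\<lambda>f. 0"] exI[of _ 0]) (simp_all add: onorm_zero)
qed

lemma compact_ops_add:
  assumes S: "S \<in> compact_ops" and T: "T \<in> compact_ops"
  shows "(\<lambda>f. S f + T f) \<in> compact_ops"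
proof (rule compact_opsI[OF bounded_ops_plus[OF compact_ops_bounded[OF S] compact_ops_bounded[OF T]]])
  fix \<epsilon> :: real
  assume "\<epsilon> > 0"
  then have "\<epsilon> / 2 > 0"
    by simp
  from compact_ops_approx[OF S this] obtain K n where K: "K \<in> bounded_ops" "rank_at_most n K" "onorm (\<lambda>f. S f - K f) \<le> \<epsilon> / 2"
    by (elim bexE exE conjE)
  from compact_ops_approx[OF T \<open>\<epsilon> / 2 > 0\<close>] obtain L k where L: "L \<in> bounded_ops" "rank_at_most k L" "onorm (\<lambda>f. T f - L f) \<le> \<epsilon> / 2"
    by (elim bexE exE conjE)
  have "onorm (\<lambda>f. (S f - K f) + (T f - L f)) \<le> \<epsilon>"
    using K(3) L(3)
    by (intro onorm_triangle_le bounded_ops_linear[OF bounded_ops_minus] compact_ops_bounded S T K(1) L(1)) simp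
  then have "onorm (\<lambda>f. (S f + T f) - (K f + L f)) \<le> \<epsilon>"
    by (simp add: algebra_simps)
  then show "\<exists>K\<in>bounded_ops. \<exists>n. rank_at_most n K \<and> onorm (\<lambda>f. (S f + T f) - K f) \<le> \<epsilon>"
    using bounded_ops_plus[OF K(1) L(1)] rank_at_most_add[OF K(2) L(2)]
    by (intro bexI[of _ "\<lambda>f. K f + L f"] exI[of _ "n + k"] conjI)
qed

lemma compact_ops_limit:
  assumes T: "T \<in> bounded_ops" and approx: "\<And>\<epsilon>. \<epsilon> > 0 \<Longrightarrow> \<exists>S\<in>compact_ops. onorm (\<lambda>f. T f - S f) \<le> \<epsilon>"
  shows "T \<in> compact_ops"
proof (rule compact_opsI[OF T])
  fix \<epsilon> :: real
  assume "\<epsilon> > 0"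
  then have "\<epsilon> / 2 > 0"
    by simp
  from approx[OF this] obtain S where S: "S \<in> compact_ops" "onorm (\<lambda>f. T f - S f) \<le> \<epsilon> / 2"
    by (rule bexE)
  from compact_ops_approx[OF S(1) \<open>\<epsilon> / 2 > 0\<close>] obtain K n where K: "K \<in> bounded_ops" "rank_at_most n K" "onorm (\<lambda>f. S f - K f) \<le> \<epsilon> / 2"
    by (elim bexE exE conjE)
  have "onorm (\<lambda>f. (T f - S f) + (S f - K f)) \<le> \<epsilon>"
    using S(2) K(3)
    by (intro onorm_triangle_le bounded_ops_linear[OF bounded_ops_minus] T compact_ops_bounded S(1) K(1)) simp
  then show "\<exists>K\<in>bounded_ops. \<exists>n. rank_at_most n K \<and> onorm (\<lambda>f. T f - K f) \<le> \<epsilon>"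
    using K by (intro bexI[of _ K] exI[of _ n] conjI) simp_all
qed

section \<open>Identification of the average with the projection, and compactness\<close>

context averaging_params
begin

text \<open>The two sides of the weak identity integrate the conjugated symbol against k and against
  \<open>Phi H\<close>. By \<open>inversion_level\<close> these agree on cut-offs, and
  \<open>integral_level_sets_eq_0\<close> extends the agreement to every square integrable symbol:
  \<open>Phi H\<close> is the average of k over level sets.\<close>

lemma avg_distorted_hankel:
  assumes "G \<in> hs_distorted_hankel \<alpha> \<beta>"
  shows "avg G = G"
proof -
  obtain \<phi> where sq: "square_integrable quadrant (\<lambda>p. \<phi> (s p))" and G: "G = integral_op (\<lambda>p. \<phi> (s p))"
    using assms by (rule hs_distorted_hankelE)
  note sq_cnj = square_integrable_cnj[OF sq]
  \<comment> \<open>A Borel version of the symbol, changed only at nonpositive levels, which the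
    quadrant never attains.\<close>
  define \<phi>\<^sub>0 where "\<phi>\<^sub>0 t = indicator {0<..} t *\<^sub>R \<phi> t" for t
  have [measurable]: "\<phi>\<^sub>0 \<in> borel_measurable borel"
    unfolding \<phi>\<^sub>0_def[abs_def]
    by (rule borel_measurable_of_level_fun[OF \<alpha>(1) \<beta>(1)]) (use sq in \<open>simp add: square_integrable_def\<close>)
  have \<phi>\<^sub>0: "\<phi>\<^sub>0 (s p) = \<phi> (s p)" if "p \<in> space quadrant" for p
    using s_pos[OF that] by (simp add: \<phi>\<^sub>0_def)
  have symbol: "cinner (e z) (G (d z)) = (LINT p|quadrant. cnj (\<phi> (s p)) * E z p)" if z: "z \<in> space V" for z
  proof -
    have "cinner (e z) (G (d z)) = cnj (cinner (G (d z)) (e z))"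
      by (rule cinner_commute)
    also have "cinner (G (d z)) (e z) = (LINT p|quadrant. \<phi> (s p) * ev_fun \<beta> (pt z) (snd p) * cnj (ev_fun \<alpha> (cnj (pt z)) (fst p)))"
      unfolding G e_def d_def ev_def by (rule cinner_integral_op_abs[OF sq sq_ev(3)[OF z] sq_ev(2)[OF z]])
    also have "\<dots> = (LINT p|quadrant. \<phi> (s p) * cnj (E z p))"
      by (simp add: cnj_E cnj_ev_fun mult_ac)
    also have "cnj \<dots> = (LINT p|quadrant. cnj (\<phi> (s p) * cnj (E z p)))"
      by (rule Bochner_Integration.integral_cnj[symmetric])
    finally show ?thesis
      by simp
  qed
  show ?thesis
  proof (rule avg_eqI)
    show "G \<in> bounded_ops"
      unfolding G by (rule integral_op_bounded[OF sq])
    fix f g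
    define H where "H z = cinner f (e z) * cinner (d z) g" for z
    define k where "k p = rep_l2 f (fst p) * cnj (rep_l2 g (snd p))" for p
    have H: "H \<in> borel_measurable V" "(\<integral>\<^sup>+z. ennreal (w z * cmod (H z)) \<partial>V) < \<infinity>"
      unfolding H_def[abs_def] by (rule frame_product_measurable frame_product_finite)+
    have k_sq: "square_integrable quadrant k"
      unfolding k_def[abs_def] by (rule square_integrable_tensor)
    note Phi_sq = Phi_square_integrable[OF H]
    have int: "integrable quadrant (\<lambda>p. l p * k p)" "integrable quadrant (\<lambda>p. l p * Phi H (s p))"
      if "square_integrable quadrant l" for l
      using square_integrable_mult_cnj[OF k_sq square_integrable_cnj[OF that]]
        square_integrable_mult_cnj[OF Phi_sq square_integrable_cnj[OF that]]
      by (simp_all add: mult.commute)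
    have "cinner f (G g) = cnj (LINT p|quadrant. \<phi> (s p) * rep_l2 g (snd p) * cnj (rep_l2 f (fst p)))"
      by (subst cinner_commute) (simp only: G cinner_integral_op(1)[OF sq])
    also have "\<dots> = (LINT p|quadrant. cnj (\<phi> (s p) * rep_l2 g (snd p) * cnj (rep_l2 f (fst p))))"
      by (rule Bochner_Integration.integral_cnj[symmetric])
    also have "\<dots> = (LINT p|quadrant. cnj (\<phi> (s p)) * k p)"
      by (simp add: k_def mult_ac)
    finally have left: "cinner f (G g) = (LINT p|quadrant. cnj (\<phi> (s p)) * k p)" .
    have "form G f g = (LINT z|V. H z * (LINT p|quadrant. cnj (\<phi> (s p)) * E z p))"
      unfolding form_def H_def by (intro Bochner_Integration.integral_cong refl) (simp add: symbol)
    also have "\<dots> = (LINT p|quadrant. cnj (\<phi> (s p)) * Phi H (s p))"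
      by (rule Phi_Fubini[OF H sq_cnj])
    finally have right: "form G f g = (LINT p|quadrant. cnj (\<phi> (s p)) * Phi H (s p))" .
    \<comment> \<open>The difference of k and \<open>Phi H\<close> is square integrable but need not
      be integrable. The factor exp(-s), itself square integrable as \<open>E (1, 0)\<close>,
      repairs this, and \<psi> below undoes it.\<close>
    define D where "D p = of_real (exp (- s p)) * (k p - Phi H (s p))" for p
    define \<psi> where "\<psi> t = cnj (\<phi>\<^sub>0 t) * of_real (exp t)" for t
    have [measurable]: "\<psi> \<in> borel_measurable borel"
      unfolding \<psi>_def[abs_def] by measurable
    have \<psi>D: "\<psi> (s p) * D p = cnj (\<phi> (s p)) * k p - cnj (\<phi> (s p)) * Phi H (s p)" if "p \<in> space quadrant" for p
    proof -
      have "complex_of_real (exp (s p)) * of_real (exp (- s p)) = 1"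
        by (simp flip: of_real_mult exp_add)
      then have "\<psi> (s p) * D p = cnj (\<phi>\<^sub>0 (s p)) * (k p - Phi H (s p))"
        unfolding \<psi>_def D_def by (metis (no_types, lifting) mult.assoc mult_1)
      then show ?thesis
        by (simp add: \<phi>\<^sub>0[OF that] right_diff_distrib)
    qed
    have "(LINT p|quadrant. \<psi> (s p) * D p) = 0"
    proof (rule integral_level_sets_eq_0)
      have E: "E (1, 0) p = of_real (exp (- s p))" for p
      proof -
        have "E (1, 0) p = exp (of_real (- s p))"
          by (simp add: E_def pt_def Complex_eq)
        then show ?thesis
          by (simp only: exp_of_real)
      qed
      have "square_integrable quadrant (E (1, 0))"
        by (rule square_integrable_E) (simp add: space_V)
      from int[OF this] show "integrable quadrant D"
        by (simp add: D_def[abs_def] E right_diff_distrib)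
      show "integrable quadrant (\<lambda>p. \<psi> (s p) * D p)"
      proof -
        have "integrable quadrant (\<lambda>p. cnj (\<phi> (s p)) * k p - cnj (\<phi> (s p)) * Phi H (s p))"
          using int[OF sq_cnj] by (rule Bochner_Integration.integrable_diff)
        then show ?thesis
          by (subst Bochner_Integration.integrable_cong[OF refl \<psi>D])
      qed
      fix q
      let ?c = "\<lambda>p. complex_of_real (indicator {..real_of_rat q} (s p) * exp (- s p))"
      have "(LINT p|quadrant. indicator {..real_of_rat q} (s p) *\<^sub>R D p)
          = (LINT p|quadrant. ?c p * k p - ?c p * Phi H (s p))"
        by (simp add: D_def scaleR_conv_of_real right_diff_distrib mult.assoc)
      also have "\<dots> = (LINT p|quadrant. ?c p * k p) - (LINT p|quadrant. ?c p * Phi H (s p))"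
        by (rule Bochner_Integration.integral_diff[OF int[OF square_integrable_cutoff]])
      also have "\<dots> = 0"
        unfolding H_def[abs_def] k_def[abs_def] inversion_level by simp
      finally show "(LINT p|quadrant. indicator {..real_of_rat q} (s p) *\<^sub>R D p) = 0" .
    qed measurable
    moreover have "(LINT p|quadrant. \<psi> (s p) * D p)
        = (LINT p|quadrant. cnj (\<phi> (s p)) * k p - cnj (\<phi> (s p)) * Phi H (s p))"
      by (intro Bochner_Integration.integral_cong refl \<psi>D)
    moreover have "\<dots> = cinner f (G g) - form G f g"
      unfolding left right by (rule Bochner_Integration.integral_diff[OF int[OF sq_cnj]])
    ultimately show "cinner f (G g) = form G f g"
      by simp
  qed
qed

lemma hs_distorted_hankel_diff:
  assumes "S \<in> hs_distorted_hankel \<alpha> \<beta>" "T \<in> hs_distorted_hankel \<alpha> \<beta>"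
  shows "(\<lambda>f. S f - T f) \<in> hs_distorted_hankel \<alpha> \<beta>"
proof -
  obtain \<phi> where \<phi>: "square_integrable quadrant (\<lambda>p. \<phi> (s p))" "S = integral_op (\<lambda>p. \<phi> (s p))"
    using assms(1) by (rule hs_distorted_hankelE)
  obtain \<psi> where \<psi>: "square_integrable quadrant (\<lambda>p. \<psi> (s p))" "T = integral_op (\<lambda>p. \<psi> (s p))"
    using assms(2) by (rule hs_distorted_hankelE)
  show ?thesis
    using hs_distorted_hankelI[of "\<lambda>t. \<phi> t - \<psi> t"] integral_op_diff[OF \<phi>(1) \<psi>(1)] by (simp add: \<phi>(2) \<psi>(2))
qed

lemma trace_class_avg:
  assumes "T \<in> schatten_class 1"
  shows trace_class_avg_in: "avg T \<in> hs_distorted_hankel \<alpha> \<beta>"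
    and trace_class_avg_trace: "R \<in> bounded_ops \<Longrightarrow> \<exists>t. has_trace (avg T \<circ> adjoint_op R) t \<and> has_trace (T \<circ> adjoint_op (avg R)) t"
proof -
  have T: "T \<in> bounded_ops"
    using assms by (simp add: schatten_class_def)
  obtain u v where rep: "integral_rep (count_space (UNIV :: (nat \<times> nat) set)) u v T"
    using nuclear_decomposition[OF assms] by blast
  have N: "sigma_finite_measure (count_space (UNIV :: (nat \<times> nat) set))"
    by (rule sigma_finite_measure_count_space)
  show "avg T \<in> hs_distorted_hankel \<alpha> \<beta>"
    by (rule avg_in_hs_distorted_hankel[OF N rep T])
  show "R \<in> bounded_ops \<Longrightarrow> \<exists>t. has_trace (avg T \<circ> adjoint_op R) t \<and> has_trace (T \<circ> adjoint_op (avg R)) t"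
    by (rule avg_trace[OF N rep T])
qed

lemma hs_distorted_hankel_bounded: "G \<in> hs_distorted_hankel \<alpha> \<beta> \<Longrightarrow> G \<in> bounded_ops"
  by (simp add: hs_distorted_hankel_def schatten_class_def)

text \<open>Symmetry moves the average from T to G, and G is its own average, so T minus its average
  is orthogonal to every G. Conversely, the difference D of two solutions is itself a distorted
  Hankel operator orthogonal to itself, hence zero.\<close>

lemma averaging_projection_hs_eq:
  assumes T: "T \<in> schatten_class 1"
  shows "averaging_projection_hs \<alpha> \<beta> T = avg T"
  unfolding averaging_projection_hs_def
proof (rule the_equality)
  have orthogonal: "has_trace ((\<lambda>f. T f - avg T f) \<circ> adjoint_op G) 0" if G: "G \<in> hs_distorted_hankel \<alpha> \<beta>" for G
  proof -
    obtain t where "has_trace (avg T \<circ> adjoint_op G) t" "has_trace (T \<circ> adjoint_op G) t"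
      using trace_class_avg_trace[OF T hs_distorted_hankel_bounded[OF G]] by (auto simp: avg_distorted_hankel[OF G])
    from has_trace_diff[OF this(2,1)] show ?thesis
      by (simp add: o_def)
  qed
  show "avg T \<in> hs_distorted_hankel \<alpha> \<beta> \<and> (\<forall>G\<in>hs_distorted_hankel \<alpha> \<beta>. trace_pairing (\<lambda>f. T f - avg T f) G = 0)"
    using trace_class_avg_in[OF T] op_trace_eqI[OF orthogonal] by (simp add: trace_pairing_def)
  fix P
  assume P: "P \<in> hs_distorted_hankel \<alpha> \<beta> \<and> (\<forall>G\<in>hs_distorted_hankel \<alpha> \<beta>. trace_pairing (\<lambda>f. T f - P f) G = 0)"
  define D where "D f = avg T f - P f" for f
  have D: "D \<in> hs_distorted_hankel \<alpha> \<beta>"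
    unfolding D_def[abs_def] using P trace_class_avg_in[OF T] by (intro hs_distorted_hankel_diff) auto
  then obtain \<phi> where \<phi>: "square_integrable quadrant (\<lambda>p. \<phi> (s p))" "D = integral_op (\<lambda>p. \<phi> (s p))"
    by (rule hs_distorted_hankelE)
  obtain t where t: "has_trace (D \<circ> adjoint_op D) t" "t = 0 \<longrightarrow> D = (\<lambda>f. 0)"
    using integral_op_trace_self[OF \<phi>(1)] unfolding \<phi>(2)[symmetric] by blast
  \<comment> \<open>T - P is the sum of T - avg T, whose pairing with D vanishes, and D; the pairing
    of T - P with D is thus that of D with itself.\<close>
  have "has_trace ((\<lambda>f. T f - P f) \<circ> adjoint_op D) (0 + t)"
    using has_trace_add[OF orthogonal[OF D] t(1)] by (simp add: o_def D_def)
  from op_trace_eqI[OF this] have "t = 0"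
    using P D by (simp add: trace_pairing_def)
  then have "D f = 0" for f
    using t(2) by simp
  then show "P = avg T"
    by (intro ext) (simp add: D_def)
qed

text \<open>Existence is the symmetry of the form. For uniqueness, pairing with rank-one operators,
  which lie in the trace class, recovers all matrix entries of a bounded operator.\<close>

lemma averaging_projection_eq:
  assumes R: "R \<in> bounded_ops"
  shows "averaging_projection \<alpha> \<beta> R = avg R"
  unfolding averaging_projection_def
proof (rule the_equality)
  have pairing: "trace_pairing T (avg R) = trace_pairing (averaging_projection_hs \<alpha> \<beta> T) R"
    if T: "T \<in> schatten_class 1" for T
  proof -
    obtain t where "has_trace (avg T \<circ> adjoint_op R) t" "has_trace (T \<circ> adjoint_op (avg R)) t"
      using trace_class_avg_trace[OF T R] by blast
    then show ?thesis
      by (simp add: trace_pairing_def averaging_projection_hs_eq[OF T] op_trace_eqI)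
  qed
  then show "avg R \<in> bounded_ops \<and> (\<forall>T\<in>schatten_class 1. trace_pairing T (avg R) = trace_pairing (averaging_projection_hs \<alpha> \<beta> T) R)"
    using avg_bounded[OF R] by simp
  fix X
  assume X: "X \<in> bounded_ops \<and> (\<forall>T\<in>schatten_class 1. trace_pairing T X = trace_pairing (averaging_projection_hs \<alpha> \<beta> T) R)"
  show "X = avg R"
  proof (intro ext l2_eqI_right)
    fix f g
    have "cinner f (X g) = trace_pairing (rank_one f g) X"
      using X unfolding trace_pairing_def by (intro op_trace_eqI[symmetric] rank_one_trace) simp
    also have "\<dots> = trace_pairing (rank_one f g) (avg R)"
      using X pairing rank_one_schatten by simp
    also have "\<dots> = cinner f (avg R g)"
      unfolding trace_pairing_def by (intro op_trace_eqI rank_one_trace avg_bounded R)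
    finally show "cinner f (X g) = cinner f (avg R g)" .
  qed
qed

text \<open>The average of each rank-one operator is a Hilbert--Schmidt distorted Hankel operator
  and hence compact; sums are handled by linearity.\<close>

lemma avg_finite_rank_compact:
  fixes u v :: "nat \<Rightarrow> l2" and n :: nat
  shows "(\<lambda>h. \<Sum>i<n. rank_one (u i) (v i) h) \<in> bounded_ops \<and> avg (\<lambda>h. \<Sum>i<n. rank_one (u i) (v i) h) \<in> compact_ops"
proof (induction n)
  case 0
  have "avg (\<lambda>h. 0) = (\<lambda>h. 0)"
    by (rule avg_eqI[OF bounded_ops_zero]) (simp add: form_def)
  then show ?case
    by (simp add: bounded_ops_zero compact_ops_zero)
next
  case (Suc n)
  have "avg (rank_one (u n) (v n)) \<in> compact_ops"
    using trace_class_avg_in[OF rank_one_schatten, of "u n" "v n"]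
    by (intro schatten_2_compact) (simp add: hs_distorted_hankel_def)
  with Suc.IH show ?case
    by (simp add: avg_add rank_one_bounded bounded_ops_plus compact_ops_add)
qed

lemma avg_compact:
  assumes R: "R \<in> compact_ops"
  shows "avg R \<in> compact_ops"
proof (rule compact_ops_limit)
  have Rb: "R \<in> bounded_ops"
    using R by (rule compact_ops_bounded)
  then show "avg R \<in> bounded_ops"
    by (rule avg_bounded)
  fix \<epsilon> :: real
  assume "\<epsilon> > 0"
  \<comment> \<open>\<open>frame_const\<close> is only known to be nonnegative; adding 1 makes the
    division safe and still leaves an error of at most \<epsilon>.\<close>
  then have pos: "\<epsilon> / (frame_const + 1) > 0"
    using frame_const_nonneg by simp
  obtain K n where K: "K \<in> bounded_ops" "rank_at_most n K" "onorm (\<lambda>f. R f - K f) \<le> \<epsilon> / (frame_const + 1)"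
    using compact_ops_approx[OF R pos] by (elim bexE exE conjE)
  obtain u v where uv: "\<And>h. K h = (\<Sum>i<n. rank_one (u i) (v i) h)"
    using finite_rank_decomposition[OF K(1,2)] by blast
  have "K = (\<lambda>h. \<Sum>i<n. rank_one (u i) (v i) h)"
    using uv by (rule ext)
  then have "avg K \<in> compact_ops"
    using avg_finite_rank_compact by simp
  moreover have "onorm (\<lambda>f. avg R f - avg K f) \<le> \<epsilon>"
  proof -
    note RK = bounded_ops_minus[OF Rb K(1)]
    have "avg (\<lambda>f. (R f - K f) + K f) = (\<lambda>f. avg (\<lambda>f. R f - K f) f + avg K f)"
      by (rule avg_add[OF RK K(1)])
    then have "avg R f = avg (\<lambda>f. R f - K f) f + avg K f" for f
      by (simp add: fun_eq_iff)
    then have "onorm (\<lambda>f. avg R f - avg K f) = onorm (avg (\<lambda>f. R f - K f))"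
      by simp
    also have "\<dots> \<le> frame_const * (\<epsilon> / (frame_const + 1))"
      using onorm_avg[OF RK] mult_left_mono[OF K(3) frame_const_nonneg] by (rule order_trans)
    also have "\<dots> \<le> \<epsilon>"
      using frame_const_nonneg \<open>\<epsilon> > 0\<close> by (simp add: field_simps)
    finally show ?thesis .
  qed
  ultimately show "\<exists>S\<in>compact_ops. onorm (\<lambda>f. avg R f - S f) \<le> \<epsilon>"
    by (intro bexI[of _ "avg K"])
qed

text \<open>One statement covers both spaces, with the same constant. The inclusion in
  \<open>bounded_ops\<close> lets \<open>averaging_projection_eq\<close> replace the definite
  description by the average.\<close>

lemma bounded_operator_on_averaging_projection:
  assumes "W \<subseteq> bounded_ops" and "\<And>R. R \<in> W \<Longrightarrow> avg R \<in> W"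
  shows "bounded_operator_on W (averaging_projection \<alpha> \<beta>)"
  unfolding bounded_operator_on_def
proof (intro conjI ballI allI)
  have W: "R \<in> bounded_ops" if "R \<in> W" for R
    using assms(1) that by blast
  show "averaging_projection \<alpha> \<beta> T \<in> W" if "T \<in> W" for T
    using assms(2)[OF that] by (simp add: averaging_projection_eq[OF W[OF that]])
  show "averaging_projection \<alpha> \<beta> (\<lambda>f. S f + T f) = (\<lambda>f. averaging_projection \<alpha> \<beta> S f + averaging_projection \<alpha> \<beta> T f)"
    if "S \<in> W" "T \<in> W" for S T
    using W[OF that(1)] W[OF that(2)] by (simp add: averaging_projection_eq bounded_ops_plus avg_add)
  show "averaging_projection \<alpha> \<beta> (\<lambda>f. c *\<^sub>C T f) = (\<lambda>f. c *\<^sub>C averaging_projection \<alpha> \<beta> T f)"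
    if "T \<in> W" for c T
    using W[OF that] by (simp add: averaging_projection_eq bounded_ops_cmult avg_scaleC)
  show "\<exists>C. \<forall>T\<in>W. onorm (averaging_projection \<alpha> \<beta> T) \<le> C * onorm T"
    using W by (intro exI[of _ frame_const]) (simp add: averaging_projection_eq onorm_avg)
qed

end

theorem theorem5p3:
  fixes \<alpha> \<beta> :: real
  assumes "\<alpha> \<in> {0<..<1}" and "\<beta> \<in> {0<..<1}"
  shows "bounded_operator_on bounded_ops (averaging_projection \<alpha> \<beta>)
       \<and> bounded_operator_on compact_ops (averaging_projection \<alpha> \<beta>)"
proof -
  interpret averaging_params \<alpha> \<beta>
    using assms by unfold_locales auto
  show ?thesis
    using avg_bounded avg_compact compact_ops_bounded
    by (intro conjI bounded_operator_on_averaging_projection) auto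
qed

end
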